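(* For all $w\in\mathbb C$, $$\frac1{2\pi}\int_{-\infty}^\infty\xi_{\mathbb Q}\!\left(w,\tfrac w2+ix\right)dx=\theta(1)^w\left(\frac{\psi_2^2}{16}-\frac w8-\frac14\right),$$ where $\psi_2=\pi\theta(1)^4=\frac{\pi^2}{\Gamma(3/4)^4}$. In particular, the function $M(x)=\frac1\pi\xi_{\mathbb Q}(0,ix)$ satisfies $\int_{-\infty}^\infty M(x)\,dx=\frac{\psi_2^2}{8}-\frac12$.
   Context: $\theta(t)=\sum_{n\in\mathbb Z}e^{-\pi n^2t}$ for $t>0$, and $\theta(1)^w=e^{w\log\theta(1)}$. $Z_{\mathbb Q}(w,s)=\int_0^\infty\theta(t^2)^s\theta(1/t^2)^{w-s}\frac{dt}{t}$ for $\Re(w)<\Re(s)<0$, continued meromorphically to $\mathbb C^2$; $\xi_{\mathbb Q}(w,s)=\frac{s(s-w)}{2w}Z_{\mathbb Q}(w,s)$ extends to an entire function on $\mathbb C^2$, denoted $\xi_{\mathbb Q}$. *)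

theory Defs
  imports "HOL-Analysis.Analysis"
begin

definition theta :: "real \<Rightarrow> real" where
  "theta t = (\<Sum>\<^sub>\<infinity>n::int. exp (- pi * (real_of_int n)\<^sup>2 * t))"

text \<open>The integral converges absolutely for \<open>Re w < Re s < 0\<close>, and is only used there.\<close>

definition Z_Q_integral :: "complex \<Rightarrow> complex \<Rightarrow> complex" where
  "Z_Q_integral w s =
     (LBINT t:{0<..}. complex_of_real (theta (t\<^sup>2)) powr s
        * complex_of_real (theta (1 / t\<^sup>2)) powr (w - s) / complex_of_real t)"

text \<open>Holomorphy on all of \<open>\<complex>\<^sup>2\<close>: total differentiability at every point, with a
  complex-linear derivative.\<close>

definition entire2 :: "(complex \<Rightarrow> complex \<Rightarrow> complex) \<Rightarrow> bool" where
  "entire2 f \<longleftrightarrow>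
     (\<forall>w s. \<exists>a b. ((\<lambda>p. f (fst p) (snd p)) has_derivative (\<lambda>h. a * fst h + b * snd h)) (at (w, s)))"

text \<open>Uniqueness of the entire extension is the identity theorem, since the region
  \<open>Re w < Re s < 0\<close> is open and nonempty; note that \<open>w \<noteq> 0\<close> there.\<close>

definition xi_Q :: "complex \<Rightarrow> complex \<Rightarrow> complex" where
  "xi_Q = (THE f. entire2 f \<and>
     (\<forall>w s. Re w < Re s \<and> Re s < 0 \<longrightarrow> f w s = s * (s - w) / (2 * w) * Z_Q_integral w s))"

definition psi2 :: real where
  "psi2 = pi * theta 1 ^ 4"

definition M_Q :: "real \<Rightarrow> complex" where
  "M_Q x = 1 / complex_of_real pi * xi_Q 0 (\<i> * complex_of_real x)"

end

theory Submission
  imports Defs "HOL-Complex_Analysis.Complex_Analysis" "HOL-Real_Asymp.Real_Asymp" "HOL-Probability.Probability"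
begin

text \<open>
  Put \<open>G u = e\<^bsup>u/2\<^esup> \<theta>(e\<^bsup>2u\<^esup>)\<close>, an even function by the inversion formula, and \<open>g = ln G\<close>. The substitution
  \<open>t = e\<^sup>u\<close> turns \<open>Z(w,s)\<close> into the integral of \<open>G\<^sup>w e\<^bsup>u(w/2-s)\<^esup>\<close>, and two integrations by parts give
  \<open>\<xi>(w,s) = \<integral> H\<^sub>w(u) e\<^bsup>u(w/2-s)\<^esup> du\<close> with \<open>H\<^sub>w = G\<^sup>w (g'' + w (g'\<^sup>2 - 1/4)) / 2\<close>. This \<open>H\<^sub>w\<close> decays faster
  than every exponential, so the integral is entire in \<open>(w,s)\<close>; on the line \<open>s = w/2 + ix\<close> it is a
  Fourier transform, whose mean is \<open>2\<pi> H\<^sub>w(0)\<close> by Fourier inversion.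

  The value \<open>g''(0)\<close> comes from a Riccati equation for \<open>\<theta>'/\<theta>\<close>. All identities between theta constants
  follow from the duplication formula \<open>\<theta>(t)\<^sup>2 = \<theta>(2t)\<^sup>2 + (\<theta>(t/2) - \<theta>(2t))\<^sup>2\<close>: the defect of each identity
  is invariant under \<open>t \<mapsto> 2t\<close> up to a power of 2 and vanishes as \<open>t \<rightarrow> \<infinity>\<close>. In the same way the
  duplication formulas, being steps of the arithmetic-geometric mean, evaluate complete elliptic
  integrals; this yields the inversion formula without Poisson summation, and \<open>\<theta>(1)\<close> as a Beta value.
\<close>

section \<open>The theta series\<close>

text \<open>The factor \<open>s * (s - w) / (2 * w)\<close> is exactly what makes the integrations
  by parts succeed. With \<open>k = w/2 - s\<close> it holds that
  \<open>s * (s - w) = k^2 - w^2/4\<close>. Moving \<open>k^2\<close> onto \<open>G^w\<close>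
  produces \<open>(G^w)'' = (w g'' + w^2 g'^2) G^w\<close>, the term \<open>w^2/4\<close> turns
  \<open>g'^2\<close> into \<open>g'^2 - 1/4\<close>, and one factor \<open>w\<close> cancels, so no
  pole is left at \<open>w = 0\<close>. The shift by 1/4 matters for growth: \<open>g'\<close> tends
  to 1/2 and -1/2 at the two ends, so \<open>G^w\<close> is only of exponential size and confines
  the original integral to a region of convergence, while \<open>g'^2 - 1/4\<close> and
  \<open>g''\<close> decay doubly exponentially. The series shows this decay for large
  \<open>t\<close> only; evenness carries it to small \<open>t\<close> and also forces
  \<open>g'(0) = 0\<close>. The constant is read off at \<open>u = 0\<close>, that is
  \<open>t = 1\<close>, the fixed point of the inversion: \<open>g'(0)^2 - 1/4 = -1/4\<close>
  contributes \<open>- w/8 - 1/4\<close>, and the inhomogeneous term of the Riccati equation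
  contributes \<open>psi2^2/16\<close>.\<close>

definition is_sq :: "nat \<Rightarrow> real" where
  "is_sq m = (if m \<in> range (\<lambda>n::nat. n\<^sup>2) then 1 else 0)"

text \<open>This is the \<open>k\<close>-th derivative of the power series of \<open>q^(n^2)\<close>
  over the natural numbers \<open>n\<close>. At the nome \<open>q = exp (- pi * t)\<close> theta
  equals \<open>2 * sqser 0 q - 1\<close>, so derivatives of theta come from power series calculus,
  and limits as \<open>t\<close> tends to infinity come from continuity at
  \<open>q = 0\<close>.\<close>

definition sqser :: "nat \<Rightarrow> real \<Rightarrow> real" where
  "sqser k q = (\<Sum>n. (diffs ^^ k) is_sq n * q ^ n)"

lemma summable_diffs_is_sq:
  fixes q :: real
  assumes "\<bar>q\<bar> < 1"
  shows "summable (\<lambda>n. (diffs ^^ k) is_sq n * q ^ n)"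
  using assms
proof (induction k arbitrary: q)
  case 0
  have "summable (\<lambda>n. is_sq n * q ^ n)"
  proof (rule summable_comparison_test')
    show "summable (\<lambda>n. \<bar>q\<bar> ^ n)"
      using 0 by (simp add: summable_geometric)
    show "norm (is_sq n * q ^ n) \<le> \<bar>q\<bar> ^ n" if "n \<ge> 0" for n
      by (auto simp: is_sq_def power_abs)
  qed
  then show ?case by simp
next
  case (Suc k)
  show ?case
    using termdiff_converges[of q 1 "(diffs ^^ k) is_sq"] Suc by simp
qed

lemma DERIV_sqser:
  assumes "\<bar>q\<bar> < 1"
  shows "(sqser k has_real_derivative sqser (Suc k) q) (at q)"
proof -
  obtain K where K: "\<bar>q\<bar> < K" "K < 1"
    using assms dense by blast
  show ?thesis
    unfolding sqser_def[abs_def]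
    using termdiffs_strong[OF summable_diffs_is_sq[of K k], of q] K by simp
qed

lemma isCont_sqser: "\<bar>q\<bar> < 1 \<Longrightarrow> isCont (sqser k) q"
  using DERIV_sqser DERIV_isCont by blast

lemma sqser_0 [simp]: "sqser 0 0 = 1" and sqser_1_0 [simp]: "sqser (Suc 0) 0 = 1"
proof -
  show "sqser 0 0 = 1"
    using powser_zero[of is_sq] by (simp add: sqser_def is_sq_def)
  have "is_sq (Suc 0) = 1"
    unfolding is_sq_def by (metis one_power2 One_nat_def rangeI)
  then show "sqser (Suc 0) 0 = 1"
    using powser_zero[of "diffs is_sq"] by (simp add: sqser_def diffs_def)
qed

lemma sqser_sums_squares:
  assumes "0 \<le> q" "q < 1"
  shows "((\<lambda>n::nat. q ^ n\<^sup>2) has_sum sqser 0 q) UNIV"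
proof -
  have "(\<lambda>n. is_sq n * q ^ n) sums sqser 0 q"
    using summable_diffs_is_sq[of q 0] assms by (simp add: sqser_def summable_sums)
  moreover have "strict_mono (\<lambda>n::nat. n\<^sup>2)"
    by (auto simp: strict_mono_def power_strict_mono)
  ultimately have "(\<lambda>n. is_sq (n\<^sup>2) * q ^ n\<^sup>2) sums sqser 0 q"
    by (subst sums_mono_reindex[where g = "\<lambda>n::nat. n\<^sup>2"]) (auto simp: is_sq_def)
  then have "(\<lambda>n. q ^ n\<^sup>2) sums sqser 0 q"
    by (simp add: is_sq_def)
  then show ?thesis
    using assms by (intro sums_nonneg_imp_has_sum) auto
qed

text \<open>No coefficient of the derivative is negative, and the constant one is
  \<open>is_sq 1 = 1\<close>. This bound makes theta strictly decreasing.\<close>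

lemma sqser_1_ge: 
  assumes "0 \<le> q" "q < 1"
  shows "sqser (Suc 0) q \<ge> 1"
proof -
  have *: "summable (\<lambda>n. diffs is_sq n * q ^ n)"
    using summable_diffs_is_sq[of q 1] assms by simp
  have "is_sq (Suc 0) = 1"
    unfolding is_sq_def by (metis one_power2 One_nat_def rangeI)
  then have "1 = (\<Sum>n\<in>{0}. diffs is_sq n * q ^ n)"
    by (simp add: diffs_def)
  also have "\<dots> \<le> (\<Sum>n. diffs is_sq n * q ^ n)"
    by (rule sum_le_suminf[OF *]) (auto simp: diffs_def is_sq_def assms)
  finally show ?thesis
    by (simp add: sqser_def)
qed

text \<open>The non-negative and the negative integers both run through the squares; the term at 0
  belongs to one half only, whence the correction by 1.\<close>

lemma theta_has_sum:
  assumes "t > 0"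
  shows "((\<lambda>n::int. exp (- pi * (real_of_int n)\<^sup>2 * t)) has_sum (2 * sqser 0 (exp (- pi * t)) - 1)) UNIV"
proof -
  define q where "q = exp (- pi * t)"
  have q: "0 < q" "q < 1"
    using assms by (auto simp: q_def)
  have e: "exp (- pi * (real_of_int n)\<^sup>2 * t) = q ^ (nat \<bar>n\<bar>)\<^sup>2" for n
    unfolding q_def exp_of_nat_mult[symmetric] by (simp add: algebra_simps)
  have s: "((\<lambda>n::nat. q ^ n\<^sup>2) has_sum sqser 0 q) UNIV"
    using q by (intro sqser_sums_squares) auto
  have 1: "((\<lambda>n::int. q ^ (nat \<bar>n\<bar>)\<^sup>2) has_sum sqser 0 q) (range int)"
    using s by (subst has_sum_reindex) (auto simp: o_def)
  have "((\<lambda>n::nat. q ^ n\<^sup>2) has_sum (sqser 0 q - (\<Sum>n\<in>{0}. q ^ n\<^sup>2))) (UNIV - {0})"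
    by (rule has_sum_Diff[OF s]) (use has_sum_finite[of "{0}" "\<lambda>n::nat. q ^ n\<^sup>2"] in auto)
  then have "((\<lambda>n::int. q ^ (nat \<bar>n\<bar>)\<^sup>2) has_sum (sqser 0 q - 1)) ((\<lambda>n. - int n) ` (UNIV - {0}))"
    by (subst has_sum_reindex) (auto simp: o_def inj_on_def)
  moreover have "range int \<inter> (\<lambda>n. - int n) ` (UNIV - {0}) = {}"
    by auto
  ultimately have "((\<lambda>n::int. q ^ (nat \<bar>n\<bar>)\<^sup>2) has_sum (2 * sqser 0 q - 1)) (range int \<union> (\<lambda>n. - int n) ` (UNIV - {0}))"
    using has_sum_Un_disjoint[OF 1] by fastforce
  also have "range int \<union> (\<lambda>n. - int n) ` (UNIV - {0}) = UNIV"
  proof -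
    have "n \<in> range int \<union> (\<lambda>n. - int n) ` (UNIV - {0})" for n
    proof (cases "n \<ge> 0")
      case True then show ?thesis by (metis UnI1 rangeI nonneg_int_cases)
    next
      case False
      then have "n \<in> (\<lambda>n. - int n) ` (UNIV - {0})"
        by (intro image_eqI[of _ _ "nat (- n)"]) auto
      then show ?thesis by (rule UnI2)
    qed
    then show ?thesis by (metis UNIV_eq_I)
  qed
  finally show ?thesis
    unfolding e q_def .
qed

lemma theta_eq: "t > 0 \<Longrightarrow> theta t = 2 * sqser 0 (exp (- pi * t)) - 1"
  unfolding theta_def by (rule infsumI[OF theta_has_sum])

lemma theta_summable: "t > 0 \<Longrightarrow> (\<lambda>n::int. exp (- pi * (real_of_int n)\<^sup>2 * t)) summable_on A"
  using theta_has_sum has_sum_imp_summable summable_on_subset_banach by blast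

text \<open>Summability of reals in this sense is absolute, so Fubini applies. It turns squares of
  theta series into sums over a lattice.\<close>

lemma infsum_Times:
  fixes f :: "'a \<Rightarrow> real" and g :: "'b \<Rightarrow> real"
  assumes "f summable_on A" "g summable_on B"
  shows "(\<lambda>(x,y). f x * g y) summable_on A \<times> B"
    "infsum (\<lambda>(x,y). f x * g y) (A \<times> B) = infsum f A * infsum g B"
proof -
  have "(\<lambda>x. norm (f x)) summable_on A" "(\<lambda>x. norm (g x)) summable_on B"
    using assms summable_on_iff_abs_summable_on_real by blast+
  then have "(\<lambda>p. norm (case p of (x,y) \<Rightarrow> f x * g y)) summable_on A \<times> B"
    by (subst Infinite_Sum.abs_summable_on_Sigma_iff)
       (auto simp: abs_mult infsum_cmult_right' infsum_nonneg
         intro!: summable_on_cmult_left summable_on_cmult_right)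
  then show *: "(\<lambda>(x,y). f x * g y) summable_on A \<times> B"
    using summable_on_iff_abs_summable_on_real by blast
  from infsum_Sigma'_banach[OF this]
  show "infsum (\<lambda>(x,y). f x * g y) (A \<times> B) = infsum f A * infsum g B"
    by (simp add: infsum_cmult_left' infsum_cmult_right')
qed

text \<open>Rotating the square lattice by \<open>(m, n) \<mapsto> (m + n, m - n)\<close> maps it onto the pairs of equal parity.\<close>

lemma theta_duplication:
  assumes "t > 0"
  shows "theta t ^ 2 = theta (2 * t) ^ 2 + (theta (t / 2) - theta (2 * t)) ^ 2"
proof -
  define e where "e = (\<lambda>t n. exp (- pi * (real_of_int n)\<^sup>2 * t))"
  define F where "F = (\<lambda>(x, y). e (t / 2) x * e (t / 2) y)"
  define E :: "int set" where "E = {n. even n}"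
  define D :: "int set" where "D = {n. odd n}"
  have sm: "e s summable_on A" if "s > 0" for s A
    unfolding e_def using theta_summable[OF that] .
  have th: "infsum (e s) UNIV = theta s" for s
    by (simp add: e_def theta_def)
  have sE: "infsum (e (t / 2)) E = theta (2 * t)"
  proof -
    have "infsum (e (t / 2)) E = infsum (\<lambda>n. e (t / 2) (2 * n)) UNIV"
      by (rule infsum_reindex_bij_betw[symmetric])
        (auto simp: E_def bij_betw_def inj_on_def dvd_def)
    also have "(\<lambda>n. e (t / 2) (2 * n)) = e (2 * t)"
      by (auto simp: e_def power2_eq_square)
    finally show ?thesis using th by simp
  qed
  have sD: "infsum (e (t / 2)) D = theta (t / 2) - theta (2 * t)"
  proof -
    have "infsum (e (t / 2)) (E \<union> D) = infsum (e (t / 2)) E + infsum (e (t / 2)) D"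
      by (rule infsum_Un_disjoint) (auto simp: E_def D_def intro!: sm assms)
    moreover have "E \<union> D = UNIV" by (auto simp: E_def D_def)
    ultimately show ?thesis by (simp add: sE th)
  qed
  have "theta t ^ 2 = infsum (\<lambda>(m, n). e t m * e t n) (UNIV \<times> UNIV)"
    using infsum_Times(2)[OF sm[OF assms, of UNIV] sm[OF assms, of UNIV]]
    by (simp add: th power2_eq_square)
  also have "\<dots> = infsum F (E \<times> E \<union> D \<times> D)"
  proof (rule infsum_reindex_bij_betw[where g = "\<lambda>(m, n). (m + n, m - n)" and f = F, THEN trans[rotated]])
    show "bij_betw (\<lambda>(m, n). (m + n, m - n)) (UNIV \<times> UNIV) (E \<times> E \<union> D \<times> D)"
    proof (rule bij_betwI[where g = "\<lambda>(x, y). ((x + y) div 2, (x - y) div 2)"])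
      show "(case case p of (x, y) \<Rightarrow> ((x + y) div 2, (x - y) div 2) of (m, n) \<Rightarrow> (m + n, m - n)) = p"
        if "p \<in> E \<times> E \<union> D \<times> D" for p
      proof -
        obtain x y where p: "p = (x, y)" by force
        have "even (x + y)" "even (x - y)"
          using that p by (auto simp: E_def D_def)
        then have "2 * ((x + y) div 2) = x + y" "2 * ((x - y) div 2) = x - y"
          by simp_all
        then show ?thesis unfolding p prod.case by (intro prod_eqI; simp; linarith)
      qed
    qed (auto simp: E_def D_def)
    have "e t m * e t n = F (m + n, m - n)" for m n
    proof -
      have "- pi * (real_of_int (m + n))\<^sup>2 * (t / 2) + - pi * (real_of_int (m - n))\<^sup>2 * (t / 2)
        = - pi * (real_of_int m)\<^sup>2 * t + - pi * (real_of_int n)\<^sup>2 * t"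
        by (simp add: power2_eq_square field_simps)
      then show ?thesis
        by (simp add: F_def e_def mult_exp_exp)
    qed
    then show "infsum (\<lambda>(m, n). e t m * e t n) (UNIV \<times> UNIV)
      = infsum (\<lambda>x. F (case x of (m, n) \<Rightarrow> (m + n, m - n))) (UNIV \<times> UNIV)"
      by (intro infsum_cong) auto
  qed
  also have "\<dots> = infsum F (E \<times> E) + infsum F (D \<times> D)"
    unfolding F_def using assms
    by (intro infsum_Un_disjoint infsum_Times(1) sm) (auto simp: E_def D_def)
  also have "\<dots> = theta (2 * t) ^ 2 + (theta (t / 2) - theta (2 * t)) ^ 2"
    unfolding F_def using assms by (simp add: infsum_Times(2) sm sE sD power2_eq_square)
  finally show ?thesis .
qed

section \<open>Duplication and the Riccati equation\<close>

definition dtheta :: "real \<Rightarrow> real" where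
  "dtheta t = - (2 * pi * exp (- pi * t) * sqser (Suc 0) (exp (- pi * t)))"

definition ddtheta :: "real \<Rightarrow> real" where
  "ddtheta t = 2 * pi\<^sup>2 * (exp (- pi * t) * sqser (Suc 0) (exp (- pi * t))
     + (exp (- pi * t))\<^sup>2 * sqser (Suc (Suc 0)) (exp (- pi * t)))"

text \<open>\<open>thetab\<close> and \<open>thetac\<close> are the Jacobi theta constants \<open>\<theta>\<^sub>4 = \<Sum> (-1)\<^sup>n q\<^bsup>n\<^sup>2\<^esup>\<close> and \<open>\<theta>\<^sub>2 = \<Sum> q\<^bsup>(n+1/2)\<^sup>2\<^esup>\<close> with
  nome \<open>q = e\<^bsup>-\<pi>t\<^esup>\<close>, written through \<open>theta = \<theta>\<^sub>3\<close>.\<close>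

definition thetab :: "real \<Rightarrow> real" where
  "thetab t = 2 * theta (4 * t) - theta t"

definition thetac :: "real \<Rightarrow> real" where
  "thetac t = theta (t / 4) - theta t"

definition ltheta :: "real \<Rightarrow> real" where
  "ltheta t = dtheta t / theta t"

section \<open>Monotonicity, derivatives and limits of theta\<close>

lemma sqser_strict_mono:
  assumes "0 \<le> x" "x < y" "y < 1"
  shows "sqser 0 x < sqser 0 y"
proof (rule DERIV_pos_imp_increasing[OF assms(2)])
  fix z assume "x \<le> z" "z \<le> y"
  then show "\<exists>d. (sqser 0 has_real_derivative d) (at z) \<and> 0 < d"
    using DERIV_sqser[of z 0] sqser_1_ge[of z] assms by (intro exI[of _ "sqser (Suc 0) z"]) auto
qed

lemma theta_antimono: "0 < s \<Longrightarrow> s < t \<Longrightarrow> theta t < theta s"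
  using sqser_strict_mono[of "exp (- pi * t)" "exp (- pi * s)"] by (simp add: theta_eq)

lemma theta_gt_1: "t > 0 \<Longrightarrow> theta t > 1"
  using sqser_strict_mono[of 0 "exp (- pi * t)"] by (simp add: theta_eq)

lemma theta_pos: "t > 0 \<Longrightarrow> theta t > 0"
  using theta_gt_1[of t] by simp

lemma DERIV_theta:
  assumes "t > 0"
  shows "(theta has_real_derivative dtheta t) (at t)"
proof -
  have d: "((\<lambda>t. 2 * sqser 0 (exp (- pi * t)) - 1) has_real_derivative dtheta t) (at t)"
    using assms unfolding dtheta_def
    by (auto intro!: derivative_eq_intros DERIV_chain'[OF _ DERIV_sqser])
  show ?thesis
    by (rule has_field_derivative_transform_within_open[OF d, of "{0<..}"])
      (use assms theta_eq in auto)
qed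

lemma DERIV_dtheta:
  assumes "t > 0"
  shows "(dtheta has_real_derivative ddtheta t) (at t)"
  unfolding dtheta_def[abs_def] ddtheta_def
  using assms by (auto intro!: derivative_eq_intros DERIV_chain'[OF _ DERIV_sqser]
     simp: algebra_simps power2_eq_square)

lemma nome_tendsto: "k > 0 \<Longrightarrow> ((\<lambda>t. exp (- pi * (k * t))) \<longlongrightarrow> 0) at_top"
  by real_asymp

lemma sqser_nome_tendsto: 
  assumes "k > 0" shows "((\<lambda>t. sqser j (exp (- pi * (k * t)))) \<longlongrightarrow> sqser j 0) at_top"
  using isCont_tendsto_compose[OF isCont_sqser nome_tendsto[OF assms], of j] by simp

lemma theta_tendsto: assumes "k > 0" shows "((\<lambda>t. theta (k * t)) \<longlongrightarrow> 1) at_top"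
proof -
  have "((\<lambda>t. 2 * sqser 0 (exp (- pi * (k * t))) - 1) \<longlongrightarrow> 2 * sqser 0 0 - 1) at_top"
    by (intro tendsto_intros sqser_nome_tendsto assms)
  moreover have "\<forall>\<^sub>F t in at_top. 2 * sqser 0 (exp (- pi * (k * t))) - 1 = theta (k * t)"
    using eventually_gt_at_top[of 0] by eventually_elim (simp add: theta_eq assms)
  ultimately show ?thesis
    using tendsto_cong by fastforce
qed

lemma thetab_tendsto: "(thetab \<longlongrightarrow> 1) at_top"
proof -
  have "((\<lambda>t. 2 * theta (4 * t) - theta (1 * t)) \<longlongrightarrow> 2 * 1 - 1) at_top"
    by (intro tendsto_intros theta_tendsto) auto
  then show ?thesis by (simp add: thetab_def[abs_def])
qed

section \<open>Duplication formulas and Jacobi's quartic identity\<close>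

lemma theta_sq: "t > 0 \<Longrightarrow> theta t ^ 2 = theta (2 * t) ^ 2 + thetac (2 * t) ^ 2"
  using theta_duplication[of t] by (simp add: thetac_def)

text \<open>With \<open>a = theta t\<close> and \<open>b = theta (4 * t)\<close> this is the
  identity \<open>(2b - a)^2 + a^2 = 2 (b^2 + (a - b)^2)\<close>, whose right-hand bracket is
  \<open>theta (2 * t) ^ 2\<close> by duplication.\<close>

lemma thetab_sq: 
  assumes "t > 0" shows "thetab t ^ 2 = theta (2 * t) ^ 2 - thetac (2 * t) ^ 2"
proof -
  have "theta (2 * t) ^ 2 = theta (4 * t) ^ 2 + (theta t - theta (4 * t)) ^ 2"
    using theta_duplication[of "2 * t"] assms by simp
  then have "thetab t ^ 2 = 2 * theta (2 * t) ^ 2 - theta t ^ 2"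
    unfolding thetab_def by (simp add: power2_eq_square algebra_simps)
  then show ?thesis using theta_sq[OF assms] by simp
qed

lemma thetac_sq: 
  assumes "t > 0" shows "thetac t ^ 2 = 2 * theta (2 * t) * thetac (2 * t)"
proof -
  have "theta (t / 2) ^ 2 = theta t ^ 2 + thetac t ^ 2"
    using theta_duplication[of "t / 2"] assms by (simp add: thetac_def)
  moreover have "theta (t / 2) = theta (2 * t) + thetac (2 * t)"
    by (simp add: thetac_def)
  ultimately show ?thesis
    using theta_sq[OF assms] by (simp add: power2_eq_square algebra_simps)
qed

text \<open>In \<open>x = theta (2 * t) ^ 2\<close> and \<open>y = thetac (2 * t) ^ 2\<close> it
  reads \<open>(x + y)^2 = (x - y)^2 + 4 x y\<close>.\<close>

lemma jacobi_quartic: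
  assumes "t > 0" shows "theta t ^ 4 = thetab t ^ 4 + thetac t ^ 4"
proof -
  have "(theta t ^ 2) ^ 2 = (thetab t ^ 2) ^ 2 + (thetac t ^ 2) ^ 2"
    unfolding theta_sq[OF assms] thetab_sq[OF assms] thetac_sq[OF assms]
    by (simp add: power2_eq_square algebra_simps)
  then show ?thesis by simp
qed

text \<open>Factor the difference of fourth powers at \<open>2 * t\<close>. The identity is kept in
  squared form because the positivity of \<open>thetab\<close>, which is needed to take the root, is
  itself deduced from it.\<close>

lemma thetab_quartic:
  assumes "t > 0" shows "theta t ^ 2 * thetab t ^ 2 = thetab (2 * t) ^ 4"
proof -
  have "theta t ^ 2 * thetab t ^ 2 = theta (2 * t) ^ 4 - thetac (2 * t) ^ 4"
    unfolding theta_sq[OF assms] thetab_sq[OF assms]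
    by (simp add: eval_nat_numeral algebra_simps)
  then show ?thesis using jacobi_quartic[of "2 * t"] assms by simp
qed

lemma thetac_pos: "t > 0 \<Longrightarrow> thetac t > 0"
  using theta_antimono[of "t / 4" t] by (simp add: thetac_def)

definition dthetab :: "real \<Rightarrow> real" where
  "dthetab t = 8 * dtheta (4 * t) - dtheta t"

definition dthetac :: "real \<Rightarrow> real" where
  "dthetac t = dtheta (t / 4) / 4 - dtheta t"

lemma DERIV_scale: 
  "(f has_real_derivative d) (at (k * t)) \<Longrightarrow> ((\<lambda>t. f (k * t)) has_real_derivative k * d) (at t)"
  by (subst mult.commute, rule DERIV_chain2) (auto intro!: derivative_eq_intros)

lemma DERIV_theta_scale: 
  "k * t > 0 \<Longrightarrow> ((\<lambda>t. theta (k * t)) has_real_derivative k * dtheta (k * t)) (at t)"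
  by (rule DERIV_scale[OF DERIV_theta])

lemma DERIV_thetab: "t > 0 \<Longrightarrow> (thetab has_real_derivative dthetab t) (at t)"
  unfolding thetab_def[abs_def] dthetab_def
  by (auto intro!: derivative_eq_intros DERIV_theta_scale DERIV_theta)

lemma DERIV_thetac: "t > 0 \<Longrightarrow> (thetac has_real_derivative dthetac t) (at t)"
  unfolding thetac_def[abs_def] dthetac_def
  using DERIV_theta_scale[of "1/4" t]
  by (auto intro!: derivative_eq_intros DERIV_theta)

text \<open>The series of \<open>thetab\<close> alternates in sign, so positivity is not visible
  termwise. A non-positive value forces a zero \<open>s\<close> by the intermediate value theorem,
  as \<open>thetab\<close> tends to 1. By \<open>thetab_quartic\<close> the zero propagates to every
  \<open>2 ^ n * s\<close>, against the same limit.\<close>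

lemma thetab_pos: 
  assumes "t > 0" shows "thetab t > 0"
proof (rule ccontr)
  assume neg: "\<not> thetab t > 0"
  have "\<forall>\<^sub>F s in at_top. thetab s > 0"
    using order_tendstoD(1)[OF thetab_tendsto, of 0] by simp
  then obtain T where T: "\<And>s. s \<ge> T \<Longrightarrow> thetab s > 0"
    by (auto simp: eventually_at_top_linorder)
  have "\<exists>s. t \<le> s \<and> s \<le> max t T \<and> thetab s = 0"
  proof (rule IVT')
    show "continuous_on {t..max t T} thetab"
      using assms by (intro continuous_at_imp_continuous_on) (auto intro!: DERIV_isCont DERIV_thetab)
  qed (use neg T[of "max t T"] in auto)
  then obtain s where "t \<le> s" and s0: "thetab s = 0"
    by blast
  then have s: "s > 0" "thetab s = 0"
    using assms by auto
  have z: "thetab (2 ^ n * s) = 0" for n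
  proof (induction n)
    case (Suc n)
    then show ?case
      using thetab_quartic[of "2 ^ n * s"] s by (simp add: mult.assoc)
  qed (use s in simp)
  obtain n where "T / s < 2 ^ n"
    using real_arch_pow[of 2] by auto
  then have "2 ^ n * s \<ge> T"
    using s by (simp add: field_simps)
  from T[OF this] z show False by simp
qed

text \<open>This is the geometric half of a step of the arithmetic-geometric mean on the squares of
  \<open>theta\<close> and \<open>thetab\<close>; the arithmetic half is the sum of
  \<open>theta_sq\<close> and \<open>thetab_sq\<close>.\<close>

lemma thetab_duplication:
  assumes "t > 0" shows "theta t * thetab t = thetab (2 * t) ^ 2"
proof (rule power2_eq_imp_eq)
  show "(theta t * thetab t)\<^sup>2 = ((thetab (2 * t))\<^sup>2)\<^sup>2"
    using thetab_quartic[OF assms] by (simp add: power_mult_distrib)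
qed (use assms theta_pos thetab_pos in \<open>simp_all add: less_imp_le\<close>)

lemma doubling_invariant_eq_limit:
  fixes f :: "real \<Rightarrow> real"
  assumes "\<And>t. t > 0 \<Longrightarrow> f (2 * t) = f t" and lim: "(f \<longlongrightarrow> L) at_top" and "t > 0"
  shows "f t = L"
proof -
  have "f (2 ^ n * t) = f t" for n
    by (induction n) (use assms(1)[of "2 ^ _ * t"] \<open>t > 0\<close> in \<open>auto simp: mult.assoc\<close>)
  moreover have "filterlim (\<lambda>n. 2 ^ n * t) at_top sequentially"
    using \<open>t > 0\<close> by real_asymp
  ultimately have "(\<lambda>n::nat. f t) \<longlonglongrightarrow> L"
    using filterlim_compose[OF lim] by fastforce
  then show ?thesis
    by (simp add: LIMSEQ_const_iff)
qed

section \<open>Logarithmic derivatives under doubling, limits at infinity, and the Riccati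
  equation\<close>

lemma dtheta_logderiv:
  assumes "t > 0"
  shows "theta t * dtheta t = 2 * (theta (2*t) * dtheta (2*t) + thetac (2*t) * dthetac (2*t))"
proof -
  have c2: "((\<lambda>t. thetac (2 * t)) has_real_derivative 2 * dthetac (2 * t)) (at t)"
    by (rule DERIV_scale[OF DERIV_thetac]) (use assms in simp)
  have a2: "((\<lambda>t. theta (2 * t)) has_real_derivative 2 * dtheta (2 * t)) (at t)"
    by (rule DERIV_scale[OF DERIV_theta]) (use assms in simp)
  have "((\<lambda>t. theta (2 * t) ^ 2 + thetac (2 * t) ^ 2) has_real_derivative
     4 * (theta (2*t) * dtheta (2*t) + thetac (2*t) * dthetac (2*t))) (at t)"
    by (rule DERIV_cong[OF DERIV_add[OF DERIV_power[OF a2] DERIV_power[OF c2]]]) (simp add: algebra_simps)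
  then have "((\<lambda>t. theta t ^ 2) has_real_derivative
     4 * (theta (2*t) * dtheta (2*t) + thetac (2*t) * dthetac (2*t))) (at t)"
    by (rule has_field_derivative_transform_within_open[of _ _ _ "{0<..}"])
       (use assms in \<open>simp_all add: theta_sq[symmetric]\<close>)
  moreover have "((\<lambda>t. theta t ^ 2) has_real_derivative 2 * theta t * dtheta t) (at t)"
    using assms by (auto intro!: derivative_eq_intros DERIV_theta)
  ultimately show ?thesis
    using DERIV_unique by fastforce
qed

lemma dthetac_logderiv:
  assumes "t > 0"
  shows "dthetac t / thetac t = ltheta (2*t) + dthetac (2*t) / thetac (2*t)"
proof -
  have c2: "((\<lambda>t. thetac (2 * t)) has_real_derivative 2 * dthetac (2 * t)) (at t)"
    by (rule DERIV_scale[OF DERIV_thetac]) (use assms in simp)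
  have a2: "((\<lambda>t. theta (2 * t)) has_real_derivative 2 * dtheta (2 * t)) (at t)"
    by (rule DERIV_scale[OF DERIV_theta]) (use assms in simp)
  have "((\<lambda>t. 2 * theta (2 * t) * thetac (2 * t)) has_real_derivative
     4 * (dtheta (2*t) * thetac (2*t) + theta (2*t) * dthetac (2*t))) (at t)"
    by (rule DERIV_cong[OF DERIV_mult[OF DERIV_cmult[OF a2] c2]]) (simp add: algebra_simps)
  then have "((\<lambda>t. thetac t ^ 2) has_real_derivative
     4 * (dtheta (2*t) * thetac (2*t) + theta (2*t) * dthetac (2*t))) (at t)"
    by (rule has_field_derivative_transform_within_open[of _ _ _ "{0<..}"])
       (use assms in \<open>simp_all add: thetac_sq\<close>)
  moreover have "((\<lambda>t. thetac t ^ 2) has_real_derivative 2 * thetac t * dthetac t) (at t)"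
    using assms by (auto intro!: derivative_eq_intros DERIV_thetac)
  ultimately have "thetac t * dthetac t = 2 * (dtheta (2*t) * thetac (2*t) + theta (2*t) * dthetac (2*t))"
    using DERIV_unique by fastforce
  then have "dthetac t / thetac t 
     = 2 * (dtheta (2*t) * thetac (2*t) + theta (2*t) * dthetac (2*t)) / thetac t ^ 2"
    using thetac_pos[OF assms] by (simp add: field_simps power2_eq_square)
  also have "\<dots> = ltheta (2*t) + dthetac (2*t) / thetac (2*t)"
    unfolding thetac_sq[OF assms] ltheta_def
    using theta_pos[of "2*t"] thetac_pos[of "2*t"] assms by (simp add: field_simps)
  finally show ?thesis .
qed

lemma dtheta_tendsto:
  assumes "k > 0" shows "((\<lambda>t. t ^ j * dtheta (k * t)) \<longlongrightarrow> 0) at_top"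
proof -
  have "((\<lambda>t. t ^ j * exp (- pi * (k * t))) \<longlongrightarrow> 0) at_top"
    using assms by real_asymp
  from tendsto_mult[OF this sqser_nome_tendsto[OF assms, of "Suc 0"]]
  have "((\<lambda>t. - 2 * pi * (t ^ j * exp (- pi * (k * t)) * sqser (Suc 0) (exp (- pi * (k * t))))) \<longlongrightarrow> - 2 * pi * 0) at_top"
    by (intro tendsto_mult_left) simp
  then show ?thesis
    by (simp add: dtheta_def mult_ac)
qed

lemma ddtheta_tendsto:
  "((\<lambda>t. t ^ j * ddtheta t) \<longlongrightarrow> 0) at_top"
proof -
  have 1: "((\<lambda>t. t ^ j * exp (- pi * (1 * t))) \<longlongrightarrow> 0) at_top"
    by real_asymp
  have "((\<lambda>t. 2 * pi\<^sup>2 * ((t ^ j * exp (- pi * (1 * t))) * (sqser (Suc 0) (exp (- pi * (1 * t)))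
     + exp (- pi * (1 * t)) * sqser (Suc (Suc 0)) (exp (- pi * (1 * t)))))) \<longlongrightarrow> 
      2 * pi\<^sup>2 * (0 * (sqser (Suc 0) 0 + 0 * sqser (Suc (Suc 0)) 0))) at_top"
    by (intro tendsto_intros 1 nome_tendsto sqser_nome_tendsto) auto
  then show ?thesis
    by (simp add: ddtheta_def algebra_simps power2_eq_square)
qed

text \<open>Powers of \<open>t\<close> are carried along because invariance under doubling is
  reached only after multiplying a defect of weight 4 by \<open>t ^ 2\<close>.\<close>

lemma ltheta_tendsto:
  "((\<lambda>t. t ^ j * ltheta t) \<longlongrightarrow> 0) at_top"
proof -
  have "((\<lambda>t. (t ^ j * dtheta (1 * t)) / theta (1 * t)) \<longlongrightarrow> 0 / 1) at_top"
    by (intro tendsto_intros theta_tendsto dtheta_tendsto) auto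
  then show ?thesis
    by (simp add: ltheta_def)
qed

text \<open>The nome of the arguments \<open>t / 4\<close> and \<open>t\<close> is \<open>q\<close> and \<open>q ^ 4\<close>, so \<open>thetac t\<close> is \<open>2 q\<close>
  to first order.\<close>

lemma thetac_exp_tendsto:
  "((\<lambda>t. thetac t * exp (pi * t / 4)) \<longlongrightarrow> 2) at_top" (is "?A")
  and dthetac_exp_tendsto: "((\<lambda>t. dthetac t * exp (pi * t / 4)) \<longlongrightarrow> - pi / 2) at_top" (is "?B")
proof -
  define q where "q = (\<lambda>t. exp (- (pi * t / 4)))"
  have q0: "(q \<longlongrightarrow> 0) at_top"
    unfolding q_def by real_asymp
  have qpos: "q t > 0" for t by (simp add: q_def)
  have q4: "q t ^ 4 = exp (- pi * t)" for t
    unfolding q_def exp_of_nat_mult[symmetric] by simp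
  have q1: "exp (- (pi * t / 4)) = q t" for t
    by (simp add: q_def)
  have qexp: "exp (pi * t / 4) = 1 / q t" for t
    by (simp add: q_def exp_minus field_simps)
  have fl: "filterlim q (at 0) at_top"
    using q0 qpos by (auto simp: filterlim_at less_imp_neq[symmetric] intro!: always_eventually)
  \<comment> \<open>With nome \<open>q\<close> at \<open>t / 4\<close> and \<open>q ^ 4\<close> at
    \<open>t\<close>, \<open>thetac t / q\<close> is twice the difference quotient at 0 of this
    function, whose derivative there is 1.\<close>
  have "((\<lambda>x. sqser 0 x - sqser 0 (x ^ 4)) has_real_derivative sqser (Suc 0) 0 - 0) (at 0)"
    by (auto intro!: derivative_eq_intros DERIV_sqser DERIV_chain'[OF _ DERIV_sqser])
  then have "((\<lambda>x. (sqser 0 x - sqser 0 (x ^ 4)) / x) \<longlongrightarrow> 1) (at 0)"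
    by (simp add: DERIV_def)
  from tendsto_mult_left[OF filterlim_compose[OF this fl], of 2]
  have "((\<lambda>t. 2 * ((sqser 0 (q t) - sqser 0 (q t ^ 4)) / q t)) \<longlongrightarrow> 2) at_top"
    by simp
  moreover have "\<forall>\<^sub>F t in at_top. 2 * ((sqser 0 (q t) - sqser 0 (q t ^ 4)) / q t) = thetac t * exp (pi * t / 4)"
    using eventually_gt_at_top[of 0] 
    by eventually_elim (simp add: thetac_def theta_eq q4 q1 qexp diff_divide_distrib)
  ultimately show ?A
    using tendsto_cong by fastforce
  have "((\<lambda>t. - pi / 2 * (sqser (Suc 0) (q t) - 4 * q t ^ 3 * sqser (Suc 0) (q t ^ 4))) \<longlongrightarrow> 
     - pi / 2 * (sqser (Suc 0) 0 - 4 * 0 ^ 3 * sqser (Suc 0) (0 ^ 4))) at_top"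
    by (intro tendsto_intros isCont_tendsto_compose[OF isCont_sqser] q0) auto
  moreover have "- pi / 2 * (sqser (Suc 0) (q t) - 4 * q t ^ 3 * sqser (Suc 0) (q t ^ 4)) = dthetac t * exp (pi * t / 4)" for t
  proof -
    have "dthetac t = - pi / 2 * (q t * sqser (Suc 0) (q t) - 4 * q t ^ 4 * sqser (Suc 0) (q t ^ 4))"
      unfolding q4 by (simp add: dthetac_def dtheta_def q_def algebra_simps)
    then show ?thesis
      using qpos[of t] by (simp add: qexp field_simps eval_nat_numeral)
  qed
  ultimately show ?B
    by simp
qed

text \<open>This computes the logarithmic derivative of \<open>thetac / theta\<close>. Dividing by
  \<open>thetab t ^ 4\<close> makes it invariant under doubling. Its limit comes from
  \<open>thetac t\<close> being asymptotic to \<open>2 exp (- pi t / 4)\<close>, while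
  \<open>ltheta\<close> tends to 0 and \<open>thetab\<close> to 1.\<close>

lemma logderiv_thetac_sub_ltheta:
  assumes "t > 0"
  shows "dthetac t / thetac t - ltheta t = - (pi / 4) * thetab t ^ 4"
proof -
  define f where "f = (\<lambda>t. (dthetac t / thetac t - ltheta t) / thetab t ^ 4)"
  have "f (2 * t) = f t" if "t > 0" for t
  proof -
    define a b A B C u v where "a = theta t" and "b = thetab t" and "A = theta (2*t)"
      and "B = thetab (2*t)" and "C = thetac (2*t)" and "u = ltheta (2*t)" 
      and "v = dthetac (2*t) / thetac (2*t)"
    have pos: "a > 0" "b > 0" "A > 0" "B > 0" "C > 0"
      using that theta_pos thetab_pos thetac_pos by (auto simp: a_def b_def A_def B_def C_def)
    have eq: "a^2 = A^2 + C^2" "b^2 = A^2 - C^2" "B^4 = a^2 * b^2"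
      using theta_sq[OF that] thetab_sq[OF that] thetab_quartic[OF that]
      by (simp_all add: a_def b_def A_def B_def C_def)
    have "a ^ 2 * ltheta t = 2 * (A^2 * u + C^2 * v)"
      using dtheta_logderiv[OF that] pos
      unfolding ltheta_def u_def v_def
      by (simp add: a_def A_def C_def power2_eq_square)
    then have lt: "ltheta t = 2 * (A^2 * u + C^2 * v) / a^2"
      using pos by (simp add: field_simps)
    have "dthetac t / thetac t - ltheta t = u + v - 2 * (A^2 * u + C^2 * v) / a^2"
      using dthetac_logderiv[OF that] lt by (simp add: u_def v_def)
    also have "\<dots> = ((u + v) * a^2 - 2 * (A^2 * u + C^2 * v)) / a^2"
      using pos by (simp add: field_simps)
    \<comment> \<open>Here the two duplication formulas meet: replacing \<open>a^2\<close> by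
      \<open>A^2 + C^2\<close> leaves \<open>(v - u) * (A^2 - C^2)\<close>, and the bracket is
      \<open>b^2\<close>.\<close>
    also have "(u + v) * a^2 - 2 * (A^2 * u + C^2 * v) = (v - u) * b^2"
      unfolding eq by (simp add: algebra_simps)
    finally have "f t = ((v - u) * b^2 / a^2) / b^4"
      by (simp add: f_def b_def)
    also have "\<dots> = (v - u) / (a^2 * b^2)"
      using pos by (simp add: field_simps eval_nat_numeral)
    also have "\<dots> = f (2 * t)"
      using eq by (simp add: f_def B_def u_def v_def)
    finally show ?thesis by simp
  qed
  moreover have "(f \<longlongrightarrow> - (pi / 4)) at_top"
  proof -
    have "((\<lambda>t. ((dthetac t * exp (pi * t / 4)) / (thetac t * exp (pi * t / 4)) - t ^ 0 * ltheta t) / thetab t ^ 4) \<longlongrightarrow>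
       ((- pi / 2) / 2 - 0) / 1 ^ 4) at_top"
      by (intro tendsto_intros ltheta_tendsto thetab_tendsto thetac_exp_tendsto dthetac_exp_tendsto) auto
    then show ?thesis
      by (simp add: f_def)
  qed
  ultimately have "f t = - (pi / 4)"
    using assms by (rule doubling_invariant_eq_limit)
  then show ?thesis
    using thetab_pos[OF assms] by (simp add: f_def field_simps)
qed

lemma DERIV_theta': "t > 0 \<Longrightarrow> (theta has_real_derivative theta t * ltheta t) (at t)"
  using DERIV_theta[of t] theta_pos[of t] by (simp add: ltheta_def)

lemma DERIV_thetac':
  assumes "t > 0"
  shows "(thetac has_real_derivative thetac t * (ltheta t - pi / 4 * thetab t ^ 4)) (at t)"
proof -
  have "dthetac t = thetac t * (ltheta t - pi / 4 * thetab t ^ 4)"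
    using logderiv_thetac_sub_ltheta[OF assms] thetac_pos[OF assms] by (simp add: field_simps)
  then show ?thesis
    using DERIV_thetac[OF assms] by simp
qed

text \<open>Differentiating Jacobi's identity determines the derivative of \<open>thetab\<close>
  from those of \<open>theta\<close> and \<open>thetac\<close>.\<close>

lemma DERIV_thetab':
  assumes "t > 0"
  shows "(thetab has_real_derivative thetab t * (ltheta t + pi / 4 * thetac t ^ 4)) (at t)"
proof -
  have "((\<lambda>t. theta t ^ 4) has_real_derivative 4 * theta t ^ 4 * ltheta t) (at t)"
    using assms by (auto intro!: derivative_eq_intros DERIV_theta' simp: eval_nat_numeral)
  then have "((\<lambda>t. thetab t ^ 4 + thetac t ^ 4) has_real_derivative 4 * theta t ^ 4 * ltheta t) (at t)"
    by (rule has_field_derivative_transform_within_open[of _ _ _ "{0<..}"])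
       (use assms in \<open>simp_all add: jacobi_quartic\<close>)
  moreover have "((\<lambda>t. thetab t ^ 4 + thetac t ^ 4) has_real_derivative
     4 * thetab t ^ 3 * dthetab t + 4 * thetac t ^ 4 * (ltheta t - pi / 4 * thetab t ^ 4)) (at t)"
    using assms by (auto intro!: derivative_eq_intros DERIV_thetab DERIV_thetac' simp: eval_nat_numeral)
  ultimately have "4 * thetab t ^ 3 * dthetab t + 4 * thetac t ^ 4 * (ltheta t - pi / 4 * thetab t ^ 4)
     = 4 * (thetab t ^ 4 + thetac t ^ 4) * ltheta t"
    using DERIV_unique jacobi_quartic[OF assms] by fastforce
  then have "thetab t ^ 3 * dthetab t = thetab t ^ 3 * (thetab t * (ltheta t + pi / 4 * thetac t ^ 4))"
    by (simp add: algebra_simps eval_nat_numeral)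
  then have "dthetab t = thetab t * (ltheta t + pi / 4 * thetac t ^ 4)"
    using thetab_pos[OF assms] by simp
  then show ?thesis
    using DERIV_thetab[OF assms] by simp
qed

definition dltheta :: "real \<Rightarrow> real" where
  "dltheta t = ddtheta t / theta t - ltheta t ^ 2"

lemma DERIV_ltheta: "t > 0 \<Longrightarrow> (ltheta has_real_derivative dltheta t) (at t)"
  unfolding ltheta_def[abs_def] dltheta_def
  using theta_pos[of t]
  by (intro DERIV_cong[OF DERIV_divide[OF DERIV_dtheta DERIV_theta]])
    (auto simp: diff_divide_distrib power2_eq_square)

text \<open>In \<open>dtheta_logderiv\<close> the derivative of \<open>thetac\<close> is eliminated
  through \<open>logderiv_thetac_sub_ltheta\<close>. Both resulting terms contain
  \<open>theta t ^ 2\<close>, by \<open>theta_sq\<close> and \<open>thetab_quartic\<close>, and it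
  cancels.\<close>

lemma ltheta_duplication:
  assumes "t > 0"
  shows "ltheta t = 2 * ltheta (2*t) - pi / 2 * thetac (2*t) ^ 2 * thetab t ^ 2"
proof -
  have pos: "theta t > 0" "theta (2*t) > 0" "thetac (2*t) > 0"
    using assms theta_pos thetac_pos by auto
  have "theta t ^ 2 * ltheta t = theta t * dtheta t"
    using pos by (simp add: ltheta_def power2_eq_square)
  also have "\<dots> = 2 * (theta (2*t) ^ 2 * ltheta (2*t) + thetac (2*t) ^ 2 * (dthetac (2*t) / thetac (2*t)))"
    unfolding dtheta_logderiv[OF assms] using pos by (simp add: ltheta_def power2_eq_square)
  also have "dthetac (2*t) / thetac (2*t) = ltheta (2*t) - pi / 4 * (theta t ^ 2 * thetab t ^ 2)"
    using logderiv_thetac_sub_ltheta[of "2*t"] thetab_quartic[of t] assms by simp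
  also have "2 * (theta (2*t) ^ 2 * ltheta (2*t) + thetac (2*t) ^ 2 * (ltheta (2*t) - pi / 4 * (theta t ^ 2 * thetab t ^ 2)))
     = 2 * (theta (2*t) ^ 2 + thetac (2*t) ^ 2) * ltheta (2*t) - pi / 2 * thetac (2*t) ^ 2 * (theta t ^ 2 * thetab t ^ 2)"
    by (simp add: algebra_simps)
  also have "\<dots> = theta t ^ 2 * (2 * ltheta (2*t) - pi / 2 * thetac (2*t) ^ 2 * thetab t ^ 2)"
    unfolding theta_sq[OF assms, symmetric] by (simp add: algebra_simps)
  finally show ?thesis
    using pos by simp
qed

lemma dltheta_duplication:
  assumes "t > 0"
  shows "dltheta t = 4 * dltheta (2*t) - pi / 2 * thetac (2*t) ^ 2 * thetab t ^ 2 * 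
     (4 * (ltheta (2*t) - pi / 4 * thetab (2*t) ^ 4) + 2 * (ltheta t + pi / 4 * thetac t ^ 4))"
proof -
  have l2: "((\<lambda>t. ltheta (2*t)) has_real_derivative 2 * dltheta (2*t)) (at t)"
    by (rule DERIV_scale[OF DERIV_ltheta]) (use assms in simp)
  have c2: "((\<lambda>t. thetac (2*t)) has_real_derivative 2 * (thetac (2*t) * (ltheta (2*t) - pi / 4 * thetab (2*t) ^ 4))) (at t)"
    by (rule DERIV_scale[OF DERIV_thetac']) (use assms in simp)
  have "((\<lambda>t. 2 * ltheta (2*t) - pi / 2 * thetac (2*t) ^ 2 * thetab t ^ 2) has_real_derivative
     4 * dltheta (2*t) - pi / 2 * thetac (2*t) ^ 2 * thetab t ^ 2 * 
     (4 * (ltheta (2*t) - pi / 4 * thetab (2*t) ^ 4) + 2 * (ltheta t + pi / 4 * thetac t ^ 4))) (at t)"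
    by (rule DERIV_cong[OF DERIV_diff[OF DERIV_cmult[OF l2] DERIV_mult[OF DERIV_cmult[OF
          DERIV_power[OF c2]] DERIV_power[OF DERIV_thetab'[OF assms]]]]])
       (simp add: algebra_simps power2_eq_square)
  then have "(ltheta has_real_derivative
     4 * dltheta (2*t) - pi / 2 * thetac (2*t) ^ 2 * thetab t ^ 2 * 
     (4 * (ltheta (2*t) - pi / 4 * thetab (2*t) ^ 4) + 2 * (ltheta t + pi / 4 * thetac t ^ 4))) (at t)"
    by (rule has_field_derivative_transform_within_open[OF _ _ _ ltheta_duplication[symmetric],
          of _ _ _ "{0<..}"]) (use assms in simp_all)
  then show ?thesis
    using DERIV_ltheta[OF assms] DERIV_unique by blast
qed

text \<open>The defect of this Riccati equation at \<open>t\<close> is four times its defect at \<open>2 * t\<close>, and it is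
  \<open>o(t\<^sup>-\<^sup>2)\<close>.\<close>

lemma ltheta_riccati:
  assumes "t > 0"
  shows "dltheta t = 2 * ltheta t ^ 2 + pi\<^sup>2 / 8 * thetab t ^ 4 * thetac t ^ 4"
proof -
  define f where "f = (\<lambda>t. t ^ 2 * (dltheta t - 2 * ltheta t ^ 2 - pi\<^sup>2 / 8 * thetab t ^ 4 * thetac t ^ 4))"
  have "f (2 * t) = f t" if "t > 0" for t
  proof -
    define b A B C u where "b = thetab t ^ 2" and "A = theta (2*t) ^ 2"
      and "B = thetab (2*t) ^ 4" and "C = thetac (2*t) ^ 2" and "u = ltheta (2*t)"
    have eq: "b = A - C" "B = (A + C) * (A - C)" 
      using thetab_sq[OF that] theta_sq[OF that] thetab_quartic[OF that]
      by (auto simp: b_def A_def B_def C_def)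
    have c4: "thetac t ^ 4 = 4 * A * C"
    proof -
      have "thetac t ^ 4 = (thetac t ^ 2) ^ 2" by simp
      then show ?thesis
        unfolding thetac_sq[OF that] by (simp add: A_def C_def power_mult_distrib)
    qed
    have lt: "ltheta t = 2 * u - pi / 2 * C * b"
      using ltheta_duplication[OF that] by (simp add: u_def C_def b_def)
    have b4: "thetab t ^ 4 = b ^ 2" and C4: "thetac (2*t) ^ 4 = C ^ 2"
      by (auto simp: b_def C_def)
    have "dltheta t - 2 * ltheta t ^ 2 - pi\<^sup>2 / 8 * thetab t ^ 4 * thetac t ^ 4
       = 4 * dltheta (2*t) - pi / 2 * C * b * (4 * (u - pi / 4 * B) + 2 * (2 * u - pi / 2 * C * b + pi / 4 * (4 * A * C)))
          - 2 * (2 * u - pi / 2 * C * b) ^ 2 - pi\<^sup>2 / 8 * b ^ 2 * (4 * A * C)"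
      unfolding dltheta_duplication[OF that] lt c4 b4 by (simp add: u_def B_def C_def b_def)
    also have "\<dots> = 4 * (dltheta (2*t) - 2 * u ^ 2 - pi\<^sup>2 / 8 * B * C ^ 2)"
      unfolding eq by (simp add: power2_eq_square field_simps)
    finally have "f t = t ^ 2 * (4 * (dltheta (2*t) - 2 * u ^ 2 - pi\<^sup>2 / 8 * B * C ^ 2))"
      by (simp only: f_def)
    also have "\<dots> = f (2 * t)"
      unfolding f_def u_def B_def C4 by (simp add: power_mult_distrib)
    finally show ?thesis by simp
  qed
  moreover have "(f \<longlongrightarrow> 0) at_top"
  proof -
    have e: "((\<lambda>t. t ^ 2 * exp (- pi * t)) \<longlongrightarrow> 0) at_top"
      by real_asymp
    \<comment> \<open>The fourth power of \<open>thetac\<close> carries a factor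
      \<open>exp (- pi * t)\<close>, which absorbs \<open>t ^ 2\<close>.\<close>
    have ex: "(thetac t * exp (pi * t / 4)) ^ 4 * (t ^ 2 * exp (- pi * t)) = t ^ 2 * thetac t ^ 4" for t
    proof -
      have "exp (pi * t / 4) ^ 4 * exp (- pi * t) = 1"
        unfolding exp_of_nat_mult[symmetric] mult_exp_exp by simp
      then show ?thesis
        by (simp add: power_mult_distrib algebra_simps)
    qed
    have "((\<lambda>t. (t ^ 2 * ddtheta t) / theta (1 * t) - 3 * (t ^ 1 * ltheta t) ^ 2 
        - pi\<^sup>2 / 8 * thetab t ^ 4 * ((thetac t * exp (pi * t / 4)) ^ 4 * (t ^ 2 * exp (- pi * t)))) \<longlongrightarrow> 
        0 / 1 - 3 * 0 ^ 2 - pi\<^sup>2 / 8 * 1 ^ 4 * (2 ^ 4 * 0)) at_top"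
      by (intro tendsto_intros e ddtheta_tendsto theta_tendsto ltheta_tendsto thetab_tendsto thetac_exp_tendsto) auto
    then show ?thesis
      unfolding ex by (simp add: f_def dltheta_def algebra_simps power_mult_distrib)
  qed
  ultimately have "f t = 0"
    using assms by (rule doubling_invariant_eq_limit)
  then show ?thesis
    using assms by (simp add: f_def)
qed

section \<open>The arithmetic-geometric mean integral\<close>

text \<open>The integrand of the complete elliptic integral in Gauss's symmetric form: its integral
  over the line is \<open>pi\<close> divided by the arithmetic-geometric mean of \<open>p\<close>
  and \<open>q\<close>.\<close>

definition agm_kernel :: "real \<Rightarrow> real \<Rightarrow> real \<Rightarrow> real" where
  "agm_kernel p q x = 1 / sqrt ((x\<^sup>2 + p\<^sup>2) * (x\<^sup>2 + q\<^sup>2))"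

definition agm_integral :: "real \<Rightarrow> real \<Rightarrow> real" where
  "agm_integral p q = integral UNIV (agm_kernel p q)"

lemma agm_kernel_nonneg: "agm_kernel p q x \<ge> 0"
  by (simp add: agm_kernel_def)

lemma agm_kernel_continuous:
  assumes "p > 0" "q > 0"
  shows "continuous_on S (agm_kernel p q)"
proof -
  have "(x\<^sup>2 + p\<^sup>2) * (x\<^sup>2 + q\<^sup>2) > 0" for x
    using assms by (simp add: add_nonneg_pos)
  then have "sqrt ((x\<^sup>2 + p\<^sup>2) * (x\<^sup>2 + q\<^sup>2)) \<noteq> 0" for x
    by (metis less_irrefl real_sqrt_eq_zero_cancel_iff)
  then show ?thesis
    unfolding agm_kernel_def[abs_def] by (intro continuous_intros) auto
qed

text \<open>Comparison with Cauchy kernels yields integrability, and it fixes the value of the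
  integral in the limit where both parameters approach a common value.\<close>

lemma agm_kernel_bounds:
  assumes "0 < m" "m \<le> p" "m \<le> q" "p \<le> M" "q \<le> M"
  shows "agm_kernel p q x \<le> 1 / (x\<^sup>2 + m\<^sup>2)" "1 / (x\<^sup>2 + M\<^sup>2) \<le> agm_kernel p q x"
proof -
  have sq: "m\<^sup>2 \<le> p\<^sup>2" "m\<^sup>2 \<le> q\<^sup>2" "p\<^sup>2 \<le> M\<^sup>2" "q\<^sup>2 \<le> M\<^sup>2" "m\<^sup>2 > 0"
    using assms by (auto intro: power_mono)
  have "(x\<^sup>2 + m\<^sup>2) * (x\<^sup>2 + m\<^sup>2) \<le> (x\<^sup>2 + p\<^sup>2) * (x\<^sup>2 + q\<^sup>2)"
       "(x\<^sup>2 + p\<^sup>2) * (x\<^sup>2 + q\<^sup>2) \<le> (x\<^sup>2 + M\<^sup>2) * (x\<^sup>2 + M\<^sup>2)"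
    using sq by (intro mult_mono; simp)+
  then have le: "x\<^sup>2 + m\<^sup>2 \<le> sqrt ((x\<^sup>2 + p\<^sup>2) * (x\<^sup>2 + q\<^sup>2))"
       "sqrt ((x\<^sup>2 + p\<^sup>2) * (x\<^sup>2 + q\<^sup>2)) \<le> x\<^sup>2 + M\<^sup>2"
    by (auto intro!: real_le_rsqrt real_le_lsqrt simp: power2_eq_square)
  have "x\<^sup>2 + m\<^sup>2 > 0"
    using sq by (simp add: add_nonneg_pos)
  then show "agm_kernel p q x \<le> 1 / (x\<^sup>2 + m\<^sup>2)" "1 / (x\<^sup>2 + M\<^sup>2) \<le> agm_kernel p q x"
    unfolding agm_kernel_def using le by (intro divide_left_mono mult_pos_pos; linarith)+
qed

lemma cauchy_integral:
  "(\<lambda>x::real. inverse (1 + x\<^sup>2)) absolutely_integrable_on UNIV"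
  "integral UNIV (\<lambda>x::real. inverse (1 + x\<^sup>2)) = pi"
proof -
  have ei: "einterval (-\<infinity>) \<infinity> = UNIV"
    by (auto simp: einterval_def)
  have 1: "set_integrable lborel UNIV (\<lambda>x::real. inverse (1 + x\<^sup>2))"
    using integrable_inverse_1_plus_square by (simp add: ei)
  then show "(\<lambda>x::real. inverse (1 + x\<^sup>2)) absolutely_integrable_on UNIV"
    unfolding set_integrable_def by (subst integrable_completion) auto
  have "(LINT x : UNIV | lborel. inverse (1 + x\<^sup>2)) = pi"
    using LBINT_inverse_1_plus_square by (simp add: interval_lebesgue_integral_def ei)
  then show "integral UNIV (\<lambda>x::real. inverse (1 + x\<^sup>2)) = pi"
    using set_borel_integral_eq_integral(2)[OF 1] by simp
qed

lemma range_scale: "m \<noteq> (0::real) \<Longrightarrow> range ((*) m) = UNIV"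
  by (metis surj_def nonzero_eq_divide_eq mult.commute)

lemma cauchy_integral_scale:
  assumes "m > 0"
  shows "(\<lambda>x::real. 1 / (x\<^sup>2 + m\<^sup>2)) absolutely_integrable_on UNIV
    \<and> integral UNIV (\<lambda>x::real. 1 / (x\<^sup>2 + m\<^sup>2)) = pi / m"
proof -
  have der: "((\<lambda>x. 1/m * x) has_real_derivative 1/m) (at x within UNIV)" for x
    by (rule DERIV_cmult_Id)
  have "inj_on (\<lambda>x. 1/m * x) UNIV"
    using assms by (auto intro!: inj_onI)
  have A: "(\<lambda>x. \<bar>1/m\<bar> * inverse (1 + (1/m * x)\<^sup>2)) absolutely_integrable_on UNIV \<and>
        integral UNIV (\<lambda>x. \<bar>1/m\<bar> * inverse (1 + (1/m * x)\<^sup>2)) = pi"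
    using has_absolute_integral_change_of_variables_1'[OF _ der \<open>inj_on _ _\<close>,
        of "\<lambda>x. inverse (1 + x\<^sup>2)" pi] cauchy_integral assms range_scale[of "1/m"]
    by auto
  have eq: "\<bar>1/m\<bar> * inverse (1 + (1/m * x)\<^sup>2) = m * (1 / (x\<^sup>2 + m\<^sup>2))" for x
  proof -
    have "x\<^sup>2 + m\<^sup>2 > 0" "m\<^sup>2 > 0"
      using assms by (auto simp add: add_nonneg_pos)
    then show ?thesis
      using assms by (simp add: field_simps power2_eq_square)
  qed
  have *: "(\<lambda>x. m * (1 / (x\<^sup>2 + m\<^sup>2))) absolutely_integrable_on UNIV"
     "integral UNIV (\<lambda>x. m * (1 / (x\<^sup>2 + m\<^sup>2))) = pi"
    using A unfolding eq by blast+
  have "(\<lambda>x. 1 / m * (m * (1 / (x\<^sup>2 + m\<^sup>2)))) absolutely_integrable_on UNIV"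
    by (rule set_integrable_mult_right[OF *(1)])
  moreover have "m * integral UNIV (\<lambda>x. (1 / (x\<^sup>2 + m\<^sup>2))) = pi"
    using *(2) by (simp only: Henstock_Kurzweil_Integration.integral_mult_right)
  ultimately show ?thesis
    using assms by (simp add: field_simps)
qed

lemma agm_kernel_integrable:
  assumes "p > 0" "q > 0" "S \<in> sets lebesgue"
  shows "agm_kernel p q absolutely_integrable_on S"
proof -
  have "agm_kernel p q absolutely_integrable_on UNIV"
  proof (rule measurable_bounded_by_integrable_imp_absolutely_integrable)
    show "agm_kernel p q \<in> borel_measurable (lebesgue_on UNIV)"
      using agm_kernel_continuous[OF assms(1,2)]
      by (intro continuous_imp_measurable_on_sets_lebesgue) auto
    show "(\<lambda>x. 1 / (x\<^sup>2 + (min p q)\<^sup>2)) integrable_on UNIV"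
      using cauchy_integral_scale[of "min p q"] assms absolutely_integrable_on_def by auto
    show "norm (agm_kernel p q x) \<le> 1 / (x\<^sup>2 + (min p q)\<^sup>2)" for x
      using agm_kernel_bounds(1)[of "min p q" p q "max p q" x] assms agm_kernel_nonneg[of p q x]
      by auto
  qed auto
  then show ?thesis
    using assms set_integrable_subset by blast
qed

lemma agm_kernel_integrable': "p > 0 \<Longrightarrow> q > 0 \<Longrightarrow> S \<in> sets lebesgue \<Longrightarrow> agm_kernel p q integrable_on S"
  using agm_kernel_integrable set_lebesgue_integral_eq_integral(1) by blast

lemma agm_integral_bounds:
  assumes "0 < m" "m \<le> p" "m \<le> q" "p \<le> M" "q \<le> M"
  shows "pi / M \<le> agm_integral p q" "agm_integral p q \<le> pi / m"
proof -
  have c: "(\<lambda>x::real. 1 / (x\<^sup>2 + k\<^sup>2)) integrable_on UNIV" 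
     "integral UNIV (\<lambda>x::real. 1 / (x\<^sup>2 + k\<^sup>2)) = pi / k" if "k > 0" for k
    using cauchy_integral_scale[OF that] absolutely_integrable_on_def by blast+
  have k: "agm_kernel p q integrable_on UNIV"
    using assms by (intro agm_kernel_integrable') auto
  have M: "M > 0" and m: "m > 0" using assms by auto
  have "integral UNIV (\<lambda>x. 1 / (x\<^sup>2 + M\<^sup>2)) \<le> integral UNIV (agm_kernel p q)"
    by (rule integral_le[OF c(1)[OF M] k agm_kernel_bounds(2)[OF assms]])
  then show "pi / M \<le> agm_integral p q"
    by (simp add: agm_integral_def c(2)[OF M])
  have "integral UNIV (agm_kernel p q) \<le> integral UNIV (\<lambda>x. 1 / (x\<^sup>2 + m\<^sup>2))"
    by (rule integral_le[OF k c(1)[OF m] agm_kernel_bounds(1)[OF assms]])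
  then show "agm_integral p q \<le> pi / m"
    by (simp add: agm_integral_def c(2)[OF m])
qed

lemma agm_integral_scale:
  assumes "l > 0" "p > 0" "q > 0"
  shows "agm_integral (l * p) (l * q) = agm_integral p q / l"
proof -
  have ai: "agm_kernel (l * p) (l * q) absolutely_integrable_on UNIV"
    using assms by (intro agm_kernel_integrable) auto
  have "integral UNIV (\<lambda>x. \<bar>l\<bar> * agm_kernel (l * p) (l * q) (l * x)) = agm_integral (l * p) (l * q)"
    using has_absolute_integral_change_of_variables_1'[of UNIV "(*) l" "\<lambda>_. l" "agm_kernel (l * p) (l * q)"
       "agm_integral (l * p) (l * q)"] assms ai
    by (auto intro!: derivative_eq_intros inj_onI simp: range_scale agm_integral_def)
  moreover have "\<bar>l\<bar> * agm_kernel (l * p) (l * q) (l * x) = agm_kernel p q x / l" for x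
  proof -
    have "((l * x)\<^sup>2 + (l * p)\<^sup>2) * ((l * x)\<^sup>2 + (l * q)\<^sup>2) = (l\<^sup>2)\<^sup>2 * ((x\<^sup>2 + p\<^sup>2) * (x\<^sup>2 + q\<^sup>2))"
      by (simp add: power2_eq_square algebra_simps)
    then have "sqrt (((l * x)\<^sup>2 + (l * p)\<^sup>2) * ((l * x)\<^sup>2 + (l * q)\<^sup>2)) = l\<^sup>2 * sqrt ((x\<^sup>2 + p\<^sup>2) * (x\<^sup>2 + q\<^sup>2))"
      by (simp only: real_sqrt_mult[of "(l\<^sup>2)\<^sup>2"] real_sqrt_abs abs_power2)
    then show ?thesis
      unfolding agm_kernel_def using assms by (simp add: power2_eq_square)
  qed
  ultimately show ?thesis
    by (simp add: agm_integral_def)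
qed

lemma agm_integral_half:
  assumes "p > 0" "q > 0"
  shows "agm_integral p q = 2 * integral {0<..} (agm_kernel p q)"
proof -
  have i: "agm_kernel p q integrable_on S" if "S \<in> sets lebesgue" for S
    using agm_kernel_integrable'[OF assms that] .
  have "agm_integral p q = integral ({..0} \<union> {0<..}) (agm_kernel p q)"
    unfolding agm_integral_def by (rule arg_cong2[of _ _ _ _ integral]) auto
  also have "\<dots> = integral {..0} (agm_kernel p q) + integral {0<..} (agm_kernel p q)"
  proof (rule integral_Un)
    have "{..0::real} \<inter> {0<..} = {}" by auto
    then show "negligible ({..0::real} \<inter> {0<..})" by simp
  qed (auto intro!: i)
  also have "integral {..0} (agm_kernel p q) = integral {0..} (agm_kernel p q)"
  proof -
    have "(\<lambda>x. agm_kernel p q (- x)) = agm_kernel p q"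
      by (simp add: agm_kernel_def fun_eq_iff)
    then show ?thesis
      using has_absolute_integral_reflect_real[of "{..0}" "{0..}" "agm_kernel p q"
          "integral {0..} (agm_kernel p q)"] agm_kernel_integrable[OF assms, of "{0..}"]
      by (auto simp: image_subset_iff)
  qed
  also have "integral {0..} (agm_kernel p q) = integral {0<..} (agm_kernel p q)"
  proof (rule integral_subset_negligible[symmetric])
    have "{0..} - {0<..} = {0::real}" by auto
    then show "negligible ({0..} - {0<..} :: real set)" by simp
  qed auto
  finally show ?thesis by simp
qed

text \<open>Gauss's invariance by a Landen substitution. For \<open>y = (x - p q / x) / 2\<close>
  the two factors of the new kernel become \<open>y^2 + p q = ((x + p q / x) / 2)^2\<close> and
  \<open>y^2 + ((p + q) / 2)^2 = (x^2 + p^2) (x^2 + q^2) / (4 x^2)\<close>. The first one cancels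
  against the Jacobian.\<close>

lemma agm_integral_step:
  assumes "p > 0" "q > 0"
  shows "agm_integral ((p + q) / 2) (sqrt (p * q)) = agm_integral p q"
proof -
  define g where "g = (\<lambda>x::real. (x - p * q / x) / 2)"
  define g' where "g' = (\<lambda>x::real. (1 + p * q / x\<^sup>2) / 2)"
  define k where "k = agm_kernel ((p + q) / 2) (sqrt (p * q))"
  have pq: "p * q > 0" using assms by simp
  have der: "(g has_real_derivative g' x) (at x within {0<..})" if "x \<in> {0<..}" for x
    unfolding g_def g'_def using that
    by (auto intro!: derivative_eq_intros simp: power2_eq_square)
  have inj: "inj_on g {0<..}"
  proof (rule strict_mono_on_imp_inj_on, rule strict_mono_onI)
    fix r s :: real assume "r \<in> {0<..}" "s \<in> {0<..}" "r < s"
    then have "p * q / s < p * q / r"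
      using pq by (intro divide_strict_left_mono) auto
    then show "g r < g s"
      using \<open>r < s\<close> unfolding g_def by (intro divide_strict_right_mono diff_strict_mono) auto
  qed
  have img: "g ` {0<..} = UNIV"
  proof -
    have "y \<in> g ` {0<..}" for y
    proof -
      \<comment> \<open>The positive root of \<open>x^2 - 2 y x - p q = 0\<close>.\<close>
      define x where "x = y + sqrt (y\<^sup>2 + p * q)"
      have s: "sqrt (y\<^sup>2 + p * q) ^ 2 = y\<^sup>2 + p * q" "sqrt (y\<^sup>2 + p * q) > \<bar>y\<bar>"
        using pq by (auto intro!: real_less_rsqrt add_nonneg_nonneg)
      then have "x > 0" by (simp add: x_def)
      have "x * x - p * q = 2 * y * x"
        using s(1) by (simp add: x_def power2_eq_square algebra_simps)
      then have "y = g x"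
        using \<open>x > 0\<close> by (simp add: g_def field_simps)
      then show ?thesis using \<open>x > 0\<close> by auto
    qed
    then show ?thesis by blast
  qed
  have k: "k absolutely_integrable_on UNIV"
    unfolding k_def using assms by (intro agm_kernel_integrable) auto
  have "integral UNIV k = integral {0<..} (\<lambda>x. \<bar>g' x\<bar> * k (g x))"
    using has_absolute_integral_change_of_variables_1'[OF _ der inj, of k "integral UNIV k"] img k
    by auto
  also have "\<dots> = integral {0<..} (\<lambda>x. 2 * agm_kernel p q x)"
  proof (rule Henstock_Kurzweil_Integration.integral_cong)
    fix x :: real assume "x \<in> {0<..}"
    then have x: "x > 0" by simp
    define S where "S = sqrt ((x\<^sup>2 + p\<^sup>2) * (x\<^sup>2 + q\<^sup>2))"
    have "(x\<^sup>2 + p\<^sup>2) * (x\<^sup>2 + q\<^sup>2) > 0"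
      using x by (simp add: add_pos_nonneg)
    then have S: "S > 0" "S\<^sup>2 = (x\<^sup>2 + p\<^sup>2) * (x\<^sup>2 + q\<^sup>2)"
      by (auto simp: S_def)
    define W where "W = x\<^sup>2 + p * q"
    have W: "W > 0"
      using pq by (simp add: W_def add_nonneg_pos)
    have 1: "(g x)\<^sup>2 + (sqrt (p * q))\<^sup>2 = (W / (2 * x))\<^sup>2"
      using x pq by (simp add: W_def g_def field_simps power2_eq_square)
    have 2: "(g x)\<^sup>2 + ((p + q) / 2)\<^sup>2 = (S / (2 * x))\<^sup>2"
      unfolding power_divide[of S] S using x by (simp add: g_def field_simps power2_eq_square)
    have "sqrt (((g x)\<^sup>2 + ((p + q) / 2)\<^sup>2) * ((g x)\<^sup>2 + (sqrt (p * q))\<^sup>2)) = S / (2 * x) * (W / (2 * x))"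
      unfolding 1 2 real_sqrt_mult[of "(S / (2 * x))\<^sup>2"] real_sqrt_abs using x S(1) W by simp
    then have kg: "k (g x) = 1 / (S / (2 * x) * (W / (2 * x)))"
      by (simp add: k_def agm_kernel_def)
    have "g' x = W / (2 * x\<^sup>2)"
      using x by (simp add: W_def g'_def field_simps)
    then have "\<bar>g' x\<bar> = W / (2 * x\<^sup>2)"
      using W by simp
    then have "\<bar>g' x\<bar> * k (g x) = 2 / S"
      unfolding kg using x S(1) W by (simp add: power2_eq_square)
    then show "\<bar>g' x\<bar> * k (g x) = 2 * agm_kernel p q x"
      by (simp add: S_def agm_kernel_def)
  qed
  also have "\<dots> = agm_integral p q"
    using agm_integral_half[OF assms] by simp
  finally show ?thesis
    by (simp add: agm_integral_def k_def)
qed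

text \<open>The involution \<open>x\<close> to \<open>p q / x\<close> preserves the measure
  \<open>agm_kernel p q x dx\<close> and exchanges the two sides of its fixed point
  \<open>sqrt (p * q)\<close>. Only the range where \<open>x^2 \<le> p q\<close> remains; for
  \<open>q\<close> much smaller than \<open>p\<close> the factor with \<open>p\<close> is nearly
  constant there.\<close>

lemma agm_integral_quarter:
  assumes "p > 0" "q > 0"
  shows "agm_integral p q = 4 * integral {0<..sqrt (p * q)} (agm_kernel p q)"
proof -
  define r where "r = sqrt (p * q)"
  have r: "r > 0" "r\<^sup>2 = p * q" using assms by (auto simp: r_def)
  have i: "agm_kernel p q integrable_on S" if "S \<in> sets lebesgue" for S
    using agm_kernel_integrable'[OF assms that] .
  define g where "g = (\<lambda>x::real. p * q / x)"
  define g' where "g' = (\<lambda>x::real. - (p * q / x\<^sup>2))"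
  have der: "(g has_real_derivative g' x) (at x within {0<..r})" if "x \<in> {0<..r}" for x
    unfolding g_def g'_def using that
    by (auto intro!: derivative_eq_intros simp: power2_eq_square)
  have inj: "inj_on g {0<..r}"
    using assms by (auto simp: inj_on_def g_def)
  have img: "g ` {0<..r} = {r..}"
  proof -
    have "y \<in> g ` {0<..r}" if "y \<in> {r..}" for y
    proof (rule image_eqI)
      have "r * r \<le> r * y" "y > 0" using that r by (auto intro: mult_left_mono)
      then have "p * q \<le> r * y" "y > 0"
        using r(2) by (auto simp only: power2_eq_square)
      then show "p * q / y \<in> {0<..r}"
        using assms by (simp add: pos_divide_le_eq)
      show "y = g (p * q / y)"
        using assms by (simp add: g_def)
    qed
    moreover have "g x \<in> {r..}" if "x \<in> {0<..r}" for x
    proof -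
      have "r * x \<le> r * r" "x > 0" using that r by (auto intro: mult_left_mono)
      then have "r * x \<le> p * q" "x > 0"
        using r(2) by (auto simp only: power2_eq_square)
      then show ?thesis
        by (simp add: g_def pos_le_divide_eq)
    qed
    ultimately show ?thesis by blast
  qed
  have "integral {r..} (agm_kernel p q) = integral {0<..r} (\<lambda>x. \<bar>g' x\<bar> * agm_kernel p q (g x))"
    using has_absolute_integral_change_of_variables_1'[OF _ der inj, of "agm_kernel p q" "integral {r..} (agm_kernel p q)"] img 
      agm_kernel_integrable[OF assms, of "{r..}"]
    by auto
  also have "\<dots> = integral {0<..r} (agm_kernel p q)"
  proof (rule Henstock_Kurzweil_Integration.integral_cong)
    fix x :: real assume "x \<in> {0<..r}"
    then have x: "x > 0" by simp
    have e: "((g x)\<^sup>2 + p\<^sup>2) * ((g x)\<^sup>2 + q\<^sup>2) = (p * q / x\<^sup>2)\<^sup>2 * ((x\<^sup>2 + p\<^sup>2) * (x\<^sup>2 + q\<^sup>2))"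
      using x by (simp add: g_def field_simps power2_eq_square)
    have "sqrt (((g x)\<^sup>2 + p\<^sup>2) * ((g x)\<^sup>2 + q\<^sup>2)) = (p * q / x\<^sup>2) * sqrt ((x\<^sup>2 + p\<^sup>2) * (x\<^sup>2 + q\<^sup>2))"
      unfolding e real_sqrt_mult[of "(p * q / x\<^sup>2)\<^sup>2"] using assms by simp
    then show "\<bar>g' x\<bar> * agm_kernel p q (g x) = agm_kernel p q x"
      using x assms by (simp add: agm_kernel_def g'_def)
  qed
  finally have eq: "integral {r..} (agm_kernel p q) = integral {0<..r} (agm_kernel p q)" .
  have "integral {0<..} (agm_kernel p q) = integral ({0<..r} \<union> {r..}) (agm_kernel p q)"
    using r by (intro arg_cong2[of _ _ _ _ integral]) auto
  also have "\<dots> = integral {0<..r} (agm_kernel p q) + integral {r..} (agm_kernel p q)"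
  proof (rule integral_Un)
    have "{0<..r} \<inter> {r..} = {r}" using r by auto
    then show "negligible ({0<..r} \<inter> {r..})" by simp
  qed (auto intro!: i)
  finally show ?thesis
    using agm_integral_half[OF assms] eq by (simp add: r_def)
qed

text \<open>On the remaining quarter, \<open>1 / sqrt (x^2 + p^2)\<close> lies between
  \<open>1 / sqrt (p^2 + p q)\<close> and \<open>1 / p\<close>, and the other factor integrates to
  an \<open>arsinh\<close>. The bounds capture the logarithmic growth of the integral as
  \<open>q / p\<close> tends to 0.\<close>

lemma agm_integral_arsinh_bounds:
  assumes "0 < q" "q < p"
  shows "4 * arsinh (sqrt (p / q)) / sqrt (p\<^sup>2 + p * q) \<le> agm_integral p q"
    and "agm_integral p q \<le> 4 * arsinh (sqrt (p / q)) / p"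
proof -
  define r where "r = sqrt (p * q)"
  have r: "r > 0" "r\<^sup>2 = p * q" using assms by (auto simp: r_def)
  have rq: "r / q = sqrt (p / q)"
    using assms by (simp add: r_def real_sqrt_mult real_sqrt_divide field_simps)
  have h: "((\<lambda>x. 1 / sqrt (x\<^sup>2 + q\<^sup>2)) has_integral arsinh (sqrt (p / q))) {0..r}"
  proof -
    have "((\<lambda>x. arsinh (x / q)) has_real_derivative 1 / sqrt (x\<^sup>2 + q\<^sup>2)) (at x within {0..r})" for x
    proof -
      have "sqrt ((x / q)\<^sup>2 + 1) = sqrt (x\<^sup>2 + q\<^sup>2) / q"
      proof -
        have "(x / q)\<^sup>2 + 1 = (x\<^sup>2 + q\<^sup>2) / q\<^sup>2"
          using assms by (simp add: field_simps)
        then show ?thesis using assms by (simp add: real_sqrt_divide)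
      qed
      then show ?thesis
        using assms
        by (intro DERIV_cong[OF DERIV_chain2[OF arsinh_real_has_field_derivative DERIV_cdivide[OF DERIV_ident]]])
          auto
    qed
    from fundamental_theorem_of_calculus[OF _ this[unfolded has_real_derivative_iff_has_vector_derivative]] r rq
    show ?thesis by simp
  qed
  have ik: "agm_kernel p q integrable_on {0..r}"
    using agm_kernel_integrable'[of p q "{0..r}"] assms by auto
  have Ioc: "integral {0<..r} (agm_kernel p q) = integral {0..r} (agm_kernel p q)"
  proof (rule integral_subset_negligible)
    have "{0..r} - {0<..r} = {0}" using r by auto
    then show "negligible ({0..r} - {0<..r})" by simp
  qed auto
  have kern: "agm_kernel p q x = 1 / sqrt (x\<^sup>2 + p\<^sup>2) * (1 / sqrt (x\<^sup>2 + q\<^sup>2))" for x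
    by (simp add: agm_kernel_def real_sqrt_mult)
  have "1 / sqrt (p\<^sup>2 + p * q) * arsinh (sqrt (p / q)) \<le> integral {0..r} (agm_kernel p q)"
  proof (rule has_integral_le[OF has_integral_mult_right[OF h] integrable_integral[OF ik]])
    fix x assume x: "x \<in> {0..r}"
    then have "x\<^sup>2 \<le> p * q" using r by (metis atLeastAtMost_iff power_mono)
    moreover have "x\<^sup>2 + p\<^sup>2 > 0" using assms by (simp add: add_nonneg_pos)
    ultimately have "1 / sqrt (p\<^sup>2 + p * q) \<le> 1 / sqrt (x\<^sup>2 + p\<^sup>2)"
      by (intro divide_left_mono) (auto intro!: mult_pos_pos)
    then show "1 / sqrt (p\<^sup>2 + p * q) * (1 / sqrt (x\<^sup>2 + q\<^sup>2)) \<le> agm_kernel p q x"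
      unfolding kern by (rule mult_right_mono) simp
  qed
  then show "4 * arsinh (sqrt (p / q)) / sqrt (p\<^sup>2 + p * q) \<le> agm_integral p q"
    using agm_integral_quarter[of p q] assms Ioc by (simp add: r_def)
  have "integral {0..r} (agm_kernel p q) \<le> 1 / p * arsinh (sqrt (p / q))"
  proof (rule has_integral_le[OF integrable_integral[OF ik] has_integral_mult_right[OF h]])
    fix x
    have "p \<le> sqrt (x\<^sup>2 + p\<^sup>2)" using assms by (intro real_le_rsqrt) auto
    then have "1 / sqrt (x\<^sup>2 + p\<^sup>2) \<le> 1 / p"
      using assms by (intro divide_left_mono mult_pos_pos) linarith+
    then show "agm_kernel p q x \<le> 1 / p * (1 / sqrt (x\<^sup>2 + q\<^sup>2))"
      unfolding kern by (rule mult_right_mono) simp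
  qed
  then show "agm_integral p q \<le> 4 * arsinh (sqrt (p / q)) / p"
    using agm_integral_quarter[of p q] assms Ioc by (simp add: r_def)
qed

section \<open>Inversion formula and special value\<close>

text \<open>Doubling \<open>t\<close> is one step of the arithmetic-geometric mean on these two
  squares, and both tend to 1.\<close>

lemma agm_integral_theta_thetab:
  assumes "t > 0"
  shows "agm_integral ((theta t)\<^sup>2) ((thetab t)\<^sup>2) = pi"
proof -
  define f where "f = (\<lambda>t. agm_integral ((theta t)\<^sup>2) ((thetab t)\<^sup>2))"
  have "f (2 * t) = f t" if "t > 0" for t
  proof -
    have "((theta t)\<^sup>2 + (thetab t)\<^sup>2) / 2 = (theta (2 * t))\<^sup>2"
      using theta_sq[OF that] thetab_sq[OF that] by simp
    moreover have "sqrt ((theta t)\<^sup>2 * (thetab t)\<^sup>2) = (thetab (2 * t))\<^sup>2"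
      unfolding power_mult_distrib[symmetric] thetab_duplication[OF that] real_sqrt_abs by simp
    ultimately show ?thesis
      using agm_integral_step[of "(theta t)\<^sup>2" "(thetab t)\<^sup>2"] theta_pos[OF that] thetab_pos[OF that]
      by (simp add: f_def)
  qed
  moreover have "(f \<longlongrightarrow> pi) at_top"
  proof (rule tendsto_sandwich)
    have b: "pi / (theta (1 * t))\<^sup>2 \<le> f t" "f t \<le> pi / (thetab t)\<^sup>2" if "t > 0" for t
    proof -
      have "(thetab t)\<^sup>2 \<le> (theta t)\<^sup>2"
        using theta_sq[OF that] thetab_sq[OF that] by simp
      then show "pi / (theta (1 * t))\<^sup>2 \<le> f t" "f t \<le> pi / (thetab t)\<^sup>2"
        unfolding f_def using theta_pos[OF that] thetab_pos[OF that]
          agm_integral_bounds[of "(thetab t)\<^sup>2" "(theta t)\<^sup>2" "(thetab t)\<^sup>2" "(theta t)\<^sup>2"]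
        by simp_all
    qed
    show "\<forall>\<^sub>F t in at_top. pi / (theta (1 * t))\<^sup>2 \<le> f t"
      using eventually_gt_at_top[of 0] by eventually_elim (rule b)
    show "\<forall>\<^sub>F t in at_top. f t \<le> pi / (thetab t)\<^sup>2"
      using eventually_gt_at_top[of 0] by eventually_elim (rule b)
    have "((\<lambda>t. pi / (theta (1 * t))\<^sup>2) \<longlongrightarrow> pi / 1\<^sup>2) at_top"
      by (intro tendsto_intros theta_tendsto) auto
    then show "((\<lambda>t. pi / (theta (1 * t))\<^sup>2) \<longlongrightarrow> pi) at_top" by simp
    have "((\<lambda>t. pi / (thetab t)\<^sup>2) \<longlongrightarrow> pi / 1\<^sup>2) at_top"
      by (intro tendsto_intros thetab_tendsto) auto
    then show "((\<lambda>t. pi / (thetab t)\<^sup>2) \<longlongrightarrow> pi) at_top" by simp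
  qed
  ultimately have "f t = pi"
    using assms by (rule doubling_invariant_eq_limit)
  then show ?thesis by (simp add: f_def)
qed

lemma thetac_less_theta: 
  assumes "t > 0" shows "thetac t < theta t"
proof -
  have "thetab t ^ 4 > 0"
    using thetab_pos[OF assms] by simp
  then have "thetac t ^ 4 < theta t ^ 4"
    using jacobi_quartic[OF assms] by linarith
  then show ?thesis
    by (rule power_less_imp_less_base) (use theta_pos[OF assms] in simp)
qed

lemma thetab_less_theta: 
  assumes "t > 0" shows "thetab t < theta t"
proof -
  have "thetac t ^ 4 > 0"
    using thetac_pos[OF assms] by simp
  then have "thetab t ^ 4 < theta t ^ 4"
    using jacobi_quartic[OF assms] by linarith
  then show ?thesis
    by (rule power_less_imp_less_base) (use theta_pos[OF assms] in simp)
qed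

text \<open>The quotient \<open>theta t / thetac t\<close> grows like
  \<open>exp (pi t / 4) / 2\<close>, and \<open>arsinh y\<close> behaves like
  \<open>ln (2 y)\<close> for large \<open>y\<close>.\<close>

lemma arsinh_theta_div_thetac_tendsto:
  "((\<lambda>t. arsinh (theta t / thetac t) / t) \<longlongrightarrow> pi / 4) at_top"
proof -
  define w where "w = (\<lambda>t. theta (1 * t) / (thetac t * exp (pi * t / 4)))"
  \<comment> \<open>What is left of the argument \<open>y + sqrt (y^2 + 1)\<close> of the logarithm
    once \<open>exp (pi t / 4)\<close> is pulled out; it tends to 1.\<close>
  define h where "h = (\<lambda>t. w t + sqrt ((w t)\<^sup>2 + exp (- pi * t / 2)))"
  have w: "(w \<longlongrightarrow> 1 / 2) at_top"
    unfolding w_def by (intro tendsto_intros theta_tendsto thetac_exp_tendsto) auto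
  have e: "((\<lambda>t. exp (- pi * t / 2)) \<longlongrightarrow> 0) at_top"
    by real_asymp
  have h: "(h \<longlongrightarrow> 1 / 2 + sqrt ((1 / 2)\<^sup>2 + 0)) at_top"
    unfolding h_def by (intro tendsto_intros w e)
  have "((\<lambda>t. pi / 4 + ln (h t) * (1 / t)) \<longlongrightarrow> pi / 4 + ln (1 / 2 + sqrt ((1 / 2)\<^sup>2 + 0)) * 0) at_top"
    by (intro tendsto_intros h) (auto simp: real_sqrt_power, real_asymp)
  moreover have "\<forall>\<^sub>F t in at_top. pi / 4 + ln (h t) * (1 / t) = arsinh (theta t / thetac t) / t"
    using eventually_gt_at_top[of 0]
  proof eventually_elim
    case (elim t)
    define E where "E = exp (pi * t / 4)"
    have E: "E > 0" by (simp add: E_def)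
    have wt: "theta t / thetac t = E * w t"
      by (simp add: w_def E_def)
    have "w t > 0"
      using theta_pos[OF elim] thetac_pos[OF elim] by (simp add: w_def)
    then have "h t > 0"
      by (simp add: h_def add_pos_nonneg)
    have "E\<^sup>2 * exp (- pi * t / 2) = 1"
      unfolding E_def exp_of_nat_mult[symmetric] mult_exp_exp by simp
    then have "(E * w t)\<^sup>2 + 1 = E\<^sup>2 * ((w t)\<^sup>2 + exp (- pi * t / 2))"
      by (simp add: power_mult_distrib distrib_left)
    then have "sqrt ((E * w t)\<^sup>2 + 1) = E * sqrt ((w t)\<^sup>2 + exp (- pi * t / 2))"
      using E by (simp add: real_sqrt_mult)
    then have "arsinh (theta t / thetac t) = ln (E * h t)"
      unfolding wt arsinh_real_def by (simp add: h_def distrib_left)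
    also have "\<dots> = pi * t / 4 + ln (h t)"
      using E \<open>h t > 0\<close> by (simp add: ln_mult E_def)
    finally show ?case
      using elim by (simp add: field_simps)
  qed
  ultimately show ?thesis
    using tendsto_cong by fastforce
qed

text \<open>For \<open>thetac\<close> the mean runs the other way: a step leads from twice the
  squares at \<open>2 * t\<close> to the squares at \<open>t\<close>. Homogeneity turns the factor 2
  into 1/2, so it is the quotient by \<open>t\<close> that is invariant. Since \<open>thetac\<close>
  tends to 0 the integral diverges, and its linear growth is read off the \<open>arsinh\<close>
  bounds.\<close>

lemma agm_integral_theta_thetac:
  assumes "t > 0"
  shows "agm_integral ((theta t)\<^sup>2) ((thetac t)\<^sup>2) = pi * t"
proof -
  define f where "f = (\<lambda>t. agm_integral ((theta t)\<^sup>2) ((thetac t)\<^sup>2) / t)"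
  have "f (2 * t) = f t" if "t > 0" for t
  proof -
    have pos: "theta (2 * t) > 0" "thetac (2 * t) > 0"
      using that theta_pos thetac_pos by auto
    have "agm_integral ((theta t)\<^sup>2) ((thetac t)\<^sup>2) = agm_integral (2 * (theta (2*t))\<^sup>2) (2 * (thetac (2*t))\<^sup>2)"
    proof -
      have "sqrt (2 * (theta (2*t))\<^sup>2 * (2 * (thetac (2*t))\<^sup>2)) = (thetac t)\<^sup>2"
      proof -
        have "2 * (theta (2*t))\<^sup>2 * (2 * (thetac (2*t))\<^sup>2) = ((thetac t)\<^sup>2)\<^sup>2"
          unfolding thetac_sq[OF that] by (simp add: power_mult_distrib)
        then show ?thesis by (simp only: real_sqrt_abs abs_power2)
      qed
      moreover have "(2 * (theta (2*t))\<^sup>2 + 2 * (thetac (2*t))\<^sup>2) / 2 = (theta t)\<^sup>2"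
        using theta_sq[OF that] by simp
      ultimately show ?thesis
        using agm_integral_step[of "2 * (theta (2*t))\<^sup>2" "2 * (thetac (2*t))\<^sup>2"] pos by simp
    qed
    also have "\<dots> = agm_integral ((theta (2*t))\<^sup>2) ((thetac (2*t))\<^sup>2) / 2"
      using agm_integral_scale[of 2 "(theta (2*t))\<^sup>2" "(thetac (2*t))\<^sup>2"] pos by simp
    finally show ?thesis
      using that by (simp add: f_def field_simps)
  qed
  moreover have "(f \<longlongrightarrow> pi) at_top"
  proof (rule tendsto_sandwich)
    define u where "u = (\<lambda>t. arsinh (theta t / thetac t) / t)"
    have u: "(u \<longlongrightarrow> pi / 4) at_top"
      unfolding u_def by (rule arsinh_theta_div_thetac_tendsto)
    define l where "l = (\<lambda>t. 4 * u t / sqrt (((theta (1 * t))\<^sup>2)\<^sup>2 + (theta (1 * t))\<^sup>2 * (thetac t)\<^sup>2))"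
    have b: "l t \<le> f t" "f t \<le> 4 * u t / (theta (1 * t))\<^sup>2" if "t > 0" for t
    proof -
      have pos: "theta t > 0" "thetac t > 0"
        using that theta_pos thetac_pos by auto
      have "(thetac t)\<^sup>2 < (theta t)\<^sup>2"
        using thetac_less_theta[OF that] pos by (intro power_strict_mono) auto
      from agm_integral_arsinh_bounds[OF _ this] pos
      have "4 * arsinh (theta t / thetac t) / sqrt (((theta t)\<^sup>2)\<^sup>2 + (theta t)\<^sup>2 * (thetac t)\<^sup>2)
            \<le> agm_integral ((theta t)\<^sup>2) ((thetac t)\<^sup>2)"
          "agm_integral ((theta t)\<^sup>2) ((thetac t)\<^sup>2) \<le> 4 * arsinh (theta t / thetac t) / (theta t)\<^sup>2"
        by (auto simp: real_sqrt_divide)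
      from divide_right_mono[OF this(1), of t] divide_right_mono[OF this(2), of t] that
      show "l t \<le> f t" "f t \<le> 4 * u t / (theta (1 * t))\<^sup>2"
        by (simp_all add: l_def u_def f_def mult.commute)
    qed
    show "\<forall>\<^sub>F t in at_top. l t \<le> f t"
      using eventually_gt_at_top[of 0] by eventually_elim (rule b)
    show "\<forall>\<^sub>F t in at_top. f t \<le> 4 * u t / (theta (1 * t))\<^sup>2"
      using eventually_gt_at_top[of 0] by eventually_elim (rule b)
    have "((\<lambda>t. 4 * u t / (theta (1 * t))\<^sup>2) \<longlongrightarrow> 4 * (pi / 4) / 1\<^sup>2) at_top"
      by (intro tendsto_intros theta_tendsto u) auto
    then show "((\<lambda>t. 4 * u t / (theta (1 * t))\<^sup>2) \<longlongrightarrow> pi) at_top" by simp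
    have c0: "(thetac \<longlongrightarrow> 0) at_top"
    proof -
      have "((\<lambda>t. theta (1 / 4 * t) - theta (1 * t)) \<longlongrightarrow> 1 - 1) at_top"
        by (intro tendsto_intros theta_tendsto) auto
      then show ?thesis by (simp add: thetac_def[abs_def])
    qed
    have "(l \<longlongrightarrow> 4 * (pi / 4) / sqrt ((1\<^sup>2)\<^sup>2 + 1\<^sup>2 * 0\<^sup>2)) at_top"
      unfolding l_def by (intro tendsto_intros theta_tendsto u c0) auto
    then show "(l \<longlongrightarrow> pi) at_top" by simp
  qed
  ultimately have "f t = pi"
    using assms by (rule doubling_invariant_eq_limit)
  then show ?thesis using assms by (simp add: f_def field_simps)
qed

text \<open>Replacing \<open>theta (2 * t)\<close> by the larger \<open>theta t\<close> in the
  denominator. Iterated halving of the argument thus drives the ratio to 0 at small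
  arguments.\<close>

lemma thetab_div_theta_duplication_ge:
  assumes "t > 0"
  shows "thetab t / theta t \<le> (thetab (2*t) / theta (2*t))\<^sup>2"
proof -
  have pos: "theta t > 0" "thetab t > 0" "theta (2*t) > 0"
    using assms theta_pos thetab_pos by auto
  have "(theta (2*t))\<^sup>2 \<le> (theta t)\<^sup>2"
    using theta_sq[OF assms] by simp
  moreover have "(thetab (2*t))\<^sup>2 = theta t * thetab t"
    using thetab_duplication[OF assms] by simp
  moreover have "thetab t / theta t = theta t * thetab t / (theta t)\<^sup>2"
    using pos by (simp add: power2_eq_square)
  ultimately show ?thesis
    unfolding power_divide using pos by (auto intro!: divide_left_mono)
qed

text \<open>The intermediate value theorem between the limit 1 at infinity and values near 0 at the
  points \<open>(1/2) ^ n\<close>. The behaviour near 0 has to come from halving, since the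
  inversion formula rests on this lemma.\<close>

lemma thetab_div_theta_surj:
  assumes "0 < y" "y < 1"
  obtains s where "s > 0" "thetab s / theta s = y"
proof -
  define k where "k = (\<lambda>s. thetab s / theta s)"
  have k01: "0 < k s" "k s < 1" if "s > 0" for s
    using theta_pos[OF that] thetab_pos[OF that] thetab_less_theta[OF that] by (auto simp: k_def)
  have pw: "k ((1/2) ^ n) \<le> k 1 ^ (2 ^ n)" for n
  proof (induction n)
    case (Suc n)
    have "k ((1/2) ^ Suc n) \<le> (k ((1/2) ^ n))\<^sup>2"
      using thetab_div_theta_duplication_ge[of "(1/2) ^ Suc n"] by (simp add: k_def)
    also have "\<dots> \<le> (k 1 ^ (2 ^ n))\<^sup>2"
      using Suc k01[of "(1/2) ^ n"] by (intro power_mono) auto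
    finally show ?case by (simp add: power_mult[symmetric] mult.commute)
  qed auto
  obtain n where n: "k 1 ^ n < y"
    using real_arch_pow_inv[OF assms(1), of "k 1"] k01[of 1] by auto
  have "k 1 ^ (2 ^ n) \<le> k 1 ^ n"
    using k01[of 1] by (intro power_decreasing) (auto simp: less_imp_le less_exp)
  then have lo: "k ((1/2) ^ n) < y"
    using pw[of n] n by simp
  have "((\<lambda>s. thetab s / theta (1 * s)) \<longlongrightarrow> 1 / 1) at_top"
    by (intro tendsto_intros thetab_tendsto theta_tendsto) auto
  then have "(k \<longlongrightarrow> 1) at_top"
    by (simp add: k_def[abs_def])
  from order_tendstoD(1)[OF this assms(2)]
  obtain T where T: "\<And>s. s \<ge> T \<Longrightarrow> y < k s"
    by (auto simp: eventually_at_top_linorder)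
  have "\<exists>s. (1/2) ^ n \<le> s \<and> s \<le> max 1 T \<and> k s = y"
  proof (rule IVT')
    show "continuous_on {(1/2) ^ n..max 1 T} k"
    proof (intro continuous_at_imp_continuous_on ballI)
      fix s assume "s \<in> {(1/2) ^ n..max 1 T}"
      then have "s > 0"
        by (meson atLeastAtMost_iff half_gt_zero_iff less_le_trans zero_less_one zero_less_power zero_less_divide_1_iff zero_less_numeral)
      then show "isCont k s"
        unfolding k_def using theta_pos[of s]
        by (intro continuous_intros DERIV_isCont[OF DERIV_thetab] DERIV_isCont[OF DERIV_theta]) auto
    qed
    have "(1/2::real) ^ n \<le> 1" by (simp add: power_le_one)
    then show "(1/2) ^ n \<le> max 1 T" by simp
  qed (use lo T[of "max 1 T"] in \<open>auto intro: less_imp_le\<close>)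
  then obtain s where s: "(1/2) ^ n \<le> s" "k s = y" by blast
  moreover have "s > 0"
    using s(1) by (meson less_le_trans zero_less_power zero_less_divide_1_iff zero_less_numeral)
  ultimately show ?thesis
    using that by (auto simp: k_def)
qed

text \<open>The two integrals above express \<open>t\<close> and \<open>theta t\<close> through the ratio \<open>thetab t / theta t\<close>;
  exchanging this ratio with its complement \<open>thetac t / theta t\<close> turns \<open>t\<close> into \<open>1 / t\<close>.\<close>

theorem theta_inversion:
  assumes "t > 0"
  shows "theta (1 / t) = sqrt t * theta t"
proof -
  have pos: "theta t > 0" "thetab t > 0" "thetac t > 0"
    using assms theta_pos thetab_pos thetac_pos by auto
  define y where "y = thetac t / theta t"
  define z where "z = thetab t / theta t"
  have y: "0 < y" "y < 1"
    using pos thetac_less_theta[OF assms] by (auto simp: y_def)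
  have z: "0 < z" using pos by (simp add: z_def)
  have unit: "(thetab r / theta r) ^ 4 + (thetac r / theta r) ^ 4 = 1" if "r > 0" for r
    unfolding power_divide add_divide_distrib[symmetric] jacobi_quartic[OF that, symmetric]
    using theta_pos[OF that] by simp
  have yz: "z ^ 4 + y ^ 4 = 1"
    using unit[OF assms] by (simp add: y_def z_def)
  obtain s where s: "s > 0" "thetab s / theta s = y"
    using thetab_div_theta_surj[OF y] .
  have spos: "theta s > 0" "thetab s > 0" "thetac s > 0"
    using s theta_pos thetab_pos thetac_pos by auto
  have "(thetac s / theta s) ^ 4 = z ^ 4"
    using unit[OF s(1)] yz s(2) by simp
  then have sz: "thetac s / theta s = z"
    by (rule power_eq_imp_eq_base) (use spos z in auto)
  have sc: "agm_integral (p\<^sup>2) ((p * r)\<^sup>2) = agm_integral 1 (r\<^sup>2) / p\<^sup>2" if "p > 0" "r > 0" for p r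
    using agm_integral_scale[of "p\<^sup>2" 1 "r\<^sup>2"] that by (simp add: power_mult_distrib)
  have e: "thetab t = theta t * z" "thetac t = theta t * y" "thetab s = theta s * y" "thetac s = theta s * z"
    using pos spos s(2) sz by (simp add: z_def, simp add: y_def, auto simp: field_simps)
  \<comment> \<open>By homogeneity the integrals at \<open>t\<close> and at \<open>s\<close> involve
    only the two ratios \<open>y\<close> and \<open>z\<close>, in exchanged roles, so each of two
    integrals is evaluated twice.\<close>
  have 1: "agm_integral 1 (z\<^sup>2) = pi * (theta t)\<^sup>2"
    using agm_integral_theta_thetab[OF assms] sc[OF pos(1) z] pos by (simp add: e field_simps)
  have 2: "agm_integral 1 (y\<^sup>2) = pi * t * (theta t)\<^sup>2"
    using agm_integral_theta_thetac[OF assms] sc[OF pos(1) y(1)] pos by (simp add: e field_simps)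
  have 3: "agm_integral 1 (y\<^sup>2) = pi * (theta s)\<^sup>2"
    using agm_integral_theta_thetab[OF s(1)] sc[OF spos(1) y(1)] spos by (simp add: e field_simps)
  have 4: "agm_integral 1 (z\<^sup>2) = pi * s * (theta s)\<^sup>2"
    using agm_integral_theta_thetac[OF s(1)] sc[OF spos(1) z] spos by (simp add: e field_simps)
  have 5: "(theta s)\<^sup>2 = t * (theta t)\<^sup>2"
    using 2 3 by simp
  have "(theta t)\<^sup>2 = s * (theta s)\<^sup>2"
    using 1 4 by simp
  then have "(theta t)\<^sup>2 * (s * t) = (theta t)\<^sup>2 * 1"
    unfolding 5 by (simp add: mult_ac)
  then have "s * t = 1"
    using pos by (subst (asm) mult_left_cancel) auto
  then have "s = 1 / t"
    using assms by (simp add: field_simps)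
  moreover have "theta s = sqrt t * theta t"
    by (rule power2_eq_imp_eq) (use 5 spos pos assms in \<open>auto simp: power_mult_distrib\<close>)
  ultimately show ?thesis by simp
qed

lemma thetab_inversion:
  assumes "t > 0"
  shows "thetab (1 / t) = sqrt t * thetac t"
proof -
  have "theta (4 / t) = sqrt t / 2 * theta (t / 4)"
    using theta_inversion[of "t / 4"] assms by (simp add: real_sqrt_divide)
  then show ?thesis
    using theta_inversion[OF assms] by (simp add: thetab_def thetac_def algebra_simps)
qed

text \<open>Substitute \<open>(1 + x^2)^(-2)\<close> in the Beta integral. One minus this value is
  \<open>x^2 (x^2 + 2) / (1 + x^2)^2\<close>, which produces the second factor of the
  kernel.\<close>

lemma agm_integral_lemniscate: "2 * agm_integral 1 (sqrt 2) = Beta (1 / 4) (1 / 2)"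
proof -
  define g where "g = (\<lambda>x::real. inverse ((1 + x\<^sup>2)\<^sup>2))"
  define g' where "g' = (\<lambda>x::real. - (4 * x / (1 + x\<^sup>2) ^ 3))"
  define f where "f = (\<lambda>t::real. t powr (1/4 - 1) * (1 - t) powr (1/2 - 1))"
  have w: "1 + x\<^sup>2 > 0" for x :: real by (simp add: add_pos_nonneg)
  have der: "(g has_real_derivative g' x) (at x within {0<..})" if "x \<in> {0<..}" for x
  proof -
    have "((\<lambda>y. inverse (y\<^sup>2)) has_real_derivative - 2 / y ^ 3) (at y)" if "y > 0" for y :: real
      using that by (auto intro!: derivative_eq_intros simp: field_simps eval_nat_numeral)
    moreover have "((\<lambda>x::real. 1 + x\<^sup>2) has_real_derivative 2 * x) (at x within {0<..})"
      by (auto intro!: derivative_eq_intros)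
    ultimately show ?thesis
      unfolding g_def g'_def
      by (rule DERIV_cong[OF DERIV_chain2[where f = "\<lambda>y. inverse (y\<^sup>2)"]]) (use w in auto)
  qed
  have gx: "0 < g x" "g x < 1" if "x > 0" for x
  proof -
    have "1 < (1 + x\<^sup>2)\<^sup>2" using that by (intro one_less_power) auto
    then show "g x < 1" by (simp add: g_def inverse_less_1_iff)
    show "0 < g x" using w[of x] by (simp add: g_def)
  qed
  have inj: "inj_on g {0<..}"
  proof (rule inj_onI)
    fix x y :: real assume xy: "x \<in> {0<..}" "y \<in> {0<..}" "g x = g y"
    then have "(1 + x\<^sup>2)\<^sup>2 = (1 + y\<^sup>2)\<^sup>2" by (simp add: g_def)
    then have "1 + x\<^sup>2 = 1 + y\<^sup>2"
      by (rule power2_eq_imp_eq) (use w[of x] w[of y] in auto)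
    then have "x\<^sup>2 = y\<^sup>2" by simp
    then show "x = y" by (rule power2_eq_imp_eq) (use xy in auto)
  qed
  have img: "g ` {0<..} = {0<..<1}"
  proof -
    have "t \<in> g ` {0<..}" if t: "t \<in> {0<..<1}" for t
    proof (rule image_eqI)
      have s: "sqrt t > 0" "sqrt t < 1" using t by auto
      then have p: "inverse (sqrt t) - 1 > 0" by (simp add: one_less_inverse)
      then show "sqrt (inverse (sqrt t) - 1) \<in> {0<..}" by simp
      have "1 + (sqrt (inverse (sqrt t) - 1))\<^sup>2 = inverse (sqrt t)" using p by simp
      then show "t = g (sqrt (inverse (sqrt t) - 1))"
        using t by (simp add: g_def power_inverse)
    qed
    then show ?thesis using gx by auto
  qed
  have "(f has_integral Beta (1 / 4) (1 / 2)) {0<..<1}"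
    using has_integral_Beta_real[of "1/4" "1/2"] unfolding f_def by (simp add: has_integral_Icc_iff_Ioo)
  then have f: "f integrable_on {0<..<1}" "integral {0<..<1} f = Beta (1 / 4) (1 / 2)"
    by (auto intro: integral_unique)
  have "f absolutely_integrable_on {0<..<1}"
    using f(1) by (intro nonnegative_absolutely_integrable_1) (auto simp: f_def)
  then have "integral {0<..} (\<lambda>x. \<bar>g' x\<bar> * f (g x)) = Beta (1 / 4) (1 / 2)"
    using has_absolute_integral_change_of_variables_1'[OF _ der inj, of f "Beta (1/4) (1/2)"] img f(2)
    by auto
  also have "integral {0<..} (\<lambda>x. \<bar>g' x\<bar> * f (g x)) = integral {0<..} (\<lambda>x. 4 * agm_kernel 1 (sqrt 2) x)"
  proof (rule Henstock_Kurzweil_Integration.integral_cong)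
    fix x :: real assume "x \<in> {0<..}"
    then have x: "x > 0" by simp
    define W where "W = 1 + x\<^sup>2"
    define V where "V = x\<^sup>2 + 2"
    have W: "W > 0" "V > 0" by (auto simp: W_def V_def intro: add_pos_nonneg add_nonneg_pos)
    have gW: "g x = W powr (-2)"
      using W by (simp add: g_def W_def powr_minus powr_numeral)
    have "1 - g x = (x\<^sup>2 * V) / W\<^sup>2"
      using W by (simp add: g_def W_def[symmetric] field_simps)
         (simp add: W_def V_def power2_eq_square algebra_simps)
    then have "(1 - g x) powr (1/2 - 1) = inverse (sqrt ((x\<^sup>2 * V) / W\<^sup>2))"
      using x W by (simp add: powr_minus powr_half_sqrt)
    also have "sqrt ((x\<^sup>2 * V) / W\<^sup>2) = x * sqrt V / W"
      using x W by (simp add: real_sqrt_divide real_sqrt_mult)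
    finally have f2: "(1 - g x) powr (1/2 - 1) = W / (x * sqrt V)" by simp
    have f1: "g x powr (1/4 - 1) = W * sqrt W"
    proof -
      have "g x powr (1/4 - 1) = W powr (1 + 1/2)"
        unfolding gW powr_powr by simp
      also have "\<dots> = W * sqrt W"
        unfolding powr_add using W by (simp add: powr_half_sqrt)
      finally show ?thesis .
    qed
    have g'x: "\<bar>g' x\<bar> = 4 * x / W ^ 3"
      using x W by (simp add: g'_def W_def[symmetric])
    have "sqrt W * sqrt W = W" using W by simp
    then have "\<bar>g' x\<bar> * f (g x) = 4 / (sqrt W * sqrt V)"
      unfolding g'x f_def f1 f2 using x W by (simp add: field_simps eval_nat_numeral)
    also have "\<dots> = 4 * agm_kernel 1 (sqrt 2) x"
      by (simp add: agm_kernel_def real_sqrt_mult W_def V_def add.commute)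
    finally show "\<bar>g' x\<bar> * f (g x) = 4 * agm_kernel 1 (sqrt 2) x" .
  qed
  also have "\<dots> = 2 * agm_integral 1 (sqrt 2)"
    using agm_integral_half[of 1 "sqrt 2"] by simp
  finally show ?thesis by simp
qed

lemma Gamma_quarter: "sqrt 2 * (Gamma (1 / 4 :: real) * Gamma (3 / 4)) = 2 * pi"
proof -
  have "complex_of_real (Gamma (1/4) * Gamma (3/4)) = of_real pi / sin (of_real pi * (of_real (1 / 4)))"
    using Gamma_reflection_complex[of "of_real (1/4)"] 
    by (simp add: Gamma_complex_of_real[symmetric])
  also have "\<dots> = complex_of_real (pi / sin (pi / 4))"
    unfolding of_real_mult[symmetric] sin_of_real by simp
  finally have "Gamma (1/4) * Gamma (3/4) = pi / sin (pi / 4)"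
    unfolding of_real_eq_iff .
  then show ?thesis
    by (simp add: sin_45 field_simps)
qed

text \<open>At the fixed point \<open>t = 1\<close> inversion identifies \<open>thetac\<close> with
  \<open>thetab\<close>, so Jacobi's identity gives \<open>theta^2 = sqrt 2 * thetab^2\<close>. The
  integral with value \<open>pi\<close> is then a multiple of the lemniscatic one, and the
  reflection formula removes \<open>Gamma (1/4)\<close>.\<close>

theorem theta_1_quartic: "theta 1 ^ 4 = pi / Gamma (3 / 4) ^ 4"
proof -
  have pos: "theta 1 > 0" "thetab 1 > 0"
    using theta_pos thetab_pos by auto
  have "thetac 1 = thetab 1"
    using thetab_inversion[of 1] by simp
  then have "(sqrt 2 * (thetab 1)\<^sup>2)\<^sup>2 = ((theta 1)\<^sup>2)\<^sup>2"
    using jacobi_quartic[of 1] by (simp add: power_mult_distrib)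
  then have "sqrt 2 * (thetab 1)\<^sup>2 = (theta 1)\<^sup>2"
    by (rule power2_eq_imp_eq) auto
  then have a: "(theta 1)\<^sup>2 = (thetab 1)\<^sup>2 * sqrt 2" by (simp add: mult.commute)
  have swap: "agm_integral p q = agm_integral q p" for p q
    by (simp add: agm_integral_def agm_kernel_def[abs_def] mult.commute)
  have "pi = agm_integral ((thetab 1)\<^sup>2 * 1) ((thetab 1)\<^sup>2 * sqrt 2)"
    using agm_integral_theta_thetab[of 1] a swap by simp
  also have "\<dots> = agm_integral 1 (sqrt 2) / (thetab 1)\<^sup>2"
    using pos by (intro agm_integral_scale) auto
  finally have "(thetab 1)\<^sup>2 = agm_integral 1 (sqrt 2) / pi"
    using pos by (simp add: field_simps)
  then have "2 * pi * (theta 1)\<^sup>2 = sqrt 2 * Beta (1/4) (1/2)"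
    using agm_integral_lemniscate a by (simp add: field_simps)
  also have "\<dots> = sqrt 2 * sqrt pi * Gamma (1/4) / Gamma (3/4)"
    by (simp add: Beta_def Gamma_one_half_real)
  also have "\<dots> = 2 * pi * sqrt pi / Gamma (3/4) ^ 2"
  proof -
    have "Gamma (3/4 :: real) > 0" by (simp add: Gamma_real_pos)
    then show ?thesis
      by (simp add: power2_eq_square Gamma_quarter[symmetric])
  qed
  finally have "2 * pi * (theta 1)\<^sup>2 = 2 * pi * (sqrt pi / Gamma (3/4) ^ 2)"
    by simp
  then have "(theta 1)\<^sup>2 = sqrt pi / Gamma (3/4) ^ 2"
    by (subst (asm) mult_left_cancel) auto
  then have "((theta 1)\<^sup>2)\<^sup>2 = (sqrt pi / Gamma (3/4) ^ 2)\<^sup>2"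
    by simp
  then show ?thesis
    by (simp add: power_divide)
qed

section \<open>Fourier inversion at the origin and entire functions of two variables\<close>

lemma integrable_cauchy: "integrable lborel (\<lambda>u::real. inverse (1 + u\<^sup>2))"
proof -
  have "einterval (-\<infinity>) \<infinity> = UNIV"
    by (auto simp: einterval_def)
  then show ?thesis
    using integrable_inverse_1_plus_square by (simp add: set_integrable_def)
qed

lemma integrable_cauchy_bound:
  fixes f :: "real \<Rightarrow> complex"
  assumes "f \<in> borel_measurable borel" "\<And>u. norm (f u) \<le> K * inverse (1 + u\<^sup>2)"
  shows "integrable lborel f"
proof (rule Bochner_Integration.integrable_bound)
  show "integrable lborel (\<lambda>u::real. K * inverse (1 + u\<^sup>2))"
    using integrable_cauchy by (rule integrable_mult_right)
  show "AE u in lborel. norm (f u) \<le> norm (K * inverse (1 + u\<^sup>2))"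
    using assms(2) by (intro AE_I2) (smt (verit) real_norm_def)
qed (use assms in simp)

lemma integral_deriv_eq_0:
  fixes F f :: "real \<Rightarrow> complex"
  assumes F: "\<And>u. (F has_vector_derivative f u) (at u)" and "\<And>u. isCont f u"
    and f: "integrable lborel f"
    and "(F \<longlongrightarrow> 0) at_top" "(F \<longlongrightarrow> 0) at_bot"
  shows "(LBINT u. f u) = 0"
proof -
  have ei: "einterval (-\<infinity>) \<infinity> = UNIV"
    by (auto simp: einterval_def)
  have "(LBINT u=-\<infinity>..\<infinity>. f u) = 0 - 0"
    by (rule interval_integral_FTC_integrable)
       (use assms in \<open>auto simp: ei set_integrable_def ereal_tendsto_simps\<close>)
  then show ?thesis
    by (simp add: interval_lebesgue_integral_def ei set_lebesgue_integral_def)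
qed

lemma has_vector_derivative_cis:
  "((\<lambda>u. exp (- (\<i> * complex_of_real (u * x)))) has_vector_derivative
     - (\<i> * complex_of_real x) * exp (- (\<i> * complex_of_real (u * x)))) (at u)"
proof -
  have "((\<lambda>z. exp (- (\<i> * (z * complex_of_real x)))) has_field_derivative
     - (\<i> * complex_of_real x) * exp (- (\<i> * (complex_of_real u * complex_of_real x)))) (at (complex_of_real u))"
    by (auto intro!: derivative_eq_intros)
  from has_vector_derivative_real_field[OF this] show ?thesis
    by simp
qed

lemma norm_cis_neg [simp]: "norm (exp (- (\<i> * complex_of_real x))) = 1"
  by simp

lemma fourier_deriv:
  fixes h h1 :: "real \<Rightarrow> complex"
  assumes h: "\<And>u. (h has_vector_derivative h1 u) (at u)" and h1: "\<And>u. isCont h1 u"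
    and b: "\<And>u. norm (h u) \<le> K * inverse (1 + u\<^sup>2)" and b1: "\<And>u. norm (h1 u) \<le> K * inverse (1 + u\<^sup>2)"
  shows "(LBINT u. h1 u * exp (- (\<i> * complex_of_real (u * x)))) 
    = \<i> * complex_of_real x * (LBINT u. h u * exp (- (\<i> * complex_of_real (u * x))))"
proof -
  define e where "e = (\<lambda>u. exp (- (\<i> * complex_of_real (u * x))))"
  have ce: "isCont e u" for u unfolding e_def by (intro continuous_intros)
  have ch: "isCont h u" for u
    using h has_vector_derivative_continuous by blast
  have meas: "f \<in> borel_measurable borel" if "\<And>u. isCont f u" for f :: "real \<Rightarrow> complex"
    using that by (intro borel_measurable_continuous_onI continuous_at_imp_continuous_on) auto
  have ne: "norm (e u) = 1" for u
    unfolding e_def by (rule norm_cis_neg)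
  have i1: "integrable lborel (\<lambda>u. h1 u * e u)" and i: "integrable lborel (\<lambda>u. h u * e u)"
    by (rule integrable_cauchy_bound[of _ K], rule meas, intro continuous_intros h1 ch ce,
        simp add: norm_mult ne b b1)+
  have d: "((\<lambda>u. h u * e u) has_vector_derivative (h1 u * e u - \<i> * complex_of_real x * (h u * e u))) (at u)" for u
    using has_vector_derivative_mult[OF h[of u] has_vector_derivative_cis[of x u]]
    by (simp add: e_def algebra_simps)
  have lim: "((\<lambda>u. h u * e u) \<longlongrightarrow> 0) F" if "((\<lambda>u. K * inverse (1 + u\<^sup>2)) \<longlongrightarrow> 0) F" for F
    by (rule Lim_null_comparison[OF _ that]) (auto simp: norm_mult ne b)
  have "(LBINT u. h1 u * e u - \<i> * complex_of_real x * (h u * e u)) = 0"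
  proof (rule integral_deriv_eq_0[OF d])
    show "isCont (\<lambda>u. h1 u * e u - \<i> * complex_of_real x * (h u * e u)) u" for u
      by (intro continuous_intros h1 ch ce)
    show "((\<lambda>u. h u * e u) \<longlongrightarrow> 0) at_top" "((\<lambda>u. h u * e u) \<longlongrightarrow> 0) at_bot"
      by (rule lim; real_asymp)+
  qed (use i i1 in auto)
  moreover have "(LBINT u. h1 u * e u - \<i> * complex_of_real x * (h u * e u))
     = (LBINT u. h1 u * e u) - \<i> * complex_of_real x * (LBINT u. h u * e u)"
    using i i1 by (subst Bochner_Integration.integral_diff) auto
  ultimately show ?thesis
    unfolding e_def by simp
qed

text \<open>A rescaling of the characteristic function of the standard normal distribution.\<close>

lemma fourier_gaussian:
  assumes "e > 0"
  shows "(LBINT x. complex_of_real (std_normal_density (e * x)) * exp (- (\<i> * complex_of_real (u * x))))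
     = complex_of_real (sqrt (2 * pi) / e * std_normal_density (u / e))"
proof -
  have "char std_normal_distribution (- (u / e)) = complex_of_real (exp (- ((u / e)\<^sup>2) / 2))"
    unfolding char_std_normal_distribution by simp
  moreover have "char std_normal_distribution (- (u / e)) 
     = (LBINT x. std_normal_density x *\<^sub>R iexp (- (u / e) * x))"
    unfolding char_def by (subst integral_density) (auto simp: normal_density_nonneg)
  ultimately have *: "(LBINT x. std_normal_density x *\<^sub>R iexp (- (u / e) * x)) = complex_of_real (exp (- ((u / e)\<^sup>2) / 2))"
    by simp
  have "(LBINT x. std_normal_density x *\<^sub>R iexp (- (u / e) * x)) 
     = \<bar>e\<bar> *\<^sub>R (LBINT x. std_normal_density (0 + e * x) *\<^sub>R iexp (- (u / e) * (0 + e * x)))"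
    using assms by (intro lborel_integral_real_affine) auto
  also have "(\<lambda>x. std_normal_density (0 + e * x) *\<^sub>R iexp (- (u / e) * (0 + e * x)))
     = (\<lambda>x. complex_of_real (std_normal_density (e * x)) * exp (- (\<i> * complex_of_real (u * x))))"
    using assms by (auto simp: fun_eq_iff scaleR_conv_of_real)
  finally have "complex_of_real e * (LBINT x. complex_of_real (std_normal_density (e * x)) * exp (- (\<i> * complex_of_real (u * x))))
     = complex_of_real (exp (- ((u / e)\<^sup>2) / 2))"
    using * assms by (simp add: scaleR_conv_of_real)
  moreover have "exp (- ((u / e)\<^sup>2) / 2) = sqrt (2 * pi) * std_normal_density (u / e)"
    by (simp add: std_normal_density_def)
  ultimately show ?thesis
    using assms by (simp add: field_simps)
qed

text \<open>Two derivatives of \<open>h\<close> bound \<open>(1 + x^2) * F x\<close>, so the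
  transform \<open>F\<close> is integrable. Its integral is reached as a limit of integrals damped
  by a Gaussian.\<close>

lemma fourier_inversion_0:
  fixes h h1 h2 :: "real \<Rightarrow> complex"
  assumes h: "\<And>u. (h has_vector_derivative h1 u) (at u)" and h1: "\<And>u. (h1 has_vector_derivative h2 u) (at u)"
    and h2: "\<And>u. isCont h2 u"
    and b: "\<And>u. norm (h u) \<le> K * inverse (1 + u\<^sup>2)" "\<And>u. norm (h1 u) \<le> K * inverse (1 + u\<^sup>2)"
        "\<And>u. norm (h2 u) \<le> K * inverse (1 + u\<^sup>2)"
  shows "integrable lborel (\<lambda>x. LBINT u. h u * exp (- (\<i> * complex_of_real (u * x))))"
    and "(LBINT x. LBINT u. h u * exp (- (\<i> * complex_of_real (u * x)))) = 2 * pi * h 0"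
proof -
  define F where "F = (\<lambda>x. LBINT u. h u * exp (- (\<i> * complex_of_real (u * x))))"
  have ch: "isCont h u" "isCont h1 u" for u
    using h h1 has_vector_derivative_continuous by blast+
  have meas: "f \<in> borel_measurable borel" if "\<And>u. isCont f u" for f :: "real \<Rightarrow> complex"
    using that by (intro borel_measurable_continuous_onI continuous_at_imp_continuous_on) auto
  have hm [measurable]: "h \<in> borel_measurable borel" "h2 \<in> borel_measurable borel"
    using ch h2 by (auto intro!: meas)
  have hi: "integrable lborel h" "integrable lborel h2"
    using b by (auto intro!: integrable_cauchy_bound)
  have Fm [measurable]: "F \<in> borel_measurable borel"
    unfolding F_def by measurable
  define M where "M = (LBINT u. norm (h u)) + (LBINT u. norm (h2 u))"
  have bd: "norm (LBINT u. k u * exp (- (\<i> * complex_of_real (u * x)))) \<le> (LBINT u. norm (k u))"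
    for k :: "real \<Rightarrow> complex" and x
    using integral_norm_bound[of lborel "\<lambda>u. k u * exp (- (\<i> * complex_of_real (u * x)))"]
    by (simp add: norm_mult)
  have Fb: "norm (F x) \<le> M * inverse (1 + x\<^sup>2)" for x
  proof -
    have "(LBINT u. h2 u * exp (- (\<i> * complex_of_real (u * x)))) = \<i> * complex_of_real x * (\<i> * complex_of_real x * F x)"
      unfolding F_def by (subst fourier_deriv[OF h1 h2 b(2,3)], subst fourier_deriv[OF h ch(2) b(1,2)]) simp
    then have "x\<^sup>2 * norm (F x) = norm (LBINT u. h2 u * exp (- (\<i> * complex_of_real (u * x))))"
      by (simp add: norm_mult power2_eq_square)
    then have "x\<^sup>2 * norm (F x) \<le> (LBINT u. norm (h2 u))"
      using bd[of h2 x] by simp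
    moreover have "norm (F x) \<le> (LBINT u. norm (h u))"
      using bd[of h x] by (simp add: F_def)
    ultimately have "(1 + x\<^sup>2) * norm (F x) \<le> M"
      by (simp add: M_def algebra_simps)
    moreover have "1 + x\<^sup>2 > 0" by (simp add: add_pos_nonneg)
    ultimately show ?thesis
      by (simp add: field_simps)
  qed
  have Fi: "integrable lborel F"
    by (rule integrable_cauchy_bound[OF Fm Fb])
  then show "integrable lborel (\<lambda>x. LBINT u. h u * exp (- (\<i> * complex_of_real (u * x))))"
    by (simp add: F_def)
  define G :: "real \<Rightarrow> real" where "G = std_normal_density"
  have G: "G x = 1 / sqrt (2 * pi) * exp (- x\<^sup>2 / 2)" for x
    by (simp add: G_def std_normal_density_def)
  have Gm [measurable]: "G \<in> borel_measurable borel"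
    unfolding G_def by simp
  have Gb: "\<bar>G x\<bar> \<le> G 0" "G x \<ge> 0" for x
    by (auto simp: G divide_right_mono)
  have Gc: "isCont G x" for x
    unfolding G[abs_def] by (intro continuous_intros) auto
  have Gi: "integrable lborel G" "(LBINT x. G x) = 1"
    unfolding G_def by (simp_all add: integrable_normal_density integral_normal_density)
  \<comment> \<open>By Fubini the wide Gaussian against \<open>F\<close> becomes, up to a constant,
    its own transform against \<open>h\<close>: a Gaussian average concentrating at 0 as
    \<open>e\<close> shrinks.\<close>
  have regular: "(LBINT x. F x * complex_of_real (G (e * x))) = sqrt (2 * pi) * (LBINT v. complex_of_real (G v) * h (e * v))"
    if "e > 0" for e
  proof -
    define P where "P = (\<lambda>x u. h u * exp (- (\<i> * complex_of_real (u * x))) * complex_of_real (G (e * x)))"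
    have Pm [measurable]: "case_prod P \<in> borel_measurable (lborel \<Otimes>\<^sub>M lborel)"
      unfolding P_def by measurable
    have nP: "norm (P x u) = norm (h u) * G (e * x)" for x u
      using Gb(2)[of "e * x"] by (simp add: P_def norm_mult)
    have Gei: "integrable lborel (\<lambda>x. G (e * x))"
      using lborel_integrable_real_affine[OF Gi(1), of e 0] that by simp
    have "integrable (lborel \<Otimes>\<^sub>M lborel) (case_prod P)"
    proof (rule lborel_pair.Fubini_integrable[OF Pm])
      show "integrable lborel (\<lambda>x. LBINT u. norm (case (x, u) of (x, u) \<Rightarrow> P x u))"
        using Gei hi by (simp add: nP)
      have "integrable lborel (P x)" for x
      proof (rule Bochner_Integration.integrable_bound)
        show "integrable lborel (\<lambda>u. norm (h u) * G (e * x))"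
          using hi by simp
        show "P x \<in> borel_measurable lborel"
          unfolding P_def by measurable
        show "AE u in lborel. norm (P x u) \<le> norm (norm (h u) * G (e * x))"
          using Gb(2) by (intro AE_I2) (simp add: nP)
      qed
      then show "AE x in lborel. integrable lborel (\<lambda>u. case (x, u) of (x, u) \<Rightarrow> P x u)"
        by simp
    qed
    from lborel_pair.Fubini_integral[OF this]
    have fub: "(LBINT x. LBINT u. P x u) = (LBINT u. LBINT x. P x u)" by simp
    have "(LBINT x. F x * complex_of_real (G (e * x))) = (LBINT x. LBINT u. P x u)"
      by (simp add: P_def F_def)
    also have "\<dots> = (LBINT u. h u * (LBINT x. complex_of_real (G (e * x)) * exp (- (\<i> * complex_of_real (u * x)))))"
    proof -
      have "(LBINT x. P x u) = h u * (LBINT x. complex_of_real (G (e * x)) * exp (- (\<i> * complex_of_real (u * x))))" for u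
        unfolding integral_mult_right_zero[symmetric]
        by (rule Bochner_Integration.integral_cong) (auto simp: P_def)
      then show ?thesis
        unfolding fub by (simp only:)
    qed
    also have "\<dots> = (LBINT u. h u * complex_of_real (sqrt (2 * pi) / e * G (u / e)))"
      unfolding G_def by (simp only: fourier_gaussian[OF that])
    also have "\<dots> = \<bar>e\<bar> *\<^sub>R (LBINT v. h (0 + e * v) * complex_of_real (sqrt (2 * pi) / e * G ((0 + e * v) / e)))"
      using that by (intro lborel_integral_real_affine) auto
    also have "\<dots> = complex_of_real e * (LBINT v. (complex_of_real (sqrt (2 * pi)) / e) * (complex_of_real (G v) * h (e * v)))"
      using that by (simp add: scaleR_conv_of_real mult_ac)
    also have "\<dots> = sqrt (2 * pi) * (LBINT v. complex_of_real (G v) * h (e * v))"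
      unfolding integral_mult_right_zero using that by simp
    finally show ?thesis .
  qed
  define e where "e = (\<lambda>n. 1 / real (Suc n))"
  have epos: "e n > 0" for n by (simp add: e_def)
  have elim: "e \<longlonglongrightarrow> 0" unfolding e_def by real_asymp
  have "(\<lambda>n. LBINT x. F x * complex_of_real (G (e n * x))) \<longlonglongrightarrow> (LBINT x. F x * complex_of_real (G 0))"
  proof (rule integral_dominated_convergence[where w = "\<lambda>x. norm (F x) * G 0"])
    show "integrable lborel (\<lambda>x. norm (F x) * G 0)"
      using Fi by simp
    have "(\<lambda>n. F x * complex_of_real (G (e n * x))) \<longlonglongrightarrow> F x * complex_of_real (G 0)" for x
    proof -
      have "(\<lambda>n. e n * x) \<longlonglongrightarrow> 0 * x" by (intro tendsto_intros elim)
      then have "(\<lambda>n. G (e n * x)) \<longlonglongrightarrow> G 0"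
        using isCont_tendsto_compose[OF Gc] by simp
      then show ?thesis by (intro tendsto_intros)
    qed
    then show "AE x in lborel. (\<lambda>n. F x * complex_of_real (G (e n * x))) \<longlonglongrightarrow> F x * complex_of_real (G 0)"
      by simp
    show "AE x in lborel. norm (F x * complex_of_real (G (e n * x))) \<le> norm (F x) * G 0" for n
      using Gb by (intro AE_I2) (auto simp: norm_mult intro: mult_left_mono)
  qed simp_all
  moreover have "(\<lambda>n. LBINT v. complex_of_real (G v) * h (e n * v)) \<longlonglongrightarrow> (LBINT v. complex_of_real (G v) * h 0)"
  proof (rule integral_dominated_convergence[where w = "\<lambda>v. G v * \<bar>K\<bar>"])
    show "integrable lborel (\<lambda>v. G v * \<bar>K\<bar>)"
      using Gi by simp
    have "(\<lambda>n. complex_of_real (G v) * h (e n * v)) \<longlonglongrightarrow> complex_of_real (G v) * h 0" for v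
    proof -
      have "(\<lambda>n. e n * v) \<longlonglongrightarrow> 0 * v" by (intro tendsto_intros elim)
      then have "(\<lambda>n. h (e n * v)) \<longlonglongrightarrow> h 0"
        using isCont_tendsto_compose[OF ch(1)] by simp
      then show ?thesis by (intro tendsto_intros)
    qed
    then show "AE v in lborel. (\<lambda>n. complex_of_real (G v) * h (e n * v)) \<longlonglongrightarrow> complex_of_real (G v) * h 0"
      by simp
    have "norm (h u) \<le> \<bar>K\<bar>" for u
    proof -
      have "inverse (1 + u\<^sup>2) \<le> 1" by (simp add: inverse_le_1_iff add_nonneg_eq_0_iff)
      then have "\<bar>K\<bar> * inverse (1 + u\<^sup>2) \<le> \<bar>K\<bar> * 1" by (intro mult_left_mono) auto
      moreover have "K * inverse (1 + u\<^sup>2) \<le> \<bar>K\<bar> * inverse (1 + u\<^sup>2)"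
        by (intro mult_right_mono) auto
      ultimately show ?thesis using b(1)[of u] by linarith
    qed
    then show "AE v in lborel. norm (complex_of_real (G v) * h (e n * v)) \<le> G v * \<bar>K\<bar>" for n
      using Gb by (intro AE_I2) (auto simp: norm_mult intro!: mult_left_mono)
  qed simp_all
  then have "(\<lambda>n. LBINT x. F x * complex_of_real (G (e n * x))) \<longlonglongrightarrow> 
      sqrt (2 * pi) * (LBINT v. complex_of_real (G v) * h 0)"
    unfolding regular[OF epos] by (intro tendsto_intros)
  ultimately have "(LBINT x. F x * complex_of_real (G 0)) = sqrt (2 * pi) * (LBINT v. complex_of_real (G v) * h 0)"
    using LIMSEQ_unique by blast
  then have eq: "complex_of_real (G 0) * (LBINT x. F x) = complex_of_real (sqrt (2 * pi)) * h 0"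
    using Gi by (simp add: mult.commute)
  have "complex_of_real (sqrt (2 * pi)) * complex_of_real (G 0) = 1"
    unfolding of_real_mult[symmetric] by (simp add: G)
  then have "(LBINT x. F x) = (complex_of_real (sqrt (2 * pi)) * complex_of_real (G 0)) * (LBINT x. F x)"
    by simp
  also have "\<dots> = complex_of_real (sqrt (2 * pi)) * complex_of_real (sqrt (2 * pi)) * h 0"
    using eq by (simp only: mult.assoc)
  also have "complex_of_real (sqrt (2 * pi)) * complex_of_real (sqrt (2 * pi)) = 2 * pi"
    unfolding of_real_mult[symmetric] by (simp only: real_sqrt_mult_self) simp
  finally show "(LBINT x. LBINT u. h u * exp (- (\<i> * complex_of_real (u * x)))) = 2 * pi * h 0"
    by (simp add: F_def)
qed

lemma norm_exp_minus_1_minus_le: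
  fixes z :: complex
  shows "norm (exp z - 1 - z) \<le> exp (norm z) * (norm z)\<^sup>2"
proof -
  have "norm (exp z - (\<Sum>k\<le>1. z ^ k / fact k)) \<le> exp \<bar>Re z\<bar> * norm z ^ Suc 1 / fact 1"
    by (rule Taylor_exp)
  also have "\<dots> \<le> exp (norm z) * (norm z)\<^sup>2"
    by (auto intro!: mult_right_mono abs_Re_le_cmod simp: power2_eq_square)
  finally show ?thesis by (simp add: diff_diff_eq)
qed

text \<open>Total differentiability is proved directly. The formal partial derivatives leave the
  remainder \<open>exp k - 1 - k\<close>, where \<open>k\<close> is linear in the increment and at
  most of size \<open>1 + \<bar>u\<bar>\<close> in \<open>u\<close>. It is quadratic in the
  increment, up to an exponential weight that \<open>p\<close> absorbs.\<close>

lemma exponential_integral_has_derivative: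
  fixes p :: "real \<Rightarrow> complex" and A B :: "real \<Rightarrow> real" and w s :: complex
  assumes m: "p \<in> borel_measurable borel" "A \<in> borel_measurable borel" "B \<in> borel_measurable borel"
    and i: "\<And>N. integrable lborel (\<lambda>u. norm (p u) * exp (N * \<bar>u\<bar>))"
    and AB: "\<And>u. \<bar>A u\<bar> \<le> c * (1 + \<bar>u\<bar>)" "\<And>u. \<bar>B u\<bar> \<le> c * (1 + \<bar>u\<bar>)"
  shows "integrable lborel (\<lambda>u. p u * exp (w * complex_of_real (A u) + s * complex_of_real (B u)))"
    and "\<exists>a b. ((\<lambda>z. LBINT u. p u * exp (fst z * complex_of_real (A u) + snd z * complex_of_real (B u)))
        has_derivative (\<lambda>h. a * fst h + b * snd h)) (at (w, s))"
proof -
  note [measurable] = m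
  have c: "c \<ge> 0" using AB(1)[of 0] by simp
  define J where "J = (\<lambda>u::real. 1 + \<bar>u\<bar>)"
  have J: "J u \<ge> 1" "J u \<le> exp (J u)" for u
    using exp_ge_add_one_self[of "J u"] by (auto simp: J_def)
  have iJ: "integrable lborel (\<lambda>u. norm (p u) * exp (N * J u))" for N
  proof -
    have "(\<lambda>u. norm (p u) * exp (N * J u)) = (\<lambda>u. exp N * (norm (p u) * exp (N * \<bar>u\<bar>)))"
      by (auto simp: fun_eq_iff J_def distrib_left exp_add)
    then show ?thesis using i[of N] by simp
  qed
  have lin: "norm (x * complex_of_real (A u) + y * complex_of_real (B u)) \<le> (norm x + norm y) * c * J u" for x y u
  proof -
    have "norm (x * complex_of_real (A u) + y * complex_of_real (B u)) \<le> norm x * \<bar>A u\<bar> + norm y * \<bar>B u\<bar>"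
      using norm_triangle_ineq[of "x * complex_of_real (A u)" "y * complex_of_real (B u)"]
      by (simp add: norm_mult)
    also have "\<dots> \<le> norm x * (c * J u) + norm y * (c * J u)"
      using AB[of u] by (intro add_mono mult_left_mono) (auto simp: J_def)
    finally show ?thesis by (simp add: algebra_simps)
  qed
  have nexp: "norm (exp (x * complex_of_real (A u) + y * complex_of_real (B u))) \<le> exp ((norm x + norm y) * c * J u)" for x y u
    using norm_exp[of "x * complex_of_real (A u) + y * complex_of_real (B u)"] lin[of x u y]
    by (meson exp_le_cancel_iff order_trans)
  have int: "integrable lborel (\<lambda>u. p u * q u * exp (x * complex_of_real (A u) + y * complex_of_real (B u)))"
    if [measurable]: "q \<in> borel_measurable borel" and q: "\<And>u. norm (q u) \<le> (1 + c) * J u" for q x y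
  proof (rule Bochner_Integration.integrable_bound)
    show "integrable lborel (\<lambda>u. (1 + c) * (norm (p u) * exp (((norm x + norm y) * c + 1) * J u)))"
      using iJ by simp
    show "AE u in lborel. norm (p u * q u * exp (x * complex_of_real (A u) + y * complex_of_real (B u)))
         \<le> norm ((1 + c) * (norm (p u) * exp (((norm x + norm y) * c + 1) * J u)))"
    proof (rule AE_I2)
      fix u
      have "norm (q u) \<le> (1 + c) * exp (J u)"
        using q[of u] J(2)[of u] c by (meson add_nonneg_nonneg mult_left_mono order_trans zero_le_one)
      then have "norm (p u) * norm (q u) * norm (exp (x * complex_of_real (A u) + y * complex_of_real (B u)))
          \<le> norm (p u) * ((1 + c) * exp (J u)) * exp ((norm x + norm y) * c * J u)"
        using nexp[of x u y] c by (intro mult_mono) auto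
      also have "\<dots> = (1 + c) * (norm (p u) * exp (((norm x + norm y) * c + 1) * J u))"
        by (simp add: distrib_right exp_add algebra_simps)
      finally show "norm (p u * q u * exp (x * complex_of_real (A u) + y * complex_of_real (B u)))
         \<le> norm ((1 + c) * (norm (p u) * exp (((norm x + norm y) * c + 1) * J u)))"
        using c by (simp add: norm_mult)
    qed
  qed measurable
  have le1c: "J u \<le> (1 + c) * J u" "c * J u \<le> (1 + c) * J u" for u
    using J(1)[of u] c by (auto simp: algebra_simps)
  have int1: "integrable lborel (\<lambda>u. p u * exp (x * complex_of_real (A u) + y * complex_of_real (B u)))" for x y
    using int[of "\<lambda>_. 1" x y] order_trans[OF J(1) le1c(1)] by simp
  then show "integrable lborel (\<lambda>u. p u * exp (w * complex_of_real (A u) + s * complex_of_real (B u)))" .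
  have intA: "integrable lborel (\<lambda>u. p u * complex_of_real (A u) * exp (w * complex_of_real (A u) + s * complex_of_real (B u)))"
    using AB le1c(2) by (intro int) (auto simp: J_def intro: order_trans)
  have intB: "integrable lborel (\<lambda>u. p u * complex_of_real (B u) * exp (w * complex_of_real (A u) + s * complex_of_real (B u)))"
    using AB le1c(2) by (intro int) (auto simp: J_def intro: order_trans)
  define a where "a = (LBINT u. p u * complex_of_real (A u) * exp (w * complex_of_real (A u) + s * complex_of_real (B u)))"
  define b where "b = (LBINT u. p u * complex_of_real (B u) * exp (w * complex_of_real (A u) + s * complex_of_real (B u)))"
  define E where "E = (\<lambda>z. LBINT u. p u * exp (fst z * complex_of_real (A u) + snd z * complex_of_real (B u)))"
  \<comment> \<open>The three summands pay for \<open>exp (z u)\<close>, for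
    \<open>exp (norm (k u))\<close> and for \<open>(J u)^2 \<le> exp (2 * J u)\<close>. The 4 in
    \<open>K\<close> is the square of the 2 in
    \<open>norm (k u) \<le> 2 * d * c * J u\<close>.\<close>
  define N where "N = (norm w + norm s) * c + 2 * c + 2"
  define K where "K = 4 * c\<^sup>2 * (LBINT u. norm (p u) * exp (N * J u))"
  have main: "norm (E (w + x, s + y) - E (w, s) - (a * x + b * y)) \<le> K * (norm (x, y))\<^sup>2"
    if small: "norm (x, y) < 1" for x y
  proof -
    define k where "k = (\<lambda>u. x * complex_of_real (A u) + y * complex_of_real (B u))"
    define z where "z = (\<lambda>u. w * complex_of_real (A u) + s * complex_of_real (B u))"
    define d where "d = norm (x, y)"
    have d: "0 \<le> d" "norm x \<le> d" "norm y \<le> d" "d \<le> 1"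
      using norm_fst_le[of x y] norm_snd_le[of y x] small by (auto simp: d_def)
    have "E (w + x, s + y) - E (w, s) - (a * x + b * y)
       = (LBINT u. p u * exp ((w + x) * complex_of_real (A u) + (s + y) * complex_of_real (B u)) - p u * exp (z u)
          - (p u * complex_of_real (A u) * exp (z u) * x + p u * complex_of_real (B u) * exp (z u) * y))"
      unfolding E_def a_def b_def z_def using int1 intA intB by simp
    also have "\<dots> = (LBINT u. p u * exp (z u) * (exp (k u) - 1 - k u))"
      by (rule Bochner_Integration.integral_cong) (auto simp: z_def k_def algebra_simps exp_add[symmetric])
    also have "norm \<dots> \<le> (LBINT u. (4 * c\<^sup>2 * d\<^sup>2) * (norm (p u) * exp (N * J u)))"
    proof (rule Bochner_Integration.integral_norm_bound_integral)
      show "integrable lborel (\<lambda>u. (4 * c\<^sup>2 * d\<^sup>2) * (norm (p u) * exp (N * J u)))"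
        using iJ by simp
      show bound: "norm (p u * exp (z u) * (exp (k u) - 1 - k u)) \<le> (4 * c\<^sup>2 * d\<^sup>2) * (norm (p u) * exp (N * J u))" for u
      proof -
        have "norm (k u) \<le> (norm x + norm y) * c * J u"
          unfolding k_def by (rule lin)
        also have "\<dots> \<le> (d + d) * c * J u"
          using d c J(1)[of u] by (intro mult_right_mono add_mono) auto
        finally have k1: "norm (k u) \<le> 2 * d * c * J u" by simp
        also have "\<dots> \<le> 2 * 1 * c * J u"
          using d c J(1)[of u] by (intro mult_right_mono mult_left_mono) auto
        finally have k2: "norm (k u) \<le> 2 * c * J u" by simp
        have "(norm (k u))\<^sup>2 \<le> (2 * d * c * J u)\<^sup>2"
          using k1 by (intro power_mono) auto
        also have "\<dots> = 4 * c\<^sup>2 * d\<^sup>2 * (J u)\<^sup>2"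
          by (simp add: power_mult_distrib)
        also have "\<dots> \<le> 4 * c\<^sup>2 * d\<^sup>2 * (exp (J u))\<^sup>2"
          using J[of u] by (intro mult_left_mono power_mono) auto
        finally have k3: "(norm (k u))\<^sup>2 \<le> 4 * c\<^sup>2 * d\<^sup>2 * exp (2 * J u)"
          by (simp add: exp_double)
        have "norm (exp (k u) - 1 - k u) \<le> exp (norm (k u)) * (norm (k u))\<^sup>2"
          by (rule norm_exp_minus_1_minus_le)
        also have "\<dots> \<le> exp (2 * c * J u) * (4 * c\<^sup>2 * d\<^sup>2 * exp (2 * J u))"
          using k2 k3 by (intro mult_mono) auto
        finally have e1: "norm (exp (k u) - 1 - k u) \<le> exp (2 * c * J u) * (4 * c\<^sup>2 * d\<^sup>2 * exp (2 * J u))" .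
        have e2: "norm (exp (z u)) \<le> exp ((norm w + norm s) * c * J u)"
          unfolding z_def by (rule nexp)
        have "norm (p u * exp (z u) * (exp (k u) - 1 - k u)) 
          \<le> norm (p u) * exp ((norm w + norm s) * c * J u) * (exp (2 * c * J u) * (4 * c\<^sup>2 * d\<^sup>2 * exp (2 * J u)))"
          unfolding norm_mult using e1 e2 by (intro mult_mono) auto
        also have "\<dots> = (4 * c\<^sup>2 * d\<^sup>2) * (norm (p u) * exp (N * J u))"
          by (simp add: N_def distrib_right exp_add)
        finally show ?thesis .
      qed
      show "integrable lborel (\<lambda>u. p u * exp (z u) * (exp (k u) - 1 - k u))"
      proof (rule Bochner_Integration.integrable_bound)
        show "integrable lborel (\<lambda>u. (4 * c\<^sup>2 * d\<^sup>2) * (norm (p u) * exp (N * J u)))"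
          using iJ by simp
        show "(\<lambda>u. p u * exp (z u) * (exp (k u) - 1 - k u)) \<in> borel_measurable lborel"
          unfolding z_def k_def by measurable
        show "AE u in lborel. norm (p u * exp (z u) * (exp (k u) - 1 - k u)) \<le> norm ((4 * c\<^sup>2 * d\<^sup>2) * (norm (p u) * exp (N * J u)))"
          using bound by (intro AE_I2) (smt (verit) real_norm_def)
      qed
    qed
    also have "\<dots> = K * (norm (x, y))\<^sup>2"
      by (simp add: K_def d_def)
    finally show ?thesis .
  qed
  have "(E has_derivative (\<lambda>h. a * fst h + b * snd h)) (at (w, s))"
  proof (rule has_derivativeI_sandwich[where e = 1 and H = "\<lambda>z. K * norm (z - (w, s))"])
    show "bounded_linear (\<lambda>h. a * fst h + b * snd h)"
      by (intro bounded_linear_add bounded_linear_const_mult bounded_linear_fst bounded_linear_snd)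
    fix v assume v: "v \<noteq> (w, s)" "dist v (w, s) < 1"
    define x y where "x = fst v - w" and "y = snd v - s"
    have xy: "v - (w, s) = (x, y)" "v = (w + x, s + y)"
      by (auto simp: x_def y_def prod_eq_iff)
    have "norm (x, y) > 0" "norm (x, y) < 1"
      using v by (auto simp: xy(1)[symmetric] dist_norm)
    then show "norm (E v - E (w, s) - (a * fst (v - (w, s)) + b * snd (v - (w, s)))) / norm (v - (w, s)) \<le> K * norm (v - (w, s))"
      using main[of x y] unfolding xy(1) unfolding xy(2)
      by (simp add: pos_divide_le_eq power2_eq_square mult.assoc)
  next
    have "((\<lambda>z. K * norm (z - (w, s))) \<longlongrightarrow> K * norm ((w, s) - (w, s))) (at (w, s))"
      by (intro tendsto_intros)
    then show "((\<lambda>z. K * norm (z - (w, s))) \<longlongrightarrow> 0) (at (w, s))" by simp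
  qed simp
  then show "\<exists>a b. ((\<lambda>z. LBINT u. p u * exp (fst z * complex_of_real (A u) + snd z * complex_of_real (B u)))
        has_derivative (\<lambda>h. a * fst h + b * snd h)) (at (w, s))"
    unfolding E_def by blast
qed

section \<open>Identity theorem in two variables\<close>

lemma entire2_line_holomorphic:
  assumes "entire2 f"
  shows "(\<lambda>z. f (a + z * b) (c + z * d)) holomorphic_on UNIV"
proof -
  have "(\<lambda>z. f (a + z * b) (c + z * d)) field_differentiable (at z)" for z
  proof -
    obtain p q where pq: "((\<lambda>p. f (fst p) (snd p)) has_derivative (\<lambda>h. p * fst h + q * snd h))
        (at (a + z * b, c + z * d))"
      using assms unfolding entire2_def by blast
    have "((\<lambda>z. (a + z * b, c + z * d)) has_derivative (\<lambda>h. (h * b, h * d))) (at z)"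
      by (auto intro!: derivative_eq_intros)
    from has_derivative_compose[OF this pq]
    have "((\<lambda>z. f (a + z * b) (c + z * d)) has_derivative (\<lambda>h. p * (h * b) + q * (h * d))) (at z)"
      by simp
    then have "((\<lambda>z. f (a + z * b) (c + z * d)) has_field_derivative (p * b + q * d)) (at z)"
      unfolding has_field_derivative_def
      by (rule has_derivative_eq_rhs) (simp add: fun_eq_iff algebra_simps)
    then show ?thesis
      unfolding field_differentiable_def by blast
  qed
  then show ?thesis
    by (simp add: holomorphic_on_def)
qed

lemma entire2_unique:
  assumes "entire2 f" "entire2 g"
    and eq: "\<And>w s. Re w < Re s \<Longrightarrow> Re s < 0 \<Longrightarrow> f w s = g w s"
  shows "f = g"
proof (intro ext)
  fix w s
  \<comment> \<open>The complex line through \<open>(-2, -1)\<close>, a point of the region, at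
    \<open>z = 0\<close>, and through the given \<open>(w, s)\<close> at \<open>z = 1\<close>. On it
    the identity theorem in one variable suffices.\<close>
  define S where "S = {z. Re (-2 + z * (w + 2)) < Re (-1 + z * (s + 1)) \<and> Re (-1 + z * (s + 1)) < 0}"
  have "f (-2 + 1 * (w + 2)) (-1 + 1 * (s + 1)) = g (-2 + 1 * (w + 2)) (-1 + 1 * (s + 1))"
  proof (rule analytic_continuation_open[of S UNIV "\<lambda>z. f (-2 + z * (w + 2)) (-1 + z * (s + 1))"
        "\<lambda>z. g (-2 + z * (w + 2)) (-1 + z * (s + 1))"])
    show "open S"
      unfolding S_def by (intro open_Collect_conj open_Collect_less continuous_intros)
    have "0 \<in> S" by (simp add: S_def)
    then show "S \<noteq> {}" by blast
    show "(\<lambda>z. f (-2 + z * (w + 2)) (-1 + z * (s + 1))) holomorphic_on UNIV"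
         "(\<lambda>z. g (-2 + z * (w + 2)) (-1 + z * (s + 1))) holomorphic_on UNIV"
      by (rule entire2_line_holomorphic; fact)+
  qed (use eq in \<open>auto simp: S_def\<close>)
  then show "f w s = g w s" by simp
qed

section \<open>Logarithmic coordinates\<close>

text \<open>With \<open>t = e\<^bsup>2u\<^esup>\<close> and \<open>g = gth\<close>: \<open>Xth = g'\<close> and \<open>2 (Rth + Eth) = g''\<close> (the Riccati equation). The span of
  \<open>Rth\<close> and \<open>Eth\<close> over polynomials in \<open>Xth\<close> and \<open>Vth\<close> is closed under differentiation, so that all
  derivatives of \<open>H\<^sub>w\<close> decay because \<open>Rth\<close> and \<open>Eth\<close> do.\<close>

definition gth :: "real \<Rightarrow> real" where
  "gth u = u / 2 + ln (theta (exp (2 * u)))"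

definition Xth :: "real \<Rightarrow> real" where
  "Xth u = 1 / 2 + 2 * exp (2 * u) * ltheta (exp (2 * u))"

text \<open>The weight \<open>exp (2 * u)\<close> compensates the fourth power of
  \<open>sqrt t\<close> in the inversion formula, so that \<open>u\<close> to \<open>-u\<close>
  exchanges \<open>Bth\<close> and \<open>Cth\<close>. The constant makes their product the
  inhomogeneous term in \<open>g'' / 2\<close>.\<close>

definition Bth :: "real \<Rightarrow> real" where
  "Bth u = pi / 2 * exp (2 * u) * thetab (exp (2 * u)) ^ 4"

definition Cth :: "real \<Rightarrow> real" where
  "Cth u = pi / 2 * exp (2 * u) * thetac (exp (2 * u)) ^ 4"

definition Rth :: "real \<Rightarrow> real" where
  "Rth u = (Xth u)\<^sup>2 - 1 / 4"

definition Eth :: "real \<Rightarrow> real" where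
  "Eth u = Bth u * Cth u"

definition Vth :: "real \<Rightarrow> real" where
  "Vth u = Cth u - Bth u"

lemma DERIV_comp_exp:
  assumes "\<And>t. t > 0 \<Longrightarrow> (f has_real_derivative f' t) (at t)"
  shows "((\<lambda>u. f (exp (2 * u))) has_real_derivative 2 * exp (2 * u) * f' (exp (2 * u))) (at u)"
proof -
  have "((\<lambda>u::real. exp (2 * u)) has_real_derivative 2 * exp (2 * u)) (at u)"
    by (auto intro!: derivative_eq_intros)
  from DERIV_chain2[OF assms this] show ?thesis by (simp add: mult.commute)
qed

lemma DERIV_gth: "(gth has_real_derivative Xth u) (at u)"
proof -
  have t: "theta (exp (2 * u)) > 0" by (simp add: theta_pos)
  show ?thesis
    unfolding gth_def[abs_def] Xth_def using t
    by (auto intro!: derivative_eq_intros DERIV_comp_exp[OF DERIV_theta'])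
qed

lemma DERIV_Xth: "(Xth has_real_derivative 2 * (Rth u + Eth u)) (at u)"
proof -
  define t where "t = exp (2 * u)"
  have t: "t > 0" by (simp add: t_def)
  have e: "((\<lambda>u::real. exp (2 * u)) has_real_derivative 2 * exp (2 * u)) (at u)"
    by (auto intro!: derivative_eq_intros)
  have "((\<lambda>u. 1 / 2 + 2 * (exp (2 * u) * ltheta (exp (2 * u)))) has_real_derivative
      0 + 2 * (2 * t * ltheta t + 2 * t * dltheta t * t)) (at u)"
    by (rule DERIV_cong[OF DERIV_add[OF DERIV_const DERIV_cmult[OF DERIV_mult[OF e
            DERIV_comp_exp[OF DERIV_ltheta]]]]]) (simp_all add: t_def algebra_simps)
  then have "(Xth has_real_derivative 0 + 2 * (2 * t * ltheta t + 2 * t * dltheta t * t)) (at u)"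
    by (simp add: Xth_def[abs_def] mult.assoc)
  moreover have "0 + 2 * (2 * t * ltheta t + 2 * t * dltheta t * t) = 2 * (Rth u + Eth u)"
    unfolding Rth_def Eth_def Xth_def Bth_def Cth_def t_def[symmetric] ltheta_riccati[OF t]
    by (simp add: power2_eq_square algebra_simps)
  ultimately show ?thesis by simp
qed

lemma DERIV_Bth: "(Bth has_real_derivative 4 * Bth u * (Xth u + Cth u)) (at u)"
proof -
  have e: "((\<lambda>u::real. exp (2 * u)) has_real_derivative 2 * exp (2 * u)) (at u)"
    by (auto intro!: derivative_eq_intros)
  have "((\<lambda>u. pi / 2 * (exp (2 * u) * thetab (exp (2 * u)) ^ 4)) has_real_derivative 4 * Bth u * (Xth u + Cth u)) (at u)"
    by (rule DERIV_cong[OF DERIV_cmult[OF DERIV_mult[OF e DERIV_power[OF DERIV_comp_exp[OF DERIV_thetab']]]]])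
      (simp_all add: Bth_def Xth_def Cth_def algebra_simps eval_nat_numeral)
  then show ?thesis
    by (simp add: Bth_def[abs_def] mult.assoc)
qed

lemma DERIV_Cth: "(Cth has_real_derivative 4 * Cth u * (Xth u - Bth u)) (at u)"
proof -
  have e: "((\<lambda>u::real. exp (2 * u)) has_real_derivative 2 * exp (2 * u)) (at u)"
    by (auto intro!: derivative_eq_intros)
  have "((\<lambda>u. pi / 2 * (exp (2 * u) * thetac (exp (2 * u)) ^ 4)) has_real_derivative 4 * Cth u * (Xth u - Bth u)) (at u)"
    by (rule DERIV_cong[OF DERIV_cmult[OF DERIV_mult[OF e DERIV_power[OF DERIV_comp_exp[OF DERIV_thetac']]]]])
      (simp_all add: Bth_def Xth_def Cth_def algebra_simps eval_nat_numeral)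
  then show ?thesis
    by (simp add: Cth_def[abs_def] mult.assoc)
qed

lemma DERIV_Rth: "(Rth has_real_derivative 4 * Xth u * (Rth u + Eth u)) (at u)"
  unfolding Rth_def[abs_def]
  by (rule DERIV_cong[OF DERIV_diff[OF DERIV_power[OF DERIV_Xth] DERIV_const]]) (simp add: Rth_def)

lemma DERIV_Eth: "(Eth has_real_derivative 4 * Eth u * (2 * Xth u + Vth u)) (at u)"
  unfolding Eth_def[abs_def]
  by (rule DERIV_cong[OF DERIV_mult[OF DERIV_Bth DERIV_Cth]]) (simp add: Vth_def algebra_simps)

lemma DERIV_Vth: "(Vth has_real_derivative 4 * Xth u * Vth u - 8 * Eth u) (at u)"
  unfolding Vth_def[abs_def]
  by (rule DERIV_cong[OF DERIV_diff[OF DERIV_Cth DERIV_Bth]]) (simp add: Eth_def algebra_simps)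

text \<open>The inversion formula contributes \<open>ln (sqrt (exp (2 * u))) = u\<close>, which the
  two terms \<open>u / 2\<close> and \<open>- u / 2\<close> balance.\<close>

lemma gth_minus: "gth (- u) = gth u"
proof -
  have "theta (exp (2 * (- u))) = sqrt (exp (2 * u)) * theta (exp (2 * u))"
    using theta_inversion[of "exp (2 * u)"] by (simp add: exp_minus inverse_eq_divide)
  also have "sqrt (exp (2 * u)) = exp u"
    by (rule real_sqrt_unique) (auto simp: exp_double)
  finally show ?thesis
    using theta_pos[of "exp (2 * u)"] by (simp add: gth_def ln_mult)
qed

lemma Xth_minus: "Xth (- u) = - Xth u"
proof -
  have "((\<lambda>u. gth (- u)) has_real_derivative Xth (- u) * - 1) (at u)"
    by (rule DERIV_chain2[OF DERIV_gth]) (auto intro!: derivative_eq_intros)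
  then have "(gth has_real_derivative - Xth (- u)) (at u)"
    by (simp add: gth_minus)
  then show ?thesis
    using DERIV_gth DERIV_unique by fastforce
qed

lemma Bth_minus: "Bth (- u) = Cth u"
proof -
  define t where "t = exp (2 * u)"
  have t: "t > 0" "exp (2 * (- u)) = 1 / t"
    by (auto simp: t_def exp_minus inverse_eq_divide)
  have "sqrt t ^ 4 = t\<^sup>2"
  proof -
    have "sqrt t ^ 4 = (sqrt t ^ 2) ^ 2" by simp
    then show ?thesis using t by simp
  qed
  then have "thetab (1 / t) ^ 4 = t\<^sup>2 * thetac t ^ 4"
    using thetab_inversion[OF t(1)] by (simp add: power_mult_distrib)
  then show ?thesis
    unfolding Bth_def Cth_def t(2) t_def[symmetric] using t(1) by (simp add: power2_eq_square)
qed

lemma Cth_minus: "Cth (- u) = Bth u"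
  using Bth_minus[of "- u"] by simp

lemma Rth_minus: "Rth (- u) = Rth u" and Eth_minus: "Eth (- u) = Eth u" and Vth_minus: "Vth (- u) = - Vth u"
  by (simp_all add: Rth_def Eth_def Vth_def Xth_minus Bth_minus Cth_minus)

section \<open>Growth classes\<close>

definition rapid :: "(real \<Rightarrow> complex) \<Rightarrow> bool" where
  "rapid f \<longleftrightarrow> (\<forall>N. \<exists>K. \<forall>u. norm (f u) \<le> K * exp (- N * \<bar>u\<bar>))"

definition moderate :: "(real \<Rightarrow> complex) \<Rightarrow> bool" where
  "moderate f \<longleftrightarrow> (\<exists>N K. \<forall>u. norm (f u) \<le> K * exp (N * \<bar>u\<bar>))"

lemma rapid_moderate: "rapid f \<Longrightarrow> moderate f"
  unfolding rapid_def moderate_def by (metis mult_minus_left)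

lemma rapid_add: "rapid f \<Longrightarrow> rapid g \<Longrightarrow> rapid (\<lambda>u. f u + g u)"
  unfolding rapid_def
proof (intro allI)
  fix N assume "\<forall>N. \<exists>K. \<forall>u. norm (f u) \<le> K * exp (- N * \<bar>u\<bar>)" "\<forall>N. \<exists>K. \<forall>u. norm (g u) \<le> K * exp (- N * \<bar>u\<bar>)"
  then obtain K L where "\<And>u. norm (f u) \<le> K * exp (- N * \<bar>u\<bar>)" "\<And>u. norm (g u) \<le> L * exp (- N * \<bar>u\<bar>)"
    by blast
  then have "norm (f u + g u) \<le> (K + L) * exp (- N * \<bar>u\<bar>)" for u
    unfolding distrib_right by (metis add_mono norm_triangle_ineq order_trans)
  then show "\<exists>K. \<forall>u. norm (f u + g u) \<le> K * exp (- N * \<bar>u\<bar>)" by blast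
qed

lemma norm_mult_exp_le:
  fixes a b :: complex
  assumes "norm a \<le> K * exp x" "norm b \<le> L * exp y"
  shows "norm (a * b) \<le> K * L * exp (x + y)"
proof -
  have "norm (a * b) \<le> (K * exp x) * (L * exp y)"
    unfolding norm_mult using assms by (intro mult_mono) (auto intro: order_trans[OF norm_ge_zero])
  then show ?thesis by (simp add: exp_add mult_ac)
qed

text \<open>The rate demanded of \<open>f\<close> is raised by the growth rate of \<open>g\<close>.
  Rapid functions thus form an ideal over the moderate ones, and decay of a long expression follows
  from its shape.\<close>

lemma rapid_mult: 
  assumes "rapid f" "moderate g" shows "rapid (\<lambda>u. f u * g u)"
  unfolding rapid_def
proof (intro allI)
  fix N
  obtain M L where L: "\<And>u. norm (g u) \<le> L * exp (M * \<bar>u\<bar>)"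
    using assms(2) unfolding moderate_def by blast
  obtain K where K: "\<And>u. norm (f u) \<le> K * exp (- (N + M) * \<bar>u\<bar>)"
    using assms(1) unfolding rapid_def by blast
  have "norm (f u * g u) \<le> K * L * exp (- N * \<bar>u\<bar>)" for u
    using norm_mult_exp_le[OF K L, of u u] by (simp add: algebra_simps)
  then show "\<exists>K. \<forall>u. norm (f u * g u) \<le> K * exp (- N * \<bar>u\<bar>)" by blast
qed

lemma rapid_mult': "moderate g \<Longrightarrow> rapid f \<Longrightarrow> rapid (\<lambda>u. g u * f u)"
  using rapid_mult[of f g] by (simp add: mult.commute)

lemma moderate_mult: 
  assumes "moderate f" "moderate g" shows "moderate (\<lambda>u. f u * g u)"
proof -
  obtain M L where L: "\<And>u. norm (g u) \<le> L * exp (M * \<bar>u\<bar>)"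
    using assms(2) unfolding moderate_def by blast
  obtain N K where K: "\<And>u. norm (f u) \<le> K * exp (N * \<bar>u\<bar>)"
    using assms(1) unfolding moderate_def by blast
  have "norm (f u * g u) \<le> K * L * exp ((N + M) * \<bar>u\<bar>)" for u
    using norm_mult_exp_le[OF K L, of u u] by (simp add: algebra_simps)
  then show ?thesis unfolding moderate_def by blast
qed

lemma moderate_const: "moderate (\<lambda>_. c)"
  unfolding moderate_def by (rule exI[of _ 0], rule exI[of _ "norm c"]) simp

lemma moderate_add: 
  assumes "moderate f" "moderate g" shows "moderate (\<lambda>u. f u + g u)"
proof -
  obtain M L where L: "\<And>u. norm (g u) \<le> L * exp (M * \<bar>u\<bar>)"
    using assms(2) unfolding moderate_def by blast
  obtain N K where K: "\<And>u. norm (f u) \<le> K * exp (N * \<bar>u\<bar>)"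
    using assms(1) unfolding moderate_def by blast
  have "norm (f u + g u) \<le> (K + L) * exp ((\<bar>N\<bar> + \<bar>M\<bar>) * \<bar>u\<bar>)" for u
  proof -
    have nn: "0 \<le> K" "0 \<le> L"
      using order_trans[OF norm_ge_zero K[of 0]] order_trans[OF norm_ge_zero L[of 0]] by auto
    have "K * exp (N * \<bar>u\<bar>) \<le> K * exp ((\<bar>N\<bar> + \<bar>M\<bar>) * \<bar>u\<bar>)" "L * exp (M * \<bar>u\<bar>) \<le> L * exp ((\<bar>N\<bar> + \<bar>M\<bar>) * \<bar>u\<bar>)"
      using nn by (auto intro!: mult_left_mono mult_right_mono)
    then show ?thesis
      using K[of u] L[of u] norm_triangle_ineq[of "f u" "g u"] by (simp add: distrib_right)
  qed
  then show ?thesis unfolding moderate_def by blast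
qed


lemma exp_minus_abs_le: "exp (- \<bar>u\<bar>) \<le> 2 * inverse (1 + u\<^sup>2)" for u :: real
proof -
  have "1 + \<bar>u\<bar> + \<bar>u\<bar>\<^sup>2 / 2 \<le> exp \<bar>u\<bar>"
    by (rule exp_lower_Taylor_quadratic) simp
  then have "(1 + u\<^sup>2) / 2 \<le> exp \<bar>u\<bar>"
    by simp
  moreover have "1 + u\<^sup>2 > 0" by (simp add: add_pos_nonneg)
  ultimately show ?thesis
    by (simp add: exp_minus field_simps)
qed

lemma rapid_cauchy_bound:
  assumes "rapid f" 
  obtains K where "K \<ge> 0" "\<And>u. norm (f u) \<le> K * inverse (1 + u\<^sup>2)"
proof -
  obtain K where K: "\<And>u. norm (f u) \<le> K * exp (- 1 * \<bar>u\<bar>)"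
    using assms unfolding rapid_def by blast
  have "K \<ge> 0" using order_trans[OF norm_ge_zero K[of 0]] by simp
  have "norm (f u) \<le> (2 * K) * inverse (1 + u\<^sup>2)" for u
    using K[of u] mult_left_mono[OF exp_minus_abs_le[of u] \<open>K \<ge> 0\<close>] by simp
  then show ?thesis using that[of "2 * K"] \<open>K \<ge> 0\<close> by simp
qed

lemma rapid_weighted_integrable:
  assumes "rapid f" "f \<in> borel_measurable borel"
  shows "integrable lborel (\<lambda>u. norm (f u) * exp (N * \<bar>u\<bar>))"
proof -
  have "moderate (\<lambda>u. complex_of_real (exp (N * \<bar>u\<bar>)))"
    unfolding moderate_def by (rule exI[of _ N], rule exI[of _ 1]) simp
  then obtain K where "\<And>u. norm (f u * complex_of_real (exp (N * \<bar>u\<bar>))) \<le> K * inverse (1 + u\<^sup>2)"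
    using rapid_cauchy_bound[OF rapid_mult[OF assms(1)]] by metis
  then have "integrable lborel (\<lambda>u. f u * complex_of_real (exp (N * \<bar>u\<bar>)))"
    using assms(2) by (intro integrable_cauchy_bound[of _ K]) auto
  from integrable_norm[OF this] show ?thesis
    by (simp add: norm_mult)
qed

text \<open>For \<open>t = exp (2 * u)\<close> the inequality \<open>(1 + t/m)^m \<le> exp t\<close>
  gives \<open>t^m \<le> m^m * exp (pi t)\<close>. Of the \<open>m = k + n\<close> powers,
  \<open>k\<close> pay for \<open>t^k\<close> and the other \<open>n\<close> supply
  \<open>exp (- 2 n u)\<close>.\<close>

lemma rapid_nome: 
  fixes N :: real
  shows "\<exists>K. \<forall>u\<ge>0. exp (2 * u) ^ k * exp (- pi * exp (2 * u)) \<le> K * exp (- N * u)"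
proof -
  \<comment> \<open>The maximum with 1 keeps \<open>m\<close> positive for every \<open>N\<close>
    and \<open>k\<close>.\<close>
  obtain n :: nat where n: "max 1 (N / 2) \<le> real n"
    using real_arch_simple by blast
  define m where "m = k + n"
  have m: "m > 0" using n by (simp add: m_def)
  have "exp (2 * u) ^ k * exp (- pi * exp (2 * u)) \<le> real m ^ m * exp (- N * u)" if "u \<ge> 0" for u
  proof -
    define t where "t = exp (2 * u)"
    have t: "t > 0" by (simp add: t_def)
    have "(t / m) ^ m \<le> (1 + t / m) ^ m"
      using t by (intro power_mono) auto
    also have "\<dots> \<le> exp t"
      using t m by (intro exp_ge_one_plus_x_over_n_power_n) auto
    also have "\<dots> \<le> exp (pi * t)"
      using t pi_gt3 by simp
    finally have "t ^ m / real m ^ m \<le> exp (pi * t)"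
      by (simp add: power_divide)
    then have "t ^ m * exp (- pi * t) \<le> real m ^ m"
      using m by (simp add: exp_minus field_simps)
    then have "t ^ n * (t ^ k * exp (- pi * t)) \<le> real m ^ m"
      by (simp add: m_def power_add mult_ac)
    then have "t ^ k * exp (- pi * t) \<le> real m ^ m * inverse (t ^ n)"
      using t by (simp add: field_simps)
    also have "inverse (t ^ n) = exp (- (2 * real n) * u)"
      by (simp add: t_def exp_of_nat_mult[symmetric] exp_minus[symmetric] mult_ac)
    also have "real m ^ m * exp (- (2 * real n) * u) \<le> real m ^ m * exp (- N * u)"
      using n that by (intro mult_left_mono) (auto intro!: mult_right_mono)
    finally show ?thesis by (simp add: t_def)
  qed
  then show ?thesis by blast
qed

lemma rapidI_nome:
  assumes even: "\<And>u. \<bar>f (- u)\<bar> = \<bar>f u\<bar>"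
    and b: "\<And>u. u \<ge> 0 \<Longrightarrow> \<bar>f u\<bar> \<le> c * (exp (2 * u) ^ k * exp (- pi * exp (2 * u)))" and c: "c \<ge> 0"
  shows "rapid (\<lambda>u. complex_of_real (f u))"
  unfolding rapid_def
proof
  fix N
  obtain K where K: "\<And>u. u \<ge> 0 \<Longrightarrow> exp (2 * u) ^ k * exp (- pi * exp (2 * u)) \<le> K * exp (- N * u)"
    using rapid_nome by blast
  have "norm (complex_of_real (f u)) \<le> (c * K) * exp (- N * \<bar>u\<bar>)" for u
  proof -
    have "\<bar>f \<bar>u\<bar>\<bar> \<le> c * (K * exp (- N * \<bar>u\<bar>))"
      by (rule order_trans[OF b mult_left_mono[OF K c]]) auto
    moreover have "\<bar>f \<bar>u\<bar>\<bar> = \<bar>f u\<bar>" using even[of u] by (cases "u \<ge> 0") auto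
    ultimately show ?thesis by (simp add: mult.assoc)
  qed
  then show "\<exists>K. \<forall>u. norm (complex_of_real (f u)) \<le> K * exp (- N * \<bar>u\<bar>)" by blast
qed

section \<open>Bounds on the theta functions in logarithmic coordinates\<close>

lemma sqser_1_bounded:
  assumes "r < 1"
  obtains M where "M \<ge> 1" "\<And>q. 0 \<le> q \<Longrightarrow> q \<le> r \<Longrightarrow> sqser (Suc 0) q \<le> M"
proof (cases "r \<ge> 0")
  case True
  have "continuous_on {0..r} (sqser (Suc 0))"
    using assms by (intro continuous_at_imp_continuous_on) (auto intro: isCont_sqser)
  then obtain x where "x \<in> {0..r}" "\<And>y. y \<in> {0..r} \<Longrightarrow> sqser (Suc 0) y \<le> sqser (Suc 0) x"
    using continuous_attains_sup[of "{0..r}" "sqser (Suc 0)"] True by auto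
  then show ?thesis
    using that[of "sqser (Suc 0) x"] sqser_1_ge[of x] assms by auto
qed (use that[of 1] in auto)

lemma theta_le_theta_1: "t \<ge> 1 \<Longrightarrow> theta t \<le> theta 1"
  using theta_antimono[of 1 t] by (cases "t = 1") auto

lemma t_ltheta_bound: 
  obtains c where "c \<ge> 0" "\<And>t. t \<ge> 1 \<Longrightarrow> \<bar>2 * t * ltheta t\<bar> \<le> c * (t * exp (- pi * t))"
proof -
  have "exp (- pi) < 1" by simp
  then obtain M where M: "M \<ge> 1" "\<And>q. 0 \<le> q \<Longrightarrow> q \<le> exp (- pi) \<Longrightarrow> sqser (Suc 0) q \<le> M"
    using sqser_1_bounded by metis
  have "\<bar>2 * t * ltheta t\<bar> \<le> 4 * pi * M * (t * exp (- pi * t))" if "t \<ge> 1" for t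
  proof -
    define S where "S = sqser (Suc 0) (exp (- (pi * t)))"
    have q: "exp (- pi * t) \<le> exp (- pi)" "exp (- pi * t) < 1" using that by auto
    have S: "0 \<le> S" "S \<le> M"
      using M(2)[OF _ q(1)] sqser_1_ge[OF _ q(2)] by (auto simp: S_def)
    have th: "theta t \<ge> 1" using theta_gt_1[of t] that by simp
    have "\<bar>ltheta t\<bar> = 2 * pi * exp (- pi * t) * S / theta t"
      using S th that by (simp add: ltheta_def dtheta_def S_def[symmetric] abs_mult)
    also have "\<dots> \<le> 2 * pi * exp (- pi * t) * S / 1"
      using S th by (intro divide_left_mono) auto
    also have "\<dots> \<le> 2 * pi * exp (- pi * t) * M"
      using S by (auto intro: mult_left_mono)
    finally have "2 * t * \<bar>ltheta t\<bar> \<le> 2 * t * (2 * pi * exp (- pi * t) * M)"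
      using that by (intro mult_left_mono) auto
    then show ?thesis
      using that by (simp add: abs_mult mult_ac)
  qed
  then show ?thesis using that[of "4 * pi * M"] M(1) by simp
qed

lemma thetac_bound: 
  obtains c where "c \<ge> 0" "\<And>t. t \<ge> 1 \<Longrightarrow> thetac t ^ 4 \<le> c * exp (- pi * t)"
proof -
  have "exp (- pi / 4) < 1" by simp
  then obtain M where M: "M \<ge> 1" "\<And>q. 0 \<le> q \<Longrightarrow> q \<le> exp (- pi / 4) \<Longrightarrow> sqser (Suc 0) q \<le> M"
    using sqser_1_bounded by metis
  have "thetac t ^ 4 \<le> (2 * M) ^ 4 * exp (- pi * t)" if "t \<ge> 1" for t
  proof -
    define q where "q = exp (- pi * (t / 4))"
    have q: "0 < q" "q \<le> exp (- pi / 4)" "q < 1" using that by (auto simp: q_def)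
    \<comment> \<open>The mean value theorem bounds \<open>sqser 0 q - 1\<close> by a multiple of
      the nome \<open>q\<close> at \<open>t / 4\<close>, and
      \<open>q ^ 4 = exp (- pi * t)\<close>.\<close>
    have "\<exists>z>0. z < q \<and> sqser 0 q - sqser 0 0 = (q - 0) * sqser (Suc 0) z"
      using q by (intro MVT2) (auto intro!: DERIV_sqser)
    then obtain z where z: "0 < z" "z < q" "sqser 0 q - 1 = q * sqser (Suc 0) z"
      by auto
    have "sqser 0 q - 1 \<le> q * M"
      using z q M(2)[of z] by simp
    then have "2 * (sqser 0 q - 1) \<le> 2 * (q * M)" by (rule mult_left_mono) simp
    moreover have "thetac t \<le> 2 * (sqser 0 q - 1)"
      using theta_gt_1[of t] theta_eq[of "t / 4"] that by (simp add: thetac_def q_def)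
    ultimately have "thetac t \<le> 2 * (q * M)" by (rule order_trans[rotated])
    then have "thetac t \<le> 2 * M * q" by (simp add: mult_ac)
    then have "thetac t ^ 4 \<le> (2 * M * q) ^ 4"
      using thetac_pos[of t] that by (intro power_mono) auto
    also have "q ^ 4 = exp (- pi * t)"
      unfolding q_def exp_of_nat_mult[symmetric] by simp
    then have "(2 * M * q) ^ 4 = (2 * M) ^ 4 * exp (- pi * t)"
      by (simp add: power_mult_distrib)
    finally show ?thesis .
  qed
  then show ?thesis using that[of "(2 * M) ^ 4"] by simp
qed

lemma Xth_bounded: obtains c where "\<And>u. \<bar>Xth u\<bar> \<le> c"
proof -
  obtain c where c: "c \<ge> 0" "\<And>t. t \<ge> 1 \<Longrightarrow> \<bar>2 * t * ltheta t\<bar> \<le> c * (t * exp (- pi * t))"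
    using t_ltheta_bound by blast
  have "\<bar>Xth \<bar>u\<bar>\<bar> \<le> 1 / 2 + c" for u
  proof -
    define t where "t = exp (2 * \<bar>u\<bar>)"
    have t: "t \<ge> 1" by (simp add: t_def)
    have "t * 1 \<le> pi * t" using t pi_gt3 by simp
    then have "t \<le> exp (pi * t)"
      using exp_ge_add_one_self[of "pi * t"] by linarith
    then have "t * exp (- pi * t) \<le> 1"
      by (simp add: exp_minus field_simps)
    then have "\<bar>2 * t * ltheta t\<bar> \<le> c * 1"
      using c(2)[OF t] mult_left_mono[OF _ c(1)] by (meson order_trans)
    then show ?thesis
      unfolding Xth_def t_def[symmetric] by linarith
  qed
  moreover have "\<bar>Xth \<bar>u\<bar>\<bar> = \<bar>Xth u\<bar>" for u
    using Xth_minus[of u] by (simp add: abs_if)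
  ultimately show ?thesis using that by metis
qed

lemma moderate_Xth: "moderate (\<lambda>u. complex_of_real (Xth u))"
proof -
  obtain c where "\<And>u. \<bar>Xth u\<bar> \<le> c" using Xth_bounded by blast
  then show ?thesis
    unfolding moderate_def by (intro exI[of _ 0] exI[of _ c]) simp
qed

lemma rapid_Rth: "rapid (\<lambda>u. complex_of_real (Rth u))"
proof -
  obtain c where c: "c \<ge> 0" "\<And>t. t \<ge> 1 \<Longrightarrow> \<bar>2 * t * ltheta t\<bar> \<le> c * (t * exp (- pi * t))"
    using t_ltheta_bound by blast
  obtain d where d: "\<And>u. \<bar>Xth u\<bar> \<le> d" using Xth_bounded by blast
  have d0: "d \<ge> 0" using order_trans[OF abs_ge_zero d[of 0]] .
  show ?thesis
  proof (rule rapidI_nome[where c = "(d + 1) * c" and k = 1])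
    fix u :: real assume "u \<ge> 0"
    then have t: "exp (2 * u) \<ge> 1" by simp
    \<comment> \<open>\<open>Rth\<close> factors as \<open>(Xth + 1/2) * (Xth - 1/2)\<close>; the
      first factor is bounded and the second decays with the nome.\<close>
    have "Rth u = (Xth u + 1 / 2) * (2 * exp (2 * u) * ltheta (exp (2 * u)))"
      by (simp add: Rth_def Xth_def power2_eq_square algebra_simps)
    also have "\<bar>\<dots>\<bar> \<le> (d + 1) * (c * (exp (2 * u) * exp (- pi * exp (2 * u))))"
      unfolding abs_mult[of "Xth u + 1 / 2"] using c(2)[OF t] d[of u] d0
      by (intro mult_mono) auto
    finally show "\<bar>Rth u\<bar> \<le> (d + 1) * c * (exp (2 * u) ^ 1 * exp (- pi * exp (2 * u)))"
      by (simp add: mult.assoc)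
  qed (use c d0 in \<open>auto simp: Rth_minus\<close>)
qed

lemma theta_parts_le: 
  assumes "t \<ge> 1" shows "thetab t ^ 4 \<le> theta 1 ^ 4" "thetac t ^ 4 \<le> theta 1 ^ 4"
proof -
  have t: "t > 0" using assms by simp
  show "thetab t ^ 4 \<le> theta 1 ^ 4"
    using thetab_less_theta[OF t] thetab_pos[OF t] theta_le_theta_1[OF assms] by (intro power_mono) auto
  show "thetac t ^ 4 \<le> theta 1 ^ 4"
    using thetac_less_theta[OF t] thetac_pos[OF t] theta_le_theta_1[OF assms] by (intro power_mono) auto
qed

lemma rapid_Eth: "rapid (\<lambda>u. complex_of_real (Eth u))"
proof -
  obtain c where c: "c \<ge> 0" "\<And>t. t \<ge> 1 \<Longrightarrow> thetac t ^ 4 \<le> c * exp (- pi * t)"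
    using thetac_bound by blast
  show ?thesis
  proof (rule rapidI_nome[where c = "pi\<^sup>2 / 4 * (theta 1 ^ 4 * c)" and k = 2])
    fix u :: real assume "u \<ge> 0"
    define t where "t = exp (2 * u)"
    have t: "t \<ge> 1" using \<open>u \<ge> 0\<close> by (simp add: t_def)
    have "thetab t ^ 4 * thetac t ^ 4 \<le> theta 1 ^ 4 * (c * exp (- pi * t))"
      using theta_parts_le[OF t] c(2)[OF t] by (intro mult_mono) auto
    then have "pi\<^sup>2 / 4 * t\<^sup>2 * (thetab t ^ 4 * thetac t ^ 4) \<le> pi\<^sup>2 / 4 * t\<^sup>2 * (theta 1 ^ 4 * (c * exp (- pi * t)))"
      by (intro mult_left_mono) auto
    moreover have E: "Eth u = pi\<^sup>2 / 4 * t\<^sup>2 * (thetab t ^ 4 * thetac t ^ 4)"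
      unfolding Eth_def Bth_def Cth_def t_def[symmetric] by (simp add: power2_eq_square)
    moreover have "Eth u \<ge> 0" unfolding E by simp
    ultimately show "\<bar>Eth u\<bar> \<le> pi\<^sup>2 / 4 * (theta 1 ^ 4 * c) * (exp (2 * u) ^ 2 * exp (- pi * exp (2 * u)))"
      unfolding t_def[symmetric] by (simp add: mult_ac)
  qed (use c in \<open>auto simp: Eth_minus\<close>)
qed

text \<open>Only an exponential bound is available: \<open>Bth\<close> grows like
  \<open>exp (2 * u)\<close> at infinity, because \<open>thetab\<close> tends to 1.\<close>

lemma moderate_Vth: "moderate (\<lambda>u. complex_of_real (Vth u))"
proof -
  have "\<bar>Vth \<bar>u\<bar>\<bar> \<le> pi * theta 1 ^ 4 * exp (2 * \<bar>u\<bar>)" for u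
  proof -
    define t where "t = exp (2 * \<bar>u\<bar>)"
    have t: "t \<ge> 1" by (simp add: t_def)
    have "\<bar>thetac t ^ 4 - thetab t ^ 4\<bar> \<le> 2 * theta 1 ^ 4"
    proof -
      have "0 \<le> thetac t ^ 4" "0 \<le> thetab t ^ 4" by simp_all
      then show ?thesis using theta_parts_le[OF t] by linarith
    qed
    then have "pi / 2 * t * \<bar>thetac t ^ 4 - thetab t ^ 4\<bar> \<le> pi / 2 * t * (2 * theta 1 ^ 4)"
      using t by (intro mult_left_mono) auto
    moreover have "\<bar>Vth \<bar>u\<bar>\<bar> = pi / 2 * t * \<bar>thetac t ^ 4 - thetab t ^ 4\<bar>"
      unfolding Vth_def Bth_def Cth_def t_def[symmetric] right_diff_distrib[symmetric]
      using t by (simp add: abs_mult)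
    ultimately have "\<bar>Vth \<bar>u\<bar>\<bar> \<le> pi / 2 * t * (2 * theta 1 ^ 4)"
      by (simp only:)
    then show ?thesis
      by (simp add: t_def mult_ac)
  qed
  moreover have "\<bar>Vth \<bar>u\<bar>\<bar> = \<bar>Vth u\<bar>" for u
    using Vth_minus[of u] by (simp add: abs_if)
  ultimately show ?thesis
    unfolding moderate_def by (intro exI[of _ 2] exI[of _ "pi * theta 1 ^ 4"]) simp
qed

lemma gth_bounds: "\<bar>u\<bar> / 2 \<le> gth u" "gth u \<le> \<bar>u\<bar> / 2 + ln (theta 1)"
proof -
  define t where "t = exp (2 * \<bar>u\<bar>)"
  have t: "t \<ge> 1" by (simp add: t_def)
  have "gth u = gth \<bar>u\<bar>"
    using gth_minus[of u] by (simp add: abs_if)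
  also have "\<dots> = \<bar>u\<bar> / 2 + ln (theta t)"
    by (simp add: gth_def t_def)
  finally have g: "gth u = \<bar>u\<bar> / 2 + ln (theta t)" .
  have "theta t \<ge> 1" using theta_gt_1[of t] t by simp
  then show "\<bar>u\<bar> / 2 \<le> gth u" "gth u \<le> \<bar>u\<bar> / 2 + ln (theta 1)"
    unfolding g using theta_le_theta_1[OF t] by (auto intro!: ln_mono)
qed

lemma moderate_exp_gth: "moderate (\<lambda>u. exp (w * complex_of_real (gth u)))"
proof -
  have "norm (exp (w * complex_of_real (gth u))) \<le> exp (\<bar>Re w\<bar> * ln (theta 1)) * exp (\<bar>Re w\<bar> / 2 * \<bar>u\<bar>)" for u
  proof -
    have "Re w * gth u \<le> \<bar>Re w\<bar> * (\<bar>u\<bar> / 2 + ln (theta 1))"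
      using gth_bounds[of u] by (intro mult_mono) auto
    then show ?thesis
      by (simp add: exp_add[symmetric] algebra_simps)
  qed
  then show ?thesis unfolding moderate_def by blast
qed

lemmas theta_isCont = DERIV_gth[THEN DERIV_isCont] DERIV_Xth[THEN DERIV_isCont] DERIV_Rth[THEN DERIV_isCont]
  DERIV_Eth[THEN DERIV_isCont] DERIV_Vth[THEN DERIV_isCont]

lemma theta_measurable [measurable]:
  "gth \<in> borel_measurable borel" "Xth \<in> borel_measurable borel" "Rth \<in> borel_measurable borel"
  "Eth \<in> borel_measurable borel" "Vth \<in> borel_measurable borel"
  by (auto intro!: borel_measurable_continuous_onI continuous_at_imp_continuous_on theta_isCont)

section \<open>The entire extension\<close>

text \<open>The function \<open>H_w\<close> of the overview, with
  \<open>g'' = 2 * (Rth + Eth)\<close> and \<open>g'^2 - 1/4 = Rth\<close> inserted.\<close>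

definition Hth :: "complex \<Rightarrow> real \<Rightarrow> complex" where
  "Hth w u = exp (w * complex_of_real (gth u)) * (((2 + w) * complex_of_real (Rth u) + 2 * complex_of_real (Eth u)) / 2)"

text \<open>The coefficient of \<open>Xth * Rth\<close> is \<open>(w + 2) * (w + 4) / 2\<close>:
  here \<open>w\<close> comes from the exponential and 4 from the derivative of \<open>Rth\<close>.
  The coefficient \<open>3 w + 12\<close> of \<open>Xth * Eth\<close> collects \<open>w\<close>,
  \<open>2 * (w + 2)\<close> and 8.\<close>

definition Hth1 :: "complex \<Rightarrow> real \<Rightarrow> complex" where
  "Hth1 w u = exp (w * complex_of_real (gth u)) *
     ((w\<^sup>2 + 6 * w + 8) / 2 * (complex_of_real (Xth u) * complex_of_real (Rth u))
      + ((3 * w + 12) * complex_of_real (Xth u) + 4 * complex_of_real (Vth u)) * complex_of_real (Eth u))"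

text \<open>Left as the product rule produces it: checking the derivative needs only distributivity
  and reordering, and every summand visibly keeps a factor \<open>Rth\<close> or
  \<open>Eth\<close>.\<close>

definition Hth2 :: "complex \<Rightarrow> real \<Rightarrow> complex" where
  "Hth2 w u = exp (w * complex_of_real (gth u)) *
     (w * complex_of_real (Xth u) *
       ((w\<^sup>2 + 6 * w + 8) / 2 * (complex_of_real (Xth u) * complex_of_real (Rth u))
        + ((3 * w + 12) * complex_of_real (Xth u) + 4 * complex_of_real (Vth u)) * complex_of_real (Eth u))
      + ((w\<^sup>2 + 6 * w + 8) / 2 *
          (complex_of_real (Xth u) * (4 * complex_of_real (Xth u) * (complex_of_real (Rth u) + complex_of_real (Eth u)))
           + 2 * (complex_of_real (Rth u) + complex_of_real (Eth u)) * complex_of_real (Rth u))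
      + (((3 * w + 12) * complex_of_real (Xth u) + 4 * complex_of_real (Vth u)) *
           (4 * complex_of_real (Eth u) * (2 * complex_of_real (Xth u) + complex_of_real (Vth u)))
         + ((3 * w + 12) * (2 * (complex_of_real (Rth u) + complex_of_real (Eth u)))
            + 4 * (4 * complex_of_real (Xth u) * complex_of_real (Vth u) + - 8 * complex_of_real (Eth u))) * complex_of_real (Eth u))))"

lemma has_vector_derivative_exp_gth:
  "((\<lambda>u. exp (w * complex_of_real (gth u))) has_vector_derivative
     exp (w * complex_of_real (gth u)) * (w * complex_of_real (Xth u))) (at u)"
proof -
  have "((\<lambda>z. exp (w * z)) has_field_derivative exp (w * complex_of_real (gth u)) * w) (at (complex_of_real (gth u)))"
    by (auto intro!: derivative_eq_intros)
  from field_vector_diff_chain_at[OF has_vector_derivative_of_real[OF DERIV_gth] this]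
  show ?thesis
    by (simp add: o_def mult_ac)
qed

lemma complex_theta_derivs:
  "((\<lambda>u. complex_of_real (Xth u)) has_vector_derivative 2 * (complex_of_real (Rth u) + complex_of_real (Eth u))) (at u)"
  "((\<lambda>u. complex_of_real (Rth u)) has_vector_derivative
     4 * complex_of_real (Xth u) * (complex_of_real (Rth u) + complex_of_real (Eth u))) (at u)"
  "((\<lambda>u. complex_of_real (Eth u)) has_vector_derivative
     4 * complex_of_real (Eth u) * (2 * complex_of_real (Xth u) + complex_of_real (Vth u))) (at u)"
  "((\<lambda>u. complex_of_real (Vth u)) has_vector_derivative
     4 * complex_of_real (Xth u) * complex_of_real (Vth u) + - 8 * complex_of_real (Eth u)) (at u)"
  using has_vector_derivative_of_real[OF DERIV_Xth, where 'a = complex]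
    has_vector_derivative_of_real[OF DERIV_Rth, where 'a = complex]
    has_vector_derivative_of_real[OF DERIV_Eth, where 'a = complex]
    has_vector_derivative_of_real[OF DERIV_Vth, where 'a = complex] by simp_all

lemma Hth_deriv: "(Hth w has_vector_derivative Hth1 w u) (at u)"
  unfolding Hth_def[abs_def]
  by (rule has_vector_derivative_eq_rhs[OF has_vector_derivative_mult[OF has_vector_derivative_exp_gth
        has_vector_derivative_divide[OF has_vector_derivative_add[OF
          has_vector_derivative_mult_right[OF complex_theta_derivs(2)]
          has_vector_derivative_mult_right[OF complex_theta_derivs(3)]]]]])
     (simp add: Hth1_def field_simps power2_eq_square)

lemma Hth1_deriv: "(Hth1 w has_vector_derivative Hth2 w u) (at u)"
  unfolding Hth1_def[abs_def]
  by (rule has_vector_derivative_eq_rhs[OF has_vector_derivative_mult[OF has_vector_derivative_exp_gth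
        has_vector_derivative_add[OF
          has_vector_derivative_mult_right[OF has_vector_derivative_mult[OF complex_theta_derivs(1,2)]]
          has_vector_derivative_mult[OF has_vector_derivative_add[OF
              has_vector_derivative_mult_right[OF complex_theta_derivs(1)]
              has_vector_derivative_mult_right[OF complex_theta_derivs(4)]] complex_theta_derivs(3)]]]])
     (simp only: Hth2_def distrib_left mult_ac add_ac)

lemma rapid_Hth: "rapid (Hth w)" "rapid (Hth1 w)" "rapid (Hth2 w)"
proof -
  note R = rapid_Rth and E = rapid_Eth and X = moderate_Xth and V = moderate_Vth
  note c = moderate_const
  have ew: "rapid f \<Longrightarrow> rapid (\<lambda>u. exp (w * complex_of_real (gth u)) * f u)" for f
    by (rule rapid_mult'[OF moderate_exp_gth])
  have cm: "rapid f \<Longrightarrow> rapid (\<lambda>u. a * f u)" for a f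
    by (rule rapid_mult'[OF c])
  have S: "rapid (\<lambda>u. complex_of_real (Rth u) + complex_of_real (Eth u))"
    by (rule rapid_add[OF R E])
  have P: "moderate (\<lambda>u. (3 * w + 12) * complex_of_real (Xth u) + 4 * complex_of_real (Vth u))"
    by (rule moderate_add[OF moderate_mult[OF c X] moderate_mult[OF c V]])
  have in1: "rapid (\<lambda>u. (w\<^sup>2 + 6 * w + 8) / 2 * (complex_of_real (Xth u) * complex_of_real (Rth u))
      + ((3 * w + 12) * complex_of_real (Xth u) + 4 * complex_of_real (Vth u)) * complex_of_real (Eth u))"
    by (rule rapid_add[OF cm[OF rapid_mult'[OF X R]] rapid_mult'[OF P E]])
  show "rapid (Hth w)"
    unfolding Hth_def[abs_def] divide_inverse
    by (rule ew[OF rapid_mult[OF rapid_add[OF cm[OF R] cm[OF E]] c]])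
  show "rapid (Hth1 w)"
    unfolding Hth1_def[abs_def] by (rule ew[OF in1])
  have T1: "rapid (\<lambda>u. w * complex_of_real (Xth u) *
       ((w\<^sup>2 + 6 * w + 8) / 2 * (complex_of_real (Xth u) * complex_of_real (Rth u))
        + ((3 * w + 12) * complex_of_real (Xth u) + 4 * complex_of_real (Vth u)) * complex_of_real (Eth u)))"
    by (rule rapid_mult'[OF moderate_mult[OF c X] in1])
  have T2: "rapid (\<lambda>u. (w\<^sup>2 + 6 * w + 8) / 2 *
          (complex_of_real (Xth u) * (4 * complex_of_real (Xth u) * (complex_of_real (Rth u) + complex_of_real (Eth u)))
           + 2 * (complex_of_real (Rth u) + complex_of_real (Eth u)) * complex_of_real (Rth u)))"
    by (rule cm[OF rapid_add[OF rapid_mult'[OF X rapid_mult'[OF moderate_mult[OF c X] S]]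
          rapid_mult[OF cm[OF S] rapid_moderate[OF R]]]])
  have T3: "rapid (\<lambda>u. ((3 * w + 12) * complex_of_real (Xth u) + 4 * complex_of_real (Vth u)) *
           (4 * complex_of_real (Eth u) * (2 * complex_of_real (Xth u) + complex_of_real (Vth u)))
         + ((3 * w + 12) * (2 * (complex_of_real (Rth u) + complex_of_real (Eth u)))
            + 4 * (4 * complex_of_real (Xth u) * complex_of_real (Vth u) + - 8 * complex_of_real (Eth u))) * complex_of_real (Eth u))"
    by (rule rapid_add[OF rapid_mult'[OF P rapid_mult[OF cm[OF E] moderate_add[OF moderate_mult[OF c X] V]]]
          rapid_mult'[OF moderate_add[OF rapid_moderate[OF cm[OF cm[OF S]]]
              moderate_mult[OF c moderate_add[OF moderate_mult[OF moderate_mult[OF c X] V] rapid_moderate[OF cm[OF E]]]]] E]])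
  show "rapid (Hth2 w)"
    unfolding Hth2_def[abs_def] by (rule ew[OF rapid_add[OF T1 rapid_add[OF T2 T3]]])
qed

lemma Hth2_isCont: "isCont (Hth2 w) u"
  unfolding Hth2_def[abs_def] by (intro continuous_intros theta_isCont)

section \<open>The entire function and its mean on the line\<close>

definition Xi :: "complex \<Rightarrow> complex \<Rightarrow> complex" where
  "Xi w s = (LBINT u. Hth w u * exp (complex_of_real u * (w / 2 - s)))"

lemma Xi_line: 
  "Xi w (w / 2 + \<i> * complex_of_real x) = (LBINT u. Hth w u * exp (- (\<i> * complex_of_real (u * x))))"
  unfolding Xi_def by (rule Bochner_Integration.integral_cong) (auto simp: algebra_simps)

lemma Xi_integral:
  "integrable lborel (\<lambda>x. Xi w (w / 2 + \<i> * complex_of_real x))"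
  "(LBINT x. Xi w (w / 2 + \<i> * complex_of_real x)) = 2 * pi * Hth w 0"
proof -
  obtain K0 K1 K2 where K: "K0 \<ge> 0" "K1 \<ge> 0" "K2 \<ge> 0" "\<And>u. norm (Hth w u) \<le> K0 * inverse (1 + u\<^sup>2)"
    "\<And>u. norm (Hth1 w u) \<le> K1 * inverse (1 + u\<^sup>2)" "\<And>u. norm (Hth2 w u) \<le> K2 * inverse (1 + u\<^sup>2)"
    using rapid_cauchy_bound rapid_Hth by metis
  define K where "K = K0 + K1 + K2"
  have mono: "k * inverse (1 + u\<^sup>2) \<le> K * inverse (1 + u\<^sup>2)" if "k \<le> K" for k u :: real
    using that by (intro mult_right_mono) (auto simp: add_nonneg_nonneg)
  have b: "norm (Hth w u) \<le> K * inverse (1 + u\<^sup>2)" "norm (Hth1 w u) \<le> K * inverse (1 + u\<^sup>2)"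
     "norm (Hth2 w u) \<le> K * inverse (1 + u\<^sup>2)" for u
    by (rule order_trans[OF K(4) mono] order_trans[OF K(5) mono] order_trans[OF K(6) mono];
        use K(1-3) in \<open>simp add: K_def\<close>)+
  show "integrable lborel (\<lambda>x. Xi w (w / 2 + \<i> * complex_of_real x))"
    "(LBINT x. Xi w (w / 2 + \<i> * complex_of_real x)) = 2 * pi * Hth w 0"
    unfolding Xi_line using fourier_inversion_0[OF Hth_deriv Hth1_deriv Hth2_isCont b] by auto
qed

lemma exponent_bounds:
  obtains c where "\<And>u. \<bar>gth u + u / 2\<bar> \<le> c * (1 + \<bar>u\<bar>)" "\<And>u. \<bar>- u\<bar> \<le> c * (1 + \<bar>u\<bar>)"
proof -
  define L where "L = ln (theta 1)"
  have L: "L \<ge> 0" using theta_gt_1[of 1] by (simp add: L_def)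
  have "\<bar>gth u + u / 2\<bar> \<le> (1 + L) * (1 + \<bar>u\<bar>)" "\<bar>- u\<bar> \<le> (1 + L) * (1 + \<bar>u\<bar>)" for u
  proof -
    have e: "(1 + L) * (1 + \<bar>u\<bar>) = 1 + \<bar>u\<bar> + L + L * \<bar>u\<bar>" by (simp add: algebra_simps)
    have Lu: "0 \<le> L * \<bar>u\<bar>" using L by simp
    have "0 \<le> gth u + u / 2" "gth u + u / 2 \<le> \<bar>u\<bar> + L"
      using gth_bounds[of u] unfolding L_def[symmetric] by linarith+
    then show "\<bar>gth u + u / 2\<bar> \<le> (1 + L) * (1 + \<bar>u\<bar>)"
      unfolding e using L Lu by linarith
    show "\<bar>- u\<bar> \<le> (1 + L) * (1 + \<bar>u\<bar>)"
      unfolding e using L Lu by linarith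
  qed
  then show ?thesis using that by blast
qed

text \<open>The exponent \<open>w * gth u + u * (w/2 - s)\<close> equals
  \<open>w * (gth u + u/2) - s * u\<close>, linear in \<open>(w, s)\<close>. Pulling the factor
  \<open>(2 + w) / 2\<close> out leaves two integrals whose rapid weights \<open>Rth\<close> and
  \<open>Eth\<close> do not involve \<open>w\<close>.\<close>

lemma Xi_integrable: "integrable lborel (\<lambda>u. Hth w u * exp (complex_of_real u * (w / 2 - s)))"
  and entire2_Xi: "entire2 Xi"
proof -
  obtain c where c: "\<And>u. \<bar>gth u + u / 2\<bar> \<le> c * (1 + \<bar>u\<bar>)" "\<And>u. \<bar>- u\<bar> \<le> c * (1 + \<bar>u\<bar>)"
    using exponent_bounds by blast
  define I where "I = (\<lambda>(f :: real \<Rightarrow> real) z. LBINT u. complex_of_real (f u) *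
      exp (fst z * complex_of_real (gth u + u / 2) + snd z * complex_of_real (- u)))"
  have fact1: "integrable lborel (\<lambda>u. complex_of_real (f u) *
      exp (w * complex_of_real (gth u + u / 2) + s * complex_of_real (- u)))"
    and fact2: "\<exists>a b. (I f has_derivative (\<lambda>h. a * fst h + b * snd h)) (at (w, s))"
    if "rapid (\<lambda>u. complex_of_real (f u))" and [measurable]: "f \<in> borel_measurable borel" for f w s
    unfolding I_def
    using exponential_integral_has_derivative[of "\<lambda>u. complex_of_real (f u)" "\<lambda>u. gth u + u / 2" "\<lambda>u. - u" c w s]
      rapid_weighted_integrable[OF that(1)] c by auto
  have split: "Hth w u * exp (complex_of_real u * (w / 2 - s)) =
      (2 + w) / 2 * (complex_of_real (Rth u) * exp (w * complex_of_real (gth u + u / 2) + s * complex_of_real (- u)))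
      + complex_of_real (Eth u) * exp (w * complex_of_real (gth u + u / 2) + s * complex_of_real (- u))" for w s u
  proof -
    have "exp (w * complex_of_real (gth u + u / 2) + s * complex_of_real (- u))
        = exp (w * complex_of_real (gth u)) * exp (complex_of_real u * (w / 2 - s))"
      unfolding exp_add[symmetric] by (simp add: algebra_simps)
    then show ?thesis
      unfolding Hth_def by (simp add: field_simps)
  qed
  show "integrable lborel (\<lambda>u. Hth w u * exp (complex_of_real u * (w / 2 - s)))" for w s
    unfolding split using fact1[OF rapid_Rth] fact1[OF rapid_Eth] by simp
  have Xi: "Xi w s = (2 + w) / 2 * I Rth (w, s) + I Eth (w, s)" for w s
    unfolding Xi_def split I_def using fact1[OF rapid_Rth] fact1[OF rapid_Eth] by simp
  show "entire2 Xi"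
    unfolding entire2_def
  proof (intro allI)
    fix w s
    obtain a b where ab: "(I Rth has_derivative (\<lambda>h. a * fst h + b * snd h)) (at (w, s))"
      using fact2[OF rapid_Rth theta_measurable(3)] by blast
    obtain a' b' where ab': "(I Eth has_derivative (\<lambda>h. a' * fst h + b' * snd h)) (at (w, s))"
      using fact2[OF rapid_Eth theta_measurable(4)] by blast
    have l: "((\<lambda>p. (2 + fst p) / 2) has_derivative (\<lambda>h. fst h / 2)) (at (w, s))"
      by (auto intro!: derivative_eq_intros)
    have "((\<lambda>p. (2 + fst p) / 2 * I Rth p + I Eth p) has_derivative
        (\<lambda>h. ((2 + w) / 2 * a + I Rth (w, s) / 2 + a') * fst h + ((2 + w) / 2 * b + b') * snd h)) (at (w, s))"
      by (rule has_derivative_eq_rhs[OF has_derivative_add[OF has_derivative_mult[OF l ab] ab']])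
         (simp add: fun_eq_iff field_simps)
    then have "((\<lambda>p. Xi (fst p) (snd p)) has_derivative
        (\<lambda>h. ((2 + w) / 2 * a + I Rth (w, s) / 2 + a') * fst h + ((2 + w) / 2 * b + b') * snd h)) (at (w, s))"
      by (simp add: Xi)
    then show "\<exists>a b. ((\<lambda>p. Xi (fst p) (snd p)) has_derivative (\<lambda>h. a * fst h + b * snd h)) (at (w, s))"
      by blast
  qed
qed

section \<open>Agreement with the defining integral in its region of convergence\<close>

lemma integrable_exp_abs:
  assumes "d > 0" shows "integrable lborel (\<lambda>u::real. exp (- d * \<bar>u\<bar>))"
proof (rule Bochner_Integration.integrable_bound)
  show "integrable lborel (\<lambda>u::real. 2 * inverse (1 + (0 + d * u)\<^sup>2))"
    using lborel_integrable_real_affine[OF integrable_cauchy, of d 0] assms by simp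
  show "AE u in lborel. norm (exp (- d * \<bar>u\<bar>)) \<le> norm (2 * inverse (1 + (0 + d * u)\<^sup>2))"
  proof (rule AE_I2)
    fix u
    have "exp (- \<bar>d * u\<bar>) \<le> 2 * inverse (1 + (d * u)\<^sup>2)" by (rule exp_minus_abs_le)
    then show "norm (exp (- d * \<bar>u\<bar>)) \<le> norm (2 * inverse (1 + (0 + d * u)\<^sup>2))"
      using assms by (simp add: abs_mult)
  qed
qed simp

lemma LBINT_ln_substitution:
  fixes f :: "real \<Rightarrow> complex"
  assumes f: "integrable lborel f" and c: "continuous_on UNIV f"
  shows "(LBINT t:{0<..}. f (ln t) / complex_of_real t) = (LBINT u. f u)"
proof -
  define g where "g = (\<lambda>t. f (ln t) / complex_of_real t)"
  have fm: "f \<in> borel_measurable borel" using c by (rule borel_measurable_continuous_onI)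
  have fa: "f absolutely_integrable_on UNIV"
    unfolding set_integrable_def using f fm by (subst integrable_completion) auto
  have "continuous_on {0<..} g"
    unfolding g_def by (intro continuous_intros continuous_on_compose2[OF c]) auto
  then have gm: "(\<lambda>t. indicat_real {0<..} t *\<^sub>R g t) \<in> borel_measurable borel"
    by (intro borel_measurable_continuous_on_indicator) auto
  have r: "range exp = {0::real<..}"
    by (auto simp: image_iff) (metis exp_ln)
  have e: "\<bar>exp u\<bar> *\<^sub>R g (exp u) = f u" for u
    by (simp add: g_def scaleR_conv_of_real)
  have inj: "inj (exp :: real \<Rightarrow> real)"
    by (simp add: inj_on_def)
  have "g absolutely_integrable_on {0<..} \<and> integral {0<..} g = integral UNIV f"
    using has_absolute_integral_change_of_variables_real[of UNIV exp exp g "integral UNIV f"] fa inj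
    unfolding e r by (auto intro!: derivative_eq_intros)
  then have g: "g absolutely_integrable_on {0<..}" "integral {0<..} g = integral UNIV f" by auto
  have "(LINT t:{0<..}|lborel. g t) = (LINT t:{0<..}|lebesgue. g t)"
    unfolding set_lebesgue_integral_def using gm by (subst integral_completion) auto
  also have "\<dots> = integral UNIV f"
    using set_lebesgue_integral_eq_integral(2)[OF g(1)] g(2) by simp
  also have "\<dots> = (LBINT u. f u)"
    using integral_lborel[OF f] by simp
  finally show ?thesis by (simp add: g_def)
qed

lemma Xi_eq_Z_Q_integral:
  assumes "Re w < Re s" "Re s < 0"
  shows "Xi w s = s * (s - w) / (2 * w) * Z_Q_integral w s"
proof -
  define k where "k = w / 2 - s"
  define F where "F = (\<lambda>u. exp (w * complex_of_real (gth u)) * exp (complex_of_real u * k))"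
  \<comment> \<open>These are the decay rates of \<open>F\<close> at plus and minus infinity. As
    \<open>Re w\<close> is negative, the lower bound on \<open>gth\<close> applies, and the two
    inequalities of the region say that both rates are positive.\<close>
  define d where "d = min (Re s - Re w) (- Re s)"
  have d: "d > 0" using assms by (simp add: d_def)
  have w0: "w \<noteq> 0" using assms by auto
  have Fb: "norm (F u) \<le> exp (- d * \<bar>u\<bar>)" for u
  proof -
    have "Re w * gth u \<le> Re w * (\<bar>u\<bar> / 2)"
      using gth_bounds(1)[of u] assms by (intro mult_left_mono_neg) auto
    then have "Re w * gth u + u * (Re w / 2 - Re s) \<le> Re w * (\<bar>u\<bar> / 2) + u * (Re w / 2 - Re s)" by simp
    also have "\<dots> \<le> - d * \<bar>u\<bar>"
    proof (cases "u \<ge> 0")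
      case True
      have "d * u \<le> (Re s - Re w) * u" using True by (intro mult_right_mono) (auto simp: d_def)
      then show ?thesis using True by (simp add: algebra_simps)
    next
      case False
      have "d * (- u) \<le> (- Re s) * (- u)" using False by (intro mult_right_mono) (auto simp: d_def)
      then show ?thesis using False by (simp add: algebra_simps)
    qed
    finally show ?thesis
      by (simp add: F_def k_def norm_mult exp_add[symmetric])
  qed
  have Fc: "isCont F u" for u
    unfolding F_def by (intro continuous_intros theta_isCont)
  then have Fcu: "continuous_on UNIV F"
    by (intro continuous_at_imp_continuous_on) auto
  have Fi: "integrable lborel F"
  proof (rule Bochner_Integration.integrable_bound[OF integrable_exp_abs[OF d]])
    show "F \<in> borel_measurable lborel"
      using Fcu borel_measurable_continuous_onI by simp
    show "AE u in lborel. norm (F u) \<le> norm (exp (- d * \<bar>u\<bar>))"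
      using Fb by (intro AE_I2) simp
  qed
  have Z: "Z_Q_integral w s = (LBINT u. F u)"
  proof -
    have "complex_of_real (theta (t\<^sup>2)) powr s * complex_of_real (theta (1 / t\<^sup>2)) powr (w - s) = F (ln t)"
      if t: "t > 0" for t
    proof -
      have t2: "exp (2 * ln t) = t\<^sup>2" using t by (simp add: exp_double)
      have pos: "theta (t\<^sup>2) > 0" "theta (1 / t\<^sup>2) > 0" using t by (auto intro!: theta_pos)
      have l1: "ln (theta (t\<^sup>2)) = gth (ln t) - ln t / 2"
        by (simp add: gth_def t2)
      have "theta (1 / t\<^sup>2) = t * theta (t\<^sup>2)"
        using theta_inversion[of "t\<^sup>2"] t by simp
      then have l2: "ln (theta (1 / t\<^sup>2)) = gth (ln t) + ln t / 2"
        using t pos by (simp add: ln_mult l1)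
      have e: "s * complex_of_real (gth (ln t) - ln t / 2) + (w - s) * complex_of_real (gth (ln t) + ln t / 2)
          = w * complex_of_real (gth (ln t)) + complex_of_real (ln t) * k"
        by (simp add: k_def field_simps)
      have "complex_of_real (theta (t\<^sup>2)) powr s = exp (s * complex_of_real (gth (ln t) - ln t / 2))"
        "complex_of_real (theta (1 / t\<^sup>2)) powr (w - s) = exp ((w - s) * complex_of_real (gth (ln t) + ln t / 2))"
        using pos unfolding powr_def by (simp_all add: Ln_of_real l1 l2)
      then show ?thesis
        unfolding F_def by (simp only: exp_add[symmetric] e)
    qed
    then have "Z_Q_integral w s = (LBINT t:{0<..}. F (ln t) / complex_of_real t)"
      unfolding Z_Q_integral_def by (intro set_lebesgue_integral_cong) auto
    also have "\<dots> = (LBINT u. F u)"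
      by (rule LBINT_ln_substitution[OF Fi Fcu])
    finally show ?thesis .
  qed
  have Hi: "integrable lborel (\<lambda>u. Hth w u * exp (complex_of_real u * k))"
    unfolding k_def by (rule Xi_integrable)
  \<comment> \<open>Both integrations by parts are done at once. Since
    \<open>F' = (w * Xth + k) * F\<close>, the derivative of \<open>(w * Xth - k) * F\<close> is
    \<open>(w^2 Xth^2 - k^2 + w Xth') * F\<close>, and this is \<open>f\<close> because
    \<open>k^2 - w^2/4 = s * (s - w)\<close>.\<close>
  define f where "f = (\<lambda>u. 2 * w * (Hth w u * exp (complex_of_real u * k)) - s * (s - w) * F u)"
  have "(LBINT u. f u) = 0"
  proof (rule integral_deriv_eq_0)
    have Fd: "(F has_vector_derivative (w * complex_of_real (Xth u) + k) * F u) (at u)" for u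
    proof -
      have "((\<lambda>z. exp (z * k)) has_field_derivative exp (complex_of_real u * k) * k) (at (complex_of_real u))"
        by (auto intro!: derivative_eq_intros)
      from has_vector_derivative_mult[OF has_vector_derivative_exp_gth has_vector_derivative_real_field[OF this]]
      show ?thesis
        unfolding F_def by (rule has_vector_derivative_eq_rhs) (simp add: algebra_simps)
    qed
    have fe: "f u = (w * complex_of_real (Xth u) - k) * ((w * complex_of_real (Xth u) + k) * F u)
        + w * (2 * (complex_of_real (Rth u) + complex_of_real (Eth u))) * F u" for u
    proof -
      have X2: "complex_of_real (Xth u) * complex_of_real (Xth u) = complex_of_real (Rth u) + 1 / 4"
        unfolding of_real_mult[symmetric] by (simp add: Rth_def power2_eq_square)
      have "f u = (w * ((2 + w) * complex_of_real (Rth u) + 2 * complex_of_real (Eth u)) - s * (s - w)) * F u"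
        by (simp add: f_def F_def Hth_def algebra_simps)
      also have "w * ((2 + w) * complex_of_real (Rth u) + 2 * complex_of_real (Eth u)) - s * (s - w)
         = (w * w * (complex_of_real (Xth u) * complex_of_real (Xth u)) - k * k)
           + w * (2 * (complex_of_real (Rth u) + complex_of_real (Eth u)))"
        unfolding X2 k_def by (simp add: field_simps)
      finally show ?thesis by (simp add: algebra_simps)
    qed
    show "((\<lambda>u. (w * complex_of_real (Xth u) - k) * F u) has_vector_derivative f u) (at u)" for u
      unfolding fe
      by (rule has_vector_derivative_eq_rhs[OF has_vector_derivative_mult[OF
              has_vector_derivative_diff[OF has_vector_derivative_mult_right[OF complex_theta_derivs(1)]
                has_vector_derivative_const] Fd]]) simp
    show "isCont f u" for u
      unfolding f_def Hth_def by (intro continuous_intros theta_isCont Fc) auto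
    show "integrable lborel f"
      unfolding f_def using Fi Hi by simp
    obtain c where c: "\<And>u. \<bar>Xth u\<bar> \<le> c" using Xth_bounded by blast
    have lim: "((\<lambda>u. (w * complex_of_real (Xth u) - k) * F u) \<longlongrightarrow> 0) A"
      if "((\<lambda>u. (norm w * c + norm k) * exp (- d * \<bar>u\<bar>)) \<longlongrightarrow> 0) A" for A
    proof (rule Lim_null_comparison[OF always_eventually that], rule allI)
      fix u
      have "norm (w * complex_of_real (Xth u) - k) \<le> norm w * \<bar>Xth u\<bar> + norm k"
        using norm_triangle_ineq4[of "w * complex_of_real (Xth u)" k] by (simp add: norm_mult)
      also have "\<dots> \<le> norm w * c + norm k"
        using c[of u] by (intro add_right_mono mult_left_mono) auto
      finally have le: "norm (w * complex_of_real (Xth u) - k) \<le> norm w * c + norm k" .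
      show "norm ((w * complex_of_real (Xth u) - k) * F u) \<le> (norm w * c + norm k) * exp (- d * \<bar>u\<bar>)"
        unfolding norm_mult[of "w * complex_of_real (Xth u) - k"]
        using order_trans[OF norm_ge_zero le] by (intro mult_mono le Fb) auto
    qed
    show "((\<lambda>u. (w * complex_of_real (Xth u) - k) * F u) \<longlongrightarrow> 0) at_top"
      by (rule lim) (use d in real_asymp)
    show "((\<lambda>u. (w * complex_of_real (Xth u) - k) * F u) \<longlongrightarrow> 0) at_bot"
      by (rule lim) (use d in real_asymp)
  qed
  then have "2 * w * Xi w s = s * (s - w) * Z_Q_integral w s"
    unfolding f_def Xi_def Z k_def[symmetric] using Fi Hi by simp
  then show ?thesis
    using w0 by (simp add: field_simps)
qed

lemma xi_Q_eq: "xi_Q = Xi"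
  unfolding xi_Q_def
proof (rule the_equality)
  show "entire2 Xi \<and> (\<forall>w s. Re w < Re s \<and> Re s < 0 \<longrightarrow> Xi w s = s * (s - w) / (2 * w) * Z_Q_integral w s)"
    using entire2_Xi Xi_eq_Z_Q_integral by blast
next
  fix f assume f: "entire2 f \<and> (\<forall>w s. Re w < Re s \<and> Re s < 0 \<longrightarrow> f w s = s * (s - w) / (2 * w) * Z_Q_integral w s)"
  then show "f = Xi"
    using Xi_eq_Z_Q_integral by (intro entire2_unique entire2_Xi) auto
qed

text \<open>\<open>Xth\<close> is odd, so \<open>Rth 0 = -1/4\<close>. At \<open>t = 1\<close>
  inversion makes \<open>thetab\<close> and \<open>thetac\<close> equal, so each fourth power is
  half of \<open>theta 1 ^ 4\<close>, and both \<open>Bth\<close> and \<open>Cth\<close> equal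
  \<open>psi2 / 4\<close>.\<close>

lemma Hth_0:
  "Hth w 0 = complex_of_real (theta 1) powr w * ((complex_of_real psi2)\<^sup>2 / 16 - w / 8 - 1 / 4)"
proof -
  have "Xth 0 = 0" using Xth_minus[of 0] by simp
  then have R: "Rth 0 = - (1 / 4)" by (simp add: Rth_def)
  have bc: "thetac 1 = thetab 1" using thetab_inversion[of 1] by simp
  then have "thetab 1 ^ 4 = theta 1 ^ 4 / 2" using jacobi_quartic[of 1] by simp
  then have BC: "Bth 0 = psi2 / 4" "Cth 0 = psi2 / 4"
    by (auto simp: Bth_def Cth_def bc psi2_def)
  have E: "Eth 0 = psi2\<^sup>2 / 16"
    unfolding Eth_def BC by (simp add: power2_eq_square)
  have "exp (w * complex_of_real (gth 0)) = complex_of_real (theta 1) powr w"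
    using theta_pos[of 1] by (simp add: powr_def gth_def Ln_of_real)
  then show ?thesis
    unfolding Hth_def R E by (simp add: field_simps)
qed

theorem theorem7p9:
  shows "psi2 = pi\<^sup>2 / Gamma (3 / 4 :: real) ^ 4 \<and>
    (\<forall>w::complex.
      integrable lborel (\<lambda>x::real. xi_Q w (w / 2 + \<i> * complex_of_real x)) \<and>
      1 / (2 * complex_of_real pi) * (LBINT x. xi_Q w (w / 2 + \<i> * complex_of_real x))
        = complex_of_real (theta 1) powr w
            * ((complex_of_real psi2)\<^sup>2 / 16 - w / 8 - 1 / 4)) \<and>
    integrable lborel M_Q \<and>
    (LBINT x. M_Q x) = complex_of_real (psi2\<^sup>2 / 8 - 1 / 2)"
proof (intro conjI allI)
  show "psi2 = pi\<^sup>2 / Gamma (3 / 4 :: real) ^ 4"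
    unfolding psi2_def theta_1_quartic by (simp add: power2_eq_square)
  show "integrable lborel (\<lambda>x::real. xi_Q w (w / 2 + \<i> * complex_of_real x))" for w
    unfolding xi_Q_eq by (rule Xi_integral)
  show "1 / (2 * complex_of_real pi) * (LBINT x. xi_Q w (w / 2 + \<i> * complex_of_real x))
        = complex_of_real (theta 1) powr w * ((complex_of_real psi2)\<^sup>2 / 16 - w / 8 - 1 / 4)" for w
    unfolding xi_Q_eq Xi_integral(2) Hth_0 by simp
  have M: "M_Q = (\<lambda>x. 1 / complex_of_real pi * Xi 0 (0 / 2 + \<i> * complex_of_real x))"
    by (simp add: M_Q_def xi_Q_eq fun_eq_iff)
  show "integrable lborel M_Q"
    unfolding M by (rule integrable_mult_right[OF Xi_integral(1)])
  have "(LBINT x. M_Q x) = 1 / complex_of_real pi * (2 * pi * Hth 0 0)"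
    unfolding M integral_mult_right_zero Xi_integral(2) ..
  also have "\<dots> = complex_of_real (psi2\<^sup>2 / 8 - 1 / 2)"
    unfolding Hth_0 using theta_pos[of 1] by (simp add: field_simps)
  finally show "(LBINT x. M_Q x) = complex_of_real (psi2\<^sup>2 / 8 - 1 / 2)" .
qed

end
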